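(* Let $b>0$ and $c\le 0$ be the Bona-Smith coefficients, let $T>0$, let $w(x)=(1-x^2)^{\mu}$ for some $-1<\mu<1$, and let $h_i,v_i\in C[0,T]$, $i=1,2$. Suppose that the compatibility conditions $$\eta_0(-1)=h_1(0),\quad \eta_0(1)=h_2(0),\quad u_0(-1)=v_1(0),\quad u_0(1)=v_2(0)$$ hold. Consider the integral system $$\eta(x,t)=H(x,t)+\int_0^t A_D(u+\eta u)\,d\tau,\qquad u(x,t)=U(x,t)+\int_0^t A_D\Big(c\,\eta_{xx}+\eta+\frac{u^2}{2}\Big)d\tau, \qquad (\ast)$$ with $A_D$, $H$, $U$ as defined in the context. Then: (1) If $c<0$ and $\eta_0\in H^2_w$, $u_0\in H^1_w$, there exists $T_0=T_0(T,\|\eta_0\|_{2,w},\|u_0\|_{1,w})\in(0,T]$ such that $(\ast)$ has a unique solution $(\eta,u)\in C^2_{T_0}\times C^1_{T_0}$, and it satisfies $$\|\eta\|_{C^2_{T_0}}+\|\eta_t\|_{C^2_{T_0}}\le C,\qquad \|u\|_{C^1_{T_0}}+\|u_t\|_{C^1_{T_0}}\le C,$$ for some constant $C=C(T_0)$. (2) If $c=0$ and $\eta_0\in H^2_w$, $u_0\in H^2_w$, there exists $T_0=T_0(T,\|\eta_0\|_{2,w},\|u_0\|_{2,w})\in(0,T]$ such that $(\ast)$ has a unique solution $(\eta,u)\in C^2_{T_0}\times C^2_{T_0}$, and it satisfies $$\|\eta\|_{C^2_{T_0}}+\|\eta_t\|_{C^2_{T_0}}\le C,\qquad \|u\|_{C^2_{T_0}}+\|u_t\|_{C^2_{T_0}}\le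 C,$$ for some constant $C=C(T_0)$.
   Context: Coefficients: $b=\frac{3\theta^2-1}{6}>0$, $c=\frac{2-3\theta^2}{3}\le 0$, with $2/3\le\theta^2\le 1$. Weighted spaces: $\Omega=(-1,1)$; for $-1<\mu<1$ and $w(x)=(1-x^2)^\mu$, $L^2_w$ is the space of functions on $\Omega$ square integrable with respect to $w\,dx$, with norm $\|\phi\|_{0,w}=\big(\int_{-1}^1\phi^2 w\,dx\big)^{1/2}$. For an integer $k\ge 0$, $H^k_w$ is the space of functions whose derivatives up to order $k$ are in $L^2_w$, with norm $\|\phi\|_{k,w}^2=\sum_{j=0}^k\|\phi^{(j)}\|_{0,w}^2$ ($H^0_w=L^2_w$; functions in $H^1_w$ are continuous on $[-1,1]$). For $S>0$, $C^m_S$ is the space of continuous functions $f:[0,S]\to H^m_w$ with norm $\|f\|_{C^m_S}=\max_{0\le t\le S}\|f(t)\|_{m,w}$. The operator $A_D$: let $w_1(x)=\sinh\frac{1+x}{\sqrt b}$, $w_2(x)=\sinh\frac{1-x}{\sqrt b}$, $W=w_1w_2'-w_1'w_2$ (a constant), and let $G$ be the Green function $$G(x,\xi)=-\frac{1}{bW}\begin{cases} w_1(\xi)w_2(x), & -1\le\xi\le x,\\ w_1(x)w_2(\xi), & x<\xi\le 1.\end{cases}$$ Then $(A_Df)(x)=\int_{-1}^1 G_\xi(x,\xi)f(\xi)\,d\xi$; this is the solution $v$ of $v-bv''=-f'$ on $[-1,1]$, $v(-1)=v(1)=0$. The functions $H,U$: with $\alpha=\sinh(2/\sqrt b)$, $$H(x,t)=\eta_0(x)+\frac{w_2(x)}{\alpha}(h_1(t)-h_1(0))+\frac{w_1(x)}{\alpha}(h_2(t)-h_2(0)),$$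 $$U(x,t)=u_0(x)+\frac{w_2(x)}{\alpha}(v_1(t)-v_1(0))+\frac{w_1(x)}{\alpha}(v_2(t)-v_2(0)).$$ The system $(\ast)$ is the integral formulation of the initial-boundary-value problem $\eta_t+u_x+(\eta u)_x-b\eta_{xxt}=0$, $u_t+\eta_x+uu_x+c\eta_{xxx}-bu_{xxt}=0$ on $[-1,1]$, with initial data $\eta_0,u_0$ and Dirichlet data $\eta(-1,t)=h_1(t)$, $\eta(1,t)=h_2(t)$, $u(-1,t)=v_1(t)$, $u(1,t)=v_2(t)$.
   Formalization: The bound on η_t is stated when h_1, h_2 are C^1 on [0,T_0], and that on u_t when v_1, v_2 are; for merely continuous data these derivatives need not exist, since η, u equal h_i, v_i at x=±1. T_0 and C are taken for fixed θ, μ, T, h_i, v_i. *)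

theory Defs
  imports "HOL-Analysis.Analysis"
begin

section \<open>Weighted Sobolev spaces on the interval (-1,1)\<close>

abbreviation Omega :: "real set" where
  "Omega \<equiv> {-1<..<1}"

definition weight :: "real \<Rightarrow> real \<Rightarrow> real" where
  "weight mu x = (1 - x\<^sup>2) powr mu"

definition L2w :: "real \<Rightarrow> (real \<Rightarrow> real) set" where
  "L2w mu = {phi. set_borel_measurable lborel Omega phi \<and>
                  set_integrable lborel Omega (\<lambda>x. (phi x)\<^sup>2 * weight mu x)}"

definition L2w_norm :: "real \<Rightarrow> (real \<Rightarrow> real) \<Rightarrow> real" where
  "L2w_norm mu phi = sqrt (LBINT x:Omega. (phi x)\<^sup>2 * weight mu x)"

definition loc_integrable :: "(real \<Rightarrow> real) \<Rightarrow> bool" where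
  "loc_integrable f \<longleftrightarrow> (\<forall>a b. -1 < a \<and> a < b \<and> b < 1 \<longrightarrow> set_integrable lborel {a..b} f)"

text \<open>Test functions are taken of class \<open>C\<^sup>1\<close> with compact support in (-1,1); for locally
  integrable functions this gives the same first-order weak derivative as smooth test functions.\<close>

definition test_fun :: "(real \<Rightarrow> real) \<Rightarrow> bool" where
  "test_fun phi \<longleftrightarrow> (\<forall>x. phi differentiable (at x)) \<and> continuous_on UNIV (deriv phi) \<and>
     (\<exists>a b. -1 < a \<and> a < b \<and> b < 1 \<and> (\<forall>x. x \<notin> {a..b} \<longrightarrow> phi x = 0))"

definition is_weak_deriv :: "(real \<Rightarrow> real) \<Rightarrow> (real \<Rightarrow> real) \<Rightarrow> bool" where
  "is_weak_deriv f g \<longleftrightarrow> loc_integrable f \<and> loc_integrable g \<and>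
     (\<forall>phi. test_fun phi \<longrightarrow>
        (LBINT x:Omega. f x * deriv phi x) = - (LBINT x:Omega. g x * phi x))"

text \<open>A weak derivative is determined only almost everywhere on (-1,1). The function \<open>wderiv\<close>
  picks a representative; it is used only where a weak derivative exists, and only inside
  integrals, so the choice does not matter.\<close>

definition wderiv :: "(real \<Rightarrow> real) \<Rightarrow> real \<Rightarrow> real" where
  "wderiv f = (SOME g. is_weak_deriv f g)"

text \<open>Elements of \<open>H\<^sup>k\<^sub>w\<close> are represented by functions \<open>real \<Rightarrow> real\<close> whose values outside [-1,1]
  are irrelevant. For \<open>k \<ge> 1\<close> an equivalence class has a unique representative that is continuous
  on [-1,1] (here \<open>mu < 1\<close> is used), and we always take that one, so that boundary values make
  sense and uniqueness is equality on [-1,1].\<close>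

definition Hw :: "real \<Rightarrow> nat \<Rightarrow> (real \<Rightarrow> real) set" where
  "Hw mu k = {phi. (\<forall>j<k. \<exists>g. is_weak_deriv ((wderiv ^^ j) phi) g) \<and>
                   (\<forall>j\<le>k. (wderiv ^^ j) phi \<in> L2w mu) \<and>
                   (k \<ge> 1 \<longrightarrow> continuous_on {-1..1} phi)}"

definition Hw_norm :: "real \<Rightarrow> nat \<Rightarrow> (real \<Rightarrow> real) \<Rightarrow> real" where
  "Hw_norm mu k phi = sqrt (\<Sum>j\<le>k. (L2w_norm mu ((wderiv ^^ j) phi))\<^sup>2)"

section \<open>Functions of time with values in a weighted Sobolev space\<close>

text \<open>A function of \<open>(x,t)\<close> is written with time as its first argument: \<open>f t x\<close>.\<close>

definition CHw :: "real \<Rightarrow> nat \<Rightarrow> real \<Rightarrow> (real \<Rightarrow> real \<Rightarrow> real) set" where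
  "CHw mu m S = {f. \<forall>t\<in>{0..S}. f t \<in> Hw mu m \<and>
     ((\<lambda>s. Hw_norm mu m (\<lambda>x. f s x - f t x)) \<longlongrightarrow> 0) (at t within {0..S})}"

text \<open>For an element of \<open>CHw mu m S\<close> the supremum is attained.\<close>

definition CHw_norm :: "real \<Rightarrow> nat \<Rightarrow> real \<Rightarrow> (real \<Rightarrow> real \<Rightarrow> real) \<Rightarrow> real" where
  "CHw_norm mu m S f = (SUP t\<in>{0..S}. Hw_norm mu m (f t))"

text \<open>Time derivative of an \<open>H\<^sup>m\<^sub>w\<close>-valued function: norm limit of the difference quotients,
  one-sided at the end points of \<open>[0,S]\<close>.\<close>

definition has_time_deriv ::
  "real \<Rightarrow> nat \<Rightarrow> real \<Rightarrow> (real \<Rightarrow> real \<Rightarrow> real) \<Rightarrow> (real \<Rightarrow> real \<Rightarrow> real) \<Rightarrow> bool" where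
  "has_time_deriv mu m S f ft \<longleftrightarrow> (\<forall>t\<in>{0..S}. ft t \<in> Hw mu m \<and>
     ((\<lambda>s. Hw_norm mu m (\<lambda>x. (f s x - f t x) / (s - t) - ft t x)) \<longlongrightarrow> 0) (at t within {0..S}))"

text \<open>Since \<open>A\<^sub>D f\<close> vanishes at \<open>x = -1\<close> and \<open>x = 1\<close>, solutions of the system below have boundary values
  exactly \<open>h1, h2\<close> and \<open>v1, v2\<close>. So a time derivative of a solution in \<open>CHw\<close> can exist only if the
  corresponding boundary data are of class \<open>C\<^sup>1\<close>.\<close>

definition C1_interval :: "real \<Rightarrow> (real \<Rightarrow> real) \<Rightarrow> bool" where
  "C1_interval S h \<longleftrightarrow> (\<exists>h'. (\<forall>t\<in>{0..S}. (h has_real_derivative h' t) (at t within {0..S})) \<and>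
     continuous_on {0..S} h')"

section \<open>The operator \<open>A\<^sub>D\<close>\<close>

definition w1 :: "real \<Rightarrow> real \<Rightarrow> real" where
  "w1 b x = sinh ((1 + x) / sqrt b)"

definition w2 :: "real \<Rightarrow> real \<Rightarrow> real" where
  "w2 b x = sinh ((1 - x) / sqrt b)"

definition wronskian :: "real \<Rightarrow> real" where
  "wronskian b = w1 b 0 * deriv (w2 b) 0 - deriv (w1 b) 0 * w2 b 0"

text \<open>The Wronskian is constant in \<open>x\<close>, so evaluating it at 0 is no loss.\<close>

lemma wronskian_eq:
  assumes "b > 0"
  shows "wronskian b = w1 b x * deriv (w2 b) x - deriv (w1 b) x * w2 b x"
proof -
  define r where "r = sqrt b"
  have r: "r > 0" using assms by (simp add: r_def)
  have d1: "deriv (w1 b) y = cosh ((1 + y) / r) / r" for y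
    unfolding w1_def r_def [symmetric]
    by (rule DERIV_imp_deriv) (use r in \<open>auto intro!: derivative_eq_intros\<close>)
  have d2: "deriv (w2 b) y = - cosh ((1 - y) / r) / r" for y
    unfolding w2_def r_def [symmetric]
    by (rule DERIV_imp_deriv) (use r in \<open>auto intro!: derivative_eq_intros\<close>)
  have "w1 b y * deriv (w2 b) y - deriv (w1 b) y * w2 b y = - sinh (2 / r) / r" for y
  proof -
    have "sinh (2 / r) = sinh ((1 + y) / r + (1 - y) / r)"
      by (simp add: add_divide_distrib [symmetric])
    also have "\<dots> = sinh ((1 + y) / r) * cosh ((1 - y) / r) + cosh ((1 + y) / r) * sinh ((1 - y) / r)"
      by (rule sinh_add)
    finally show ?thesis
      using r by (simp only: d1 d2 w1_def w2_def r_def [symmetric]) (simp add: field_simps)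
  qed
  then show ?thesis
    unfolding wronskian_def by simp
qed

definition Green :: "real \<Rightarrow> real \<Rightarrow> real \<Rightarrow> real" where
  "Green b x xi = - (1 / (b * wronskian b)) *
     (if xi \<le> x then w1 b xi * w2 b x else w1 b x * w2 b xi)"

text \<open>\<open>G\<^sub>\<xi>\<close> does not exist on the null set \<open>xi = x\<close>, where \<open>deriv\<close> has an unspecified value.\<close>

definition A_D :: "real \<Rightarrow> (real \<Rightarrow> real) \<Rightarrow> real \<Rightarrow> real" where
  "A_D b f x = (LBINT xi:Omega. deriv (\<lambda>z. Green b x z) xi * f xi)"

section \<open>The integral system\<close>

text \<open>The functions \<open>H\<close> and \<open>U\<close> have the same form: initial profile \<open>f0\<close>, left boundary
  data \<open>g1\<close>, right boundary data \<open>g2\<close>.\<close>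

definition lifting ::
  "real \<Rightarrow> (real \<Rightarrow> real) \<Rightarrow> (real \<Rightarrow> real) \<Rightarrow> (real \<Rightarrow> real) \<Rightarrow> real \<Rightarrow> real \<Rightarrow> real" where
  "lifting b f0 g1 g2 t x = f0 x
     + w2 b x / sinh (2 / sqrt b) * (g1 t - g1 0)
     + w1 b x / sinh (2 / sqrt b) * (g2 t - g2 0)"

definition solves_system ::
  "real \<Rightarrow> real \<Rightarrow> real \<Rightarrow> (real \<Rightarrow> real) \<Rightarrow> (real \<Rightarrow> real) \<Rightarrow> (real \<Rightarrow> real) \<Rightarrow> (real \<Rightarrow> real) \<Rightarrow>
   (real \<Rightarrow> real) \<Rightarrow> (real \<Rightarrow> real) \<Rightarrow> (real \<Rightarrow> real \<Rightarrow> real) \<Rightarrow> (real \<Rightarrow> real \<Rightarrow> real) \<Rightarrow> bool" where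
  "solves_system b c S h1 h2 v1 v2 eta0 u0 eta u \<longleftrightarrow>
     (\<forall>t\<in>{0..S}. \<forall>x\<in>{-1..1}.
        eta t x = lifting b eta0 h1 h2 t x
          + (LBINT s:{0..t}. A_D b (\<lambda>y. u s y + eta s y * u s y) x) \<and>
        u t x = lifting b u0 v1 v2 t x
          + (LBINT s:{0..t}.
               A_D b (\<lambda>y. c * wderiv (wderiv (eta s)) y + eta s y + (u s y)\<^sup>2 / 2) x))"

definition compatible ::
  "(real \<Rightarrow> real) \<Rightarrow> (real \<Rightarrow> real) \<Rightarrow> (real \<Rightarrow> real) \<Rightarrow> (real \<Rightarrow> real) \<Rightarrow>
   (real \<Rightarrow> real) \<Rightarrow> (real \<Rightarrow> real) \<Rightarrow> bool" where
  "compatible h1 h2 v1 v2 eta0 u0 \<longleftrightarrow>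
     eta0 (-1) = h1 0 \<and> eta0 1 = h2 0 \<and> u0 (-1) = v1 0 \<and> u0 1 = v2 0"

end

theory Submission
  imports Defs
begin

text \<open>
  Since \<open>A\<^sub>D f\<close> solves \<open>v - b v'' = -f'\<close>, it gains one derivative, and the system is an ordinary
  differential equation with a quadratic, locally Lipschitz vector field. The singular part of the
  solution does not move in space: differentiating the equations in \<open>x\<close> shows that at almost every
  \<open>x\<close> the pair \<open>(\<eta>\<^sub>x\<^sub>x, u\<^sub>x)\<close> satisfies a linear system in \<open>t\<close> with coefficients continuous in
  \<open>(x,t)\<close>, so \<open>\<eta>\<^sub>x\<^sub>x\<close> and \<open>u\<^sub>x\<close> are combinations \<open>a\<^sub>1 \<eta>\<^sub>0'' + a\<^sub>2 u\<^sub>0' + a\<^sub>0\<close> with continuous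
  coefficients. Taking \<open>\<eta>\<close>, \<open>\<eta>\<^sub>x\<close>, \<open>u\<close> and these coefficients as unknowns turns the problem into an
  equation in a Banach space of continuous functions, which Picard iteration solves. That the unknowns
  really are derivatives of each other is a family of bounded linear conditions which the vector field
  preserves.

  Uniqueness follows from Gronwall's inequality for the sup norm of \<open>(\<eta>, \<eta>\<^sub>x, u)\<close>: integrating by parts
  in \<open>A\<^sub>D \<eta>\<^sub>x\<^sub>x\<close> bounds this term by \<open>\<eta>\<^sub>x\<close>.
\<close>

section \<open>Primitives of integrable functions\<close>

text \<open>The iteration is not run in the weighted Sobolev spaces themselves. Their elements are
  plain functions with a seminorm, their derivatives are arbitrary choices made by
  \<open>wderiv\<close>, and a fixed point argument would need completeness of the quotient. In
  spaces of bounded continuous functions completeness is at hand, and the weighted space is entered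
  only at the end, when a coefficient triple is evaluated against the fixed functions
  \<open>eta0''\<close> and \<open>u0'\<close>. Spatial derivatives of the unknowns are never taken:
  \<open>ac f g\<close> says that \<open>f\<close> is a primitive of \<open>g\<close>, and weak
  derivatives are translated into this relation once and for all. The weight acts in two ways:
  \<open>mu < 1\<close> puts \<open>L2w mu\<close> into L1, so that primitives exist and Sobolev
  bounds hold, and \<open>mu > -1\<close> makes continuous functions square integrable with respect
  to the weight. The functions \<open>T0\<close> and \<open>C\<close> precede the initial data in
  the statement. Every quantity depending on \<open>eta0''\<close> and \<open>u0'\<close>, such as
  the norm of the operators, is therefore bounded by one that depends only on an upper bound
  \<open>n\<close> for the Sobolev norms of the data.\<close>

lemma continuous_on_Icc_bounded:
  fixes f :: "real \<Rightarrow> real"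
  assumes "continuous_on {a..b} f"
  obtains M where "\<And>x. x \<in> {a..b} \<Longrightarrow> \<bar>f x\<bar> \<le> M"
  using compact_imp_bounded[OF compact_continuous_image[OF assms compact_Icc]]
  unfolding bounded_iff by (metis imageI real_norm_def)

abbreviation L1 :: "(real \<Rightarrow> real) \<Rightarrow> bool" where
  "L1 \<equiv> set_integrable lborel Omega"

text \<open>Bridge between the Lebesgue integrals of the statement and the gauge integral
  \<open>integral {-1..x} g\<close>, for which splitting of intervals and the fundamental theorem of
  calculus are convenient. The two end points are negligible.\<close>

lemma L1_absolutely_integrable:
  assumes "L1 g"
  shows "g absolutely_integrable_on {-1..1}"
proof -
  have "integrable lborel (\<lambda>x. indicator Omega x *\<^sub>R g x)"
    using assms unfolding set_integrable_def .
  then have "set_integrable lebesgue Omega g"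
    unfolding set_integrable_def
    using integrable_completion borel_measurable_integrable by blast
  then show ?thesis
    by (simp add: absolutely_integrable_on_def integrable_on_Icc_iff_Ioo)
qed

lemma L1_integrable_on:
  assumes "L1 g" "-1 \<le> x" "y \<le> 1"
  shows "g integrable_on {x..y}"
  using L1_absolutely_integrable[OF assms(1)] assms(2,3)
  by (auto simp: absolutely_integrable_on_def intro!: integrable_subinterval_real[of g "-1" 1])

text \<open>End points are null sets. The half-open variant is the one that arises as a section of
  the triangle \<open>z \<le> y\<close> in the Fubini argument below.\<close>

lemma set_integral_eq_primitive:
  assumes "L1 g" "x \<in> {-1..1}"
  shows "(LBINT y:{-1<..<x}. g y) = integral {-1..x} g"
    and "(LBINT y:{-1<..x}. g y) = integral {-1..x} g"
    and "(LBINT y:{x<..<1}. g y) = integral {x..1} g"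
proof -
  have 1: "set_integrable lborel {-1<..<x} g" "set_integrable lborel {x<..<1} g"
    using assms by (auto intro!: set_integrable_subset[OF assms(1)])
  show *: "(LBINT y:{-1<..<x}. g y) = integral {-1..x} g"
    using set_borel_integral_eq_integral(2)[OF 1(1)] by (simp add: integral_open_interval_real)
  show "(LBINT y:{x<..<1}. g y) = integral {x..1} g"
    using set_borel_integral_eq_integral(2)[OF 1(2)] by (simp add: integral_open_interval_real)
  show "(LBINT y:{-1<..x}. g y) = integral {-1..x} g"
  proof -
    have "(LBINT y:{-1<..x}. g y) = (LBINT y:{-1<..<x}. g y)"
      by (rule set_integral_discrete_difference[where X="{x}"]) auto
    with * show ?thesis by simp
  qed
qed

lemma L1_mult_continuous:
  assumes "L1 g" "continuous_on {-1..1} w"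
  shows "L1 (\<lambda>x. w x * g x)"
proof -
  obtain M where M: "\<And>x. x \<in> {-1..1} \<Longrightarrow> \<bar>w x\<bar> \<le> M"
    using continuous_on_Icc_bounded[OF assms(2)] by blast
  have i: "integrable lborel (\<lambda>x. indicator Omega x *\<^sub>R g x)"
    using assms unfolding set_integrable_def by auto
  have w: "(\<lambda>x. indicator Omega x *\<^sub>R w x) \<in> borel_measurable borel"
    by (rule borel_measurable_continuous_on_indicator)
      (auto intro: continuous_on_subset[OF assms(2)])
  \<comment> \<open>Nothing is known about \<open>w\<close> outside [-1,1], so the indicator is
    attached to both factors before measurability is claimed.\<close>
  have "(\<lambda>x. (indicator Omega x *\<^sub>R w x) * (indicator Omega x *\<^sub>R g x)) \<in> borel_measurable lborel"
    by (intro borel_measurable_times borel_measurable_integrable[OF i]) (use w in auto)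
  also have "(\<lambda>x. (indicator Omega x *\<^sub>R w x) * (indicator Omega x *\<^sub>R g x))
      = (\<lambda>x. indicator Omega x *\<^sub>R (w x * g x))"
    by (auto simp: indicator_def fun_eq_iff)
  finally have m: "(\<lambda>x. indicator Omega x *\<^sub>R (w x * g x)) \<in> borel_measurable lborel" .
  show ?thesis unfolding set_integrable_def
  proof (rule Bochner_Integration.integrable_bound[OF _ m])
    show "integrable lborel (\<lambda>x. M *\<^sub>R (indicator Omega x *\<^sub>R g x))"
      using i by (rule integrable_scaleR_right)
    show "AE x in lborel. norm (indicator Omega x *\<^sub>R (w x * g x)) \<le> norm (M *\<^sub>R indicator Omega x *\<^sub>R g x)"
    proof (rule AE_I2)
      fix x :: real
      show "norm (indicator Omega x *\<^sub>R (w x * g x)) \<le> norm (M *\<^sub>R indicator Omega x *\<^sub>R g x)"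
        using order_trans[OF M[of x] abs_ge_self[of M]]
        by (auto simp: indicator_def abs_mult intro!: mult_right_mono)
    qed
  qed
qed

lemma L1_continuous:
  assumes "continuous_on {-1..1} w"
  shows "L1 w"
proof -
  have "L1 (\<lambda>_. 1)"
    by (simp add: set_integrable_def)
  from L1_mult_continuous[OF this assms] show ?thesis by simp
qed

lemma L1_cong_AE:
  assumes "L1 f" "AE x in lborel. x \<in> Omega \<longrightarrow> f x = g x" "set_borel_measurable lborel Omega g"
  shows "L1 g"
proof -
  have i: "integrable lborel (\<lambda>x. indicator Omega x *\<^sub>R f x)"
    using assms unfolding set_integrable_def by auto
  show ?thesis unfolding set_integrable_def
    by (rule integrable_cong_AE_imp[OF i])
      (use assms in \<open>auto simp: set_borel_measurable_def indicator_def elim!: eventually_mono\<close>)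
qed

text \<open>Split \<open>h\<close> into positive and negative part. All rays \<open>{x<..}\<close>
  have the same finite mass under the two measures with these densities, since the difference is an
  integral of \<open>h\<close> up to the right end. Hence the measures coincide, and so do their
  densities almost everywhere. This replaces a differentiation theorem for primitives.\<close>

lemma L1_vanishing_primitive:
  assumes "L1 h" "\<And>x. x \<in> {-1..1} \<Longrightarrow> integral {-1..x} h = 0"
  shows "AE x in lborel. x \<in> Omega \<longrightarrow> h x = 0"
proof -
  define H where "H = (\<lambda>x. indicator Omega x *\<^sub>R h x)"
  have i: "integrable lborel H"
    using assms unfolding set_integrable_def H_def by auto
  then have [measurable]: "H \<in> borel_measurable borel" by auto
  define p where "p = (\<lambda>x. max 0 (H x))"
  define n where "n = (\<lambda>x. max 0 (- H x))"
  have ip: "integrable lborel p" and in': "integrable lborel n"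
    unfolding p_def n_def using i by auto
  have [measurable]: "p \<in> borel_measurable borel" "n \<in> borel_measurable borel"
    by (auto simp: p_def n_def)
  have em: "emeasure (density lborel (\<lambda>x. ennreal (q x))) {x<..} = ennreal (LBINT y:{x<..}. q y)"
    if "integrable lborel q" "q \<in> borel_measurable borel" "\<And>y. q y \<ge> 0" for q :: "real \<Rightarrow> real" and x
  proof -
    have "emeasure (density lborel (\<lambda>x. ennreal (q x))) {x<..}
        = (\<integral>\<^sup>+y. ennreal (q y) * indicator {x<..} y \<partial>lborel)"
      using that by (subst emeasure_density) auto
    also have "\<dots> = (\<integral>\<^sup>+y. ennreal (indicator {x<..} y *\<^sub>R q y) \<partial>lborel)"
      by (intro nn_integral_cong) (auto simp: indicator_def)
    also have "\<dots> = ennreal (LBINT y:{x<..}. q y)"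
      unfolding set_lebesgue_integral_def
      using that by (intro nn_integral_eq_integral integrable_mult_indicator) auto
    finally show ?thesis .
  qed
  have eq: "(LBINT y:{x<..}. p y) = (LBINT y:{x<..}. n y)" for x
  proof -
    have si: "set_integrable lborel {x<..} p" "set_integrable lborel {x<..} n"
      unfolding set_integrable_def using ip in' by (intro integrable_mult_indicator; auto)+
    have "(LBINT y:{x<..}. p y) - (LBINT y:{x<..}. n y) = (LBINT y:{x<..}. p y - n y)"
      using set_integral_diff(2)[OF si] by simp
    also have "\<dots> = (LBINT y:{x<..}. H y)"
      by (intro arg_cong2[where f="set_lebesgue_integral lborel"] ext) (auto simp: p_def n_def)
    also have "\<dots> = 0"
    proof (cases "x < 1")
      case True
      define z where "z = max x (-1)"
      have z: "z \<in> {-1..1}" using True by (auto simp: z_def)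
      have "(LBINT y:{x<..}. H y) = (LBINT y:{z<..<1}. h y)"
        unfolding set_lebesgue_integral_def H_def
        by (intro Bochner_Integration.integral_cong) (auto simp: indicator_def z_def)
      also have "\<dots> = integral {z..1} h"
        using set_integral_eq_primitive[OF assms(1) z] by simp
      also have "\<dots> = integral {-1..1} h - integral {-1..z} h"
        using Henstock_Kurzweil_Integration.integral_combine[of "-1" z 1 h] z
          L1_integrable_on[OF assms(1), of "-1" 1] by auto
      also have "\<dots> = 0"
        using assms(2)[OF z] assms(2)[of 1] by simp
      finally show ?thesis .
    next
      case False
      have "(LBINT y:{x<..}. H y) = (LBINT y:{x<..}. 0)"
        unfolding set_lebesgue_integral_def H_def
        by (intro Bochner_Integration.integral_cong) (use False in \<open>auto simp: indicator_def\<close>)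
      then show ?thesis by simp
    qed
    finally show ?thesis by simp
  qed
  have "density lborel (\<lambda>x. ennreal (p x)) = density lborel (\<lambda>x. ennreal (n x))"
    by (rule measure_eqI_lessThan)
      (auto simp: em[OF ip] em[OF in'] eq p_def n_def, (auto simp: em[OF ip, unfolded p_def] em[OF in', unfolded n_def] eq[unfolded p_def n_def]))
  then have "AE x in lborel. ennreal (p x) = ennreal (n x)"
    by (intro sigma_finite_measure.density_unique[OF sigma_finite_lborel]) auto
  then show ?thesis
    by eventually_elim (auto simp: p_def n_def H_def max_def split: if_splits)
qed

text \<open>Integration by parts without any regularity: the double integral of
  \<open>f y * g z\<close> over the square from -1 to \<open>x\<close> is the product on the right,
  and cutting the square along its diagonal gives the two terms on the left.\<close>

lemma integral_mult_primitives:
  assumes f: "L1 f" and g: "L1 g" and x: "x \<in> {-1..1}"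
  shows "integral {-1..x} (\<lambda>y. f y * integral {-1..y} g) + integral {-1..x} (\<lambda>y. g y * integral {-1..y} f)
    = integral {-1..x} f * integral {-1..x} g"
proof -
  define F where "F = (\<lambda>y. indicator {-1<..<x} y *\<^sub>R f y)"
  define G where "G = (\<lambda>y. indicator {-1<..<x} y *\<^sub>R g y)"
  have iF: "integrable lborel F" and iG: "integrable lborel G"
  proof -
    have "{-1<..<x} \<subseteq> Omega" using x by auto
    then show "integrable lborel F" "integrable lborel G"
      using set_integrable_subset[OF f, of "{-1<..<x}"] set_integrable_subset[OF g, of "{-1<..<x}"]
      by (simp_all add: F_def G_def set_integrable_def)
  qed
  have [measurable]: "F \<in> borel_measurable borel" "G \<in> borel_measurable borel"
    using iF iG by auto
  have prod: "integrable (lborel \<Otimes>\<^sub>M lborel) (\<lambda>(y,z). F y * G z)"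
  proof (rule lborel_pair.Fubini_integrable)
    show "integrable lborel (\<lambda>y. \<integral>z. norm (case (y, z) of (y, z) \<Rightarrow> F y * G z) \<partial>lborel)"
      using iF by (simp add: abs_mult)
  qed (use iG in auto)
  have m1: "{p::real\<times>real. snd p \<le> fst p} \<in> sets (lborel \<Otimes>\<^sub>M lborel)"
    and m2: "{p::real\<times>real. fst p < snd p} \<in> sets (lborel \<Otimes>\<^sub>M lborel)"
    unfolding lborel_prod sets_lborel
    by (intro borel_closed closed_Collect_le continuous_intros borel_open open_Collect_less)+
  have i1: "integrable (lborel \<Otimes>\<^sub>M lborel) (\<lambda>(y,z). indicator {p. snd p \<le> fst p} (y,z) *\<^sub>R (F y * G z))"
    using integrable_mult_indicator[OF m1 prod] by (simp add: case_prod_beta')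
  have i2: "integrable (lborel \<Otimes>\<^sub>M lborel) (\<lambda>(y,z). indicator {p. fst p < snd p} (y,z) *\<^sub>R (F y * G z))"
    using integrable_mult_indicator[OF m2 prod] by (simp add: case_prod_beta')
  have PF: "integral {-1..x} f = (\<integral>y. F y \<partial>lborel)" and PG: "integral {-1..x} g = (\<integral>y. G y \<partial>lborel)"
    using set_integral_eq_primitive(1)[OF f x] set_integral_eq_primitive(1)[OF g x]
    by (simp_all add: F_def G_def set_lebesgue_integral_def)
  have cf: "continuous_on {-1..1} (\<lambda>y. integral {-1..y} f)" and cg: "continuous_on {-1..1} (\<lambda>y. integral {-1..y} g)"
    using L1_integrable_on[OF f, of "-1" 1] L1_integrable_on[OF g, of "-1" 1]
    by (auto intro: indefinite_integral_continuous_1)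
  have A: "(\<integral>y. (\<integral>z. indicator {p. snd p \<le> fst p} (y,z) *\<^sub>R (F y * G z) \<partial>lborel) \<partial>lborel)
     = integral {-1..x} (\<lambda>y. f y * integral {-1..y} g)"
  proof -
    have "(\<integral>z. indicator {p. snd p \<le> fst p} (y,z) *\<^sub>R (F y * G z) \<partial>lborel)
       = indicator {-1<..<x} y *\<^sub>R (f y * integral {-1..y} g)" for y
    proof (cases "y \<in> {-1<..<x}")
      case True
      have "(\<integral>z. indicator {p. snd p \<le> fst p} (y,z) *\<^sub>R (F y * G z) \<partial>lborel)
         = (\<integral>z. F y * (indicator {-1<..y} z *\<^sub>R g z) \<partial>lborel)"
        by (intro Bochner_Integration.integral_cong) (use True x in \<open>auto simp: G_def indicator_def\<close>)
      also have "\<dots> = F y * (LBINT z:{-1<..y}. g z)"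
        by (simp add: set_lebesgue_integral_def)
      also have "\<dots> = F y * integral {-1..y} g"
        using True x by (subst set_integral_eq_primitive(2)[OF g]) auto
      finally show ?thesis using True by (simp add: F_def)
    qed (simp add: F_def)
    then have "(\<integral>y. (\<integral>z. indicator {p. snd p \<le> fst p} (y,z) *\<^sub>R (F y * G z) \<partial>lborel) \<partial>lborel)
      = (LBINT y:{-1<..<x}. f y * integral {-1..y} g)"
      by (simp add: set_lebesgue_integral_def)
    also have "\<dots> = integral {-1..x} (\<lambda>y. f y * integral {-1..y} g)"
      using L1_mult_continuous[OF f cg] x by (intro set_integral_eq_primitive(1)) (auto simp: mult.commute)
    finally show ?thesis .
  qed
  have B: "(\<integral>y. (\<integral>z. indicator {p. fst p < snd p} (y,z) *\<^sub>R (F y * G z) \<partial>lborel) \<partial>lborel)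
     = integral {-1..x} (\<lambda>y. g y * integral {-1..y} f)"
  proof -
    have "(\<integral>y. indicator {p. fst p < snd p} (y,z) *\<^sub>R (F y * G z) \<partial>lborel)
       = indicator {-1<..<x} z *\<^sub>R (g z * integral {-1..z} f)" for z
    proof (cases "z \<in> {-1<..<x}")
      case True
      have "(\<integral>y. indicator {p. fst p < snd p} (y,z) *\<^sub>R (F y * G z) \<partial>lborel)
         = (\<integral>y. G z * (indicator {-1<..<z} y *\<^sub>R f y) \<partial>lborel)"
        by (intro Bochner_Integration.integral_cong) (use True x in \<open>auto simp: F_def indicator_def\<close>)
      also have "\<dots> = G z * (LBINT y:{-1<..<z}. f y)"
        by (simp add: set_lebesgue_integral_def)
      also have "\<dots> = G z * integral {-1..z} f"
        using True x by (subst set_integral_eq_primitive(1)[OF f]) auto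
      finally show ?thesis using True by (simp add: G_def)
    qed (simp add: G_def)
    then have "(\<integral>z. (\<integral>y. indicator {p. fst p < snd p} (y,z) *\<^sub>R (F y * G z) \<partial>lborel) \<partial>lborel)
      = (LBINT z:{-1<..<x}. g z * integral {-1..z} f)"
      by (simp add: set_lebesgue_integral_def)
    also have "\<dots> = integral {-1..x} (\<lambda>y. g y * integral {-1..y} f)"
      using L1_mult_continuous[OF g cf] x by (intro set_integral_eq_primitive(1)) (auto simp: mult.commute)
    \<comment> \<open>The upper triangle has been integrated in \<open>y\<close> first; Fubini
      restores the order in which the claim is stated.\<close>
    finally show ?thesis
      using lborel_pair.Fubini_integral[OF i2] by simp
  qed
  have "integral {-1..x} (\<lambda>y. f y * integral {-1..y} g) + integral {-1..x} (\<lambda>y. g y * integral {-1..y} f)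
    = integral\<^sup>L (lborel \<Otimes>\<^sub>M lborel) (\<lambda>(y,z). indicator {p. snd p \<le> fst p} (y,z) *\<^sub>R (F y * G z))
     + integral\<^sup>L (lborel \<Otimes>\<^sub>M lborel) (\<lambda>(y,z). indicator {p. fst p < snd p} (y,z) *\<^sub>R (F y * G z))"
    unfolding A[symmetric] B[symmetric] by (simp only: lborel_pair.integral_fst[OF i1] lborel_pair.integral_fst[OF i2])
  also have "\<dots> = integral\<^sup>L (lborel \<Otimes>\<^sub>M lborel) (\<lambda>(y,z). F y * G z)"
    by (subst Bochner_Integration.integral_add[OF i1 i2, symmetric])
      (auto intro!: Bochner_Integration.integral_cong simp: indicator_def)
  also have "\<dots> = (\<integral>y. (\<integral>z. F y * G z \<partial>lborel) \<partial>lborel)"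
    using lborel_pair.integral_fst[OF prod] by simp
  finally show ?thesis by (simp add: PF PG)
qed

section \<open>Absolutely continuous functions on [-1,1]\<close>

text \<open>Absolute continuity up to both end points, written through the primitive. As a relation
  it fixes \<open>f\<close> at every point of [-1,1] up to an additive constant, but leaves
  \<open>g\<close> free on null sets, which is how weak derivatives behave.\<close>

definition ac :: "(real \<Rightarrow> real) \<Rightarrow> (real \<Rightarrow> real) \<Rightarrow> bool" where
  "ac f g \<longleftrightarrow> L1 g \<and> (\<forall>x\<in>{-1..1}. f x - f (-1) = integral {-1..x} g)"

lemma acD:
  assumes "ac f g"
  shows "L1 g" "x \<in> {-1..1} \<Longrightarrow> f x = f (-1) + integral {-1..x} g"
proof -
  show "L1 g" using assms by (simp add: ac_def)
  assume "x \<in> {-1..1}"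
  then have "f x - f (-1) = integral {-1..x} g" using assms by (simp add: ac_def)
  then show "f x = f (-1) + integral {-1..x} g" by linarith
qed

lemma acI:
  assumes "L1 g" "\<And>x. x \<in> {-1..1} \<Longrightarrow> f x = f (-1) + integral {-1..x} g"
  shows "ac f g"
  unfolding ac_def
proof (intro conjI ballI)
  fix x :: real assume "x \<in> {-1..1}"
  from assms(2)[OF this] show "f x - f (-1) = integral {-1..x} g" by linarith
qed fact

lemma ac_continuous:
  assumes "ac f g"
  shows "continuous_on {-1..1} f"
proof -
  have "continuous_on {-1..1} (\<lambda>x. f (-1) + integral {-1..x} g)"
    using L1_integrable_on[OF acD(1)[OF assms], of "-1" 1]
    by (intro continuous_intros) (auto intro: indefinite_integral_continuous_1)
  then show ?thesis
    by (rule continuous_on_eq) (simp add: acD(2)[OF assms, symmetric])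
qed

lemma ac_cong:
  assumes "ac f g" "\<And>x. x \<in> {-1..1} \<Longrightarrow> f x = f' x" "\<And>x. x \<in> Omega \<Longrightarrow> g x = g' x"
  shows "ac f' g'"
proof -
  have "L1 g'"
    using acD(1)[OF assms(1)] assms(3) by (subst set_integrable_cong[of _ lborel _ Omega _ g]) auto
  moreover have "integral {-1..x} g' = integral {-1..x} g" if "x \<in> {-1..1}" for x
  proof -
    have "integral {-1<..<x} g' = integral {-1<..<x} g"
      using that assms(3) by (intro Henstock_Kurzweil_Integration.integral_cong) auto
    then show ?thesis by (simp add: integral_open_interval_real)
  qed
  ultimately show ?thesis
    using assms(1,2) by (simp add: ac_def)
qed

lemma ac_const: "ac (\<lambda>_. k) (\<lambda>_. 0)"
  by (simp add: ac_def set_integrable_def)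

lemma ac_cmult: "ac f g \<Longrightarrow> ac (\<lambda>x. k * f x) (\<lambda>x. k * g x)"
  by (simp add: ac_def right_diff_distrib[symmetric])

lemma ac_add:
  assumes "ac f g" "ac f' g'"
  shows "ac (\<lambda>x. f x + f' x) (\<lambda>x. g x + g' x)"
proof -
  have "integral {-1..x} (\<lambda>x. g x + g' x) = integral {-1..x} g + integral {-1..x} g'" if "x \<in> {-1..1}" for x
    using L1_integrable_on[OF acD(1)[OF assms(1)], of "-1" x] L1_integrable_on[OF acD(1)[OF assms(2)], of "-1" x] that
    by (simp add: Henstock_Kurzweil_Integration.integral_add)
  then show ?thesis
    using assms by (simp add: ac_def add_diff_add)
qed

lemma ac_diff:
  assumes "ac f g" "ac f' g'"
  shows "ac (\<lambda>x. f x - f' x) (\<lambda>x. g x - g' x)"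
  using ac_add[OF assms(1) ac_cmult[OF assms(2), of "-1"]] by simp

text \<open>Write both factors as boundary value plus primitive and expand. All terms are linear
  except the product of the two primitives, which is
  \<open>integral_mult_primitives\<close>.\<close>

lemma ac_mult:
  assumes "ac f g" "ac h k"
  shows "ac (\<lambda>x. f x * h x) (\<lambda>x. f x * k x + h x * g x)"
proof -
  note fg = acD[OF assms(1)] and hk = acD[OF assms(2)]
  have cf: "continuous_on {-1..1} (\<lambda>y. integral {-1..y} g)" and cg: "continuous_on {-1..1} (\<lambda>y. integral {-1..y} k)"
    using L1_integrable_on[OF fg(1), of "-1" 1] L1_integrable_on[OF hk(1), of "-1" 1]
    by (auto intro: indefinite_integral_continuous_1)
  have L: "L1 (\<lambda>x. f x * k x + h x * g x)"
    using L1_mult_continuous[OF hk(1) ac_continuous[OF assms(1)]] L1_mult_continuous[OF fg(1) ac_continuous[OF assms(2)]]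
    by simp
  have "f x * h x = f (-1) * h (-1) + integral {-1..x} (\<lambda>x. f x * k x + h x * g x)" if x: "x \<in> {-1..1}" for x
  proof -
    have L1': "L1 (\<lambda>y. k y * integral {-1..y} g)" "L1 (\<lambda>y. g y * integral {-1..y} k)"
      using L1_mult_continuous[OF hk(1) cf] L1_mult_continuous[OF fg(1) cg] by (auto simp: mult.commute)
    have "integral {-1..x} (\<lambda>x. f x * k x + h x * g x)
      = integral {-1..x} (\<lambda>y. (f (-1) * k y + h (-1) * g y) + (k y * integral {-1..y} g + g y * integral {-1..y} k))"
    proof (rule Henstock_Kurzweil_Integration.integral_cong)
      fix y assume "y \<in> {-1..x}"
      then have y: "y \<in> {-1..1}" using x by auto
      show "f y * k y + h y * g y
        = f (-1) * k y + h (-1) * g y + (k y * integral {-1..y} g + g y * integral {-1..y} k)"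
        unfolding fg(2)[OF y] hk(2)[OF y] by (simp add: algebra_simps)
    qed
    also have "\<dots> = (f (-1) * integral {-1..x} k + h (-1) * integral {-1..x} g)
       + (integral {-1..x} (\<lambda>y. k y * integral {-1..y} g) + integral {-1..x} (\<lambda>y. g y * integral {-1..y} k))"
      using x by (intro integral_unique has_integral_add has_integral_mult_right integrable_integral
        L1_integrable_on[OF fg(1)] L1_integrable_on[OF hk(1)] L1_integrable_on[OF L1'(1)] L1_integrable_on[OF L1'(2)]) auto
    also have "integral {-1..x} (\<lambda>y. k y * integral {-1..y} g) + integral {-1..x} (\<lambda>y. g y * integral {-1..y} k)
      = integral {-1..x} k * integral {-1..x} g"
      by (rule integral_mult_primitives[OF hk(1) fg(1) x])
    finally show ?thesis
      using fg(2)[OF x] hk(2)[OF x] by (simp add: algebra_simps)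
  qed
  with L show ?thesis by (rule acI)
qed

lemma ac_C1:
  assumes "\<And>x. x \<in> {-1..1} \<Longrightarrow> (f has_real_derivative f' x) (at x)" "continuous_on {-1..1} f'"
  shows "ac f f'"
proof -
  have "f x = f (-1) + integral {-1..x} f'" if "x \<in> {-1..1}" for x
  proof -
    have "(f' has_integral (f x - f (-1))) {-1..x}"
      by (rule fundamental_theorem_of_calculus)
        (use that assms(1) in \<open>auto simp: has_real_derivative_iff_has_vector_derivative[symmetric] intro: has_field_derivative_at_within\<close>)
    then show ?thesis by (simp add: integral_unique)
  qed
  with L1_continuous[OF assms(2)] show ?thesis by (rule acI)
qed

text \<open>The primitive of a continuous function is differentiable at every point of [-1,1],
  one-sidedly at the ends, so a continuous density is determined everywhere and not only almost
  everywhere.\<close>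

lemma ac_unique_continuous:
  assumes "ac f g" "ac f g'" "continuous_on {-1..1} g" "continuous_on {-1..1} g'" "x \<in> {-1..1}"
  shows "g x = g' x"
proof -
  have d0: "ac (\<lambda>_. 0) (\<lambda>x. g x - g' x)"
    using ac_diff[OF assms(1,2)] by simp
  have d: "integral {-1..y} (\<lambda>x. g x - g' x) = 0" if "y \<in> {-1..1}" for y
    using acD(2)[OF d0 that] by simp
  have "((\<lambda>y. integral {-1..y} (\<lambda>x. g x - g' x)) has_vector_derivative (g x - g' x)) (at x within {-1..1})"
    by (rule integral_has_vector_derivative) (use assms in \<open>auto intro!: continuous_intros\<close>)
  then have "((\<lambda>y. 0) has_vector_derivative (g x - g' x)) (at x within {-1..1})"
    by (rule has_vector_derivative_transform[rotated 2]) (use assms(5) d in auto)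
  moreover have "at x within {-1..1} \<noteq> bot"
    using assms(5) by (simp add: trivial_limit_within islimpt_Icc)
  ultimately show ?thesis
    using vector_derivative_unique_within[of x "{-1..1}" "\<lambda>_. 0::real" "g x - g' x" 0]
    by auto
qed

lemma ac_cong_AE:
  assumes "ac f g" "AE x in lborel. x \<in> Omega \<longrightarrow> g x = g' x" "L1 g'"
  shows "ac f g'"
proof (rule acI[OF assms(3)])
  fix x :: real assume x: "x \<in> {-1..1}"
  have "(LBINT y:{-1<..<x}. g y) = (LBINT y:{-1<..<x}. g' y)"
    unfolding set_lebesgue_integral_def
  proof (rule integral_cong_AE)
    have "{-1<..<x} \<subseteq> Omega" using x by auto
    then show "(\<lambda>y. indicat_real {-1<..<x} y *\<^sub>R g y) \<in> borel_measurable lborel"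
      "(\<lambda>y. indicat_real {-1<..<x} y *\<^sub>R g' y) \<in> borel_measurable lborel"
      using set_integrable_subset[OF acD(1)[OF assms(1)], of "{-1<..<x}"] set_integrable_subset[OF assms(3), of "{-1<..<x}"]
      by (auto simp: set_integrable_def)
    show "AE y in lborel. indicat_real {-1<..<x} y *\<^sub>R g y = indicat_real {-1<..<x} y *\<^sub>R g' y"
      using assms(2) by eventually_elim (use x in \<open>auto simp: indicator_def\<close>)
  qed
  then show "f x = f (-1) + integral {-1..x} g'"
    using acD(2)[OF assms(1) x]
    by (simp add: set_integral_eq_primitive(1)[OF acD(1)[OF assms(1)] x] set_integral_eq_primitive(1)[OF assms(3) x])
qed

section \<open>Weak derivatives\<close>

text \<open>Both functions are continuous densities of the same primitive. The end points are
  included, which is what gives boundary values a meaning.\<close>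

lemma AE_eq_imp_eq_continuous:
  fixes f g :: "real \<Rightarrow> real"
  assumes "AE x in lborel. x \<in> Omega \<longrightarrow> f x = g x" "continuous_on {-1..1} f" "continuous_on {-1..1} g"
    "x \<in> {-1..1}"
  shows "f x = g x"
proof -
  have 1: "ac (\<lambda>x. integral {-1..x} f) f"
    by (rule acI) (use L1_continuous[OF assms(2)] in auto)
  then have "ac (\<lambda>x. integral {-1..x} f) g"
    using assms(1) L1_continuous[OF assms(3)] by (rule ac_cong_AE)
  with 1 show ?thesis
    using assms(2-) by (rule ac_unique_continuous)
qed

lemma test_funD:
  assumes "test_fun phi"
  shows "(phi has_real_derivative deriv phi x) (at x)" "continuous_on A (deriv phi)" "continuous_on A phi"
proof -
  have d: "phi differentiable (at y)" for y
    using assms by (auto simp: test_fun_def)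
  show "(phi has_real_derivative deriv phi x) (at x)"
    using d[of x] by (simp add: DERIV_deriv_iff_real_differentiable)
  show "continuous_on A (deriv phi)"
    using assms by (auto simp: test_fun_def intro: continuous_on_subset)
  show "continuous_on A phi"
    using d differentiable_imp_continuous_within by (metis continuous_at_imp_continuous_on)
qed

lemma test_fun_support:
  assumes "test_fun phi"
  obtains a b where "-1 < a" "a < b" "b < 1" "\<And>x. x \<notin> {a..b} \<Longrightarrow> phi x = 0" "\<And>x. x \<notin> {a..b} \<Longrightarrow> deriv phi x = 0"
proof -
  obtain a b where ab: "-1 < a" "a < b" "b < 1" "\<And>x. x \<notin> {a..b} \<Longrightarrow> phi x = 0"
    using assms by (auto simp: test_fun_def)
  have "deriv phi x = 0" if "x \<notin> {a..b}" for x
  proof -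
    have "(phi has_real_derivative 0) (at x)"
      by (rule has_field_derivative_transform_within_open[of "\<lambda>_. 0" _ _ "- {a..b}"])
        (use that ab in auto)
    then show ?thesis by (rule DERIV_imp_deriv)
  qed
  with ab that show thesis by blast
qed

lemma loc_integrable_L1: "L1 f \<Longrightarrow> loc_integrable f"
  by (auto simp: loc_integrable_def intro!: set_integrable_subset[of lborel Omega f])

text \<open>By the product rule \<open>f x * phi x\<close> is a primitive of the sum of both
  integrands, and it vanishes at both ends.\<close>

lemma ac_imp_is_weak_deriv:
  assumes "ac f g"
  shows "is_weak_deriv f g"
  unfolding is_weak_deriv_def
proof (intro conjI allI impI)
  show "loc_integrable f" "loc_integrable g"
    using loc_integrable_L1 L1_continuous[OF ac_continuous[OF assms]] acD(1)[OF assms] by auto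
  fix phi assume phi: "test_fun phi"
  obtain a b where ab: "-1 < a" "a < b" "b < 1" "\<And>x. x \<notin> {a..b} \<Longrightarrow> phi x = 0"
    using test_fun_support[OF phi] by metis
  have p: "ac phi (deriv phi)"
    by (rule ac_C1) (use test_funD[OF phi] in auto)
  have fp: "ac (\<lambda>x. f x * phi x) (\<lambda>x. f x * deriv phi x + phi x * g x)"
    by (rule ac_mult[OF assms p])
  have "integral {-1..1} (\<lambda>x. f x * deriv phi x + phi x * g x) = 0"
    using acD(2)[OF fp, of 1] ab(4)[of 1] ab(4)[of "-1"] ab(1-3) by simp
  moreover have "(LBINT x:Omega. f x * deriv phi x + phi x * g x) = integral {-1..1} (\<lambda>x. f x * deriv phi x + phi x * g x)"
    using set_integral_eq_primitive(1)[OF acD(1)[OF fp], of 1] by simp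
  moreover have "(LBINT x:Omega. f x * deriv phi x + phi x * g x)
    = (LBINT x:Omega. f x * deriv phi x) + (LBINT x:Omega. g x * phi x)"
  proof -
    have 1: "L1 (\<lambda>x. f x * deriv phi x)"
      by (intro L1_continuous continuous_intros ac_continuous[OF assms] test_funD[OF phi])
    have 2: "L1 (\<lambda>x. phi x * g x)"
      by (intro L1_mult_continuous acD(1)[OF assms] test_funD[OF phi])
    show ?thesis using set_integral_add(2)[OF 1 2] by (simp add: mult.commute)
  qed
  ultimately show "(LBINT x:Omega. f x * deriv phi x) = - (LBINT x:Omega. g x * phi x)" by simp
qed

lemma loc_integrable_mult:
  assumes "loc_integrable f" "continuous_on UNIV phi" "-1 < a" "a < b" "b < 1" "\<And>x. x \<notin> {a..b} \<Longrightarrow> phi x = 0"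
  shows "L1 (\<lambda>x. phi x * f x)"
proof -
  have "set_integrable lborel {a..b} f"
    using assms by (auto simp: loc_integrable_def)
  then have "L1 (\<lambda>x. indicator {a..b} x * f x)"
    unfolding set_integrable_def
    by (rule back_subst[of "integrable lborel"]) (use assms in \<open>auto simp: indicator_def\<close>)
  from L1_mult_continuous[OF this, of phi]
  have "L1 (\<lambda>x. phi x * (indicator {a..b} x * f x))"
    using assms(2) continuous_on_subset by blast
  also have "(\<lambda>x. phi x * (indicator {a..b} x * f x)) = (\<lambda>x. phi x * f x)"
    using assms(6) by (auto simp: indicator_def fun_eq_iff)
  finally show ?thesis .
qed

lemma test_fun_mult_L1:
  assumes "loc_integrable f" "test_fun phi"
  shows "L1 (\<lambda>x. f x * phi x)" "L1 (\<lambda>x. f x * deriv phi x)"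
proof -
  obtain a b where ab: "-1 < a" "a < b" "b < 1" "\<And>x. x \<notin> {a..b} \<Longrightarrow> phi x = 0" "\<And>x. x \<notin> {a..b} \<Longrightarrow> deriv phi x = 0"
    using test_fun_support[OF assms(2)] by metis
  show "L1 (\<lambda>x. f x * phi x)" "L1 (\<lambda>x. f x * deriv phi x)"
    using loc_integrable_mult[OF assms(1) test_funD(3)[OF assms(2)] ab(1-4)]
      loc_integrable_mult[OF assms(1) test_funD(2)[OF assms(2)] ab(1-3,5)]
    by (simp_all add: mult.commute)
qed

section \<open>Bump functions and the fundamental lemma of the calculus of variations\<close>

definition bump :: "real \<Rightarrow> real \<Rightarrow> nat \<Rightarrow> real \<Rightarrow> real" where
  "bump a b n x = (let q = (max 0 (x - a) * max 0 (b - x))\<^sup>2 in q / (q + 1 / Suc n))"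

lemma DERIV_max_square: "((\<lambda>x::real. (max 0 x)\<^sup>2) has_real_derivative 2 * max 0 x) (at x)"
proof -
  consider "x < 0" | "x > 0" | "x = 0" by linarith
  then show ?thesis
  proof cases
    case 1
    have "((\<lambda>x::real. (max 0 x)\<^sup>2) has_real_derivative 0) (at x)"
      by (rule has_field_derivative_transform_within_open[of "\<lambda>_. 0" _ _ "{..<0}"]) (use 1 in auto)
    then show ?thesis using 1 by simp
  next
    case 2
    have "((\<lambda>x::real. (max 0 x)\<^sup>2) has_real_derivative 2 * x) (at x)"
      by (rule has_field_derivative_transform_within_open[of "\<lambda>x. x\<^sup>2" _ _ "{0<..}"])
        (use 2 in \<open>auto intro!: derivative_eq_intros\<close>)
    then show ?thesis using 2 by simp
  next
    case 3
    have "((\<lambda>h::real. (max 0 h)\<^sup>2 / h) \<longlongrightarrow> 0) (at 0)"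
    proof (rule tendsto_0_le[where K=1])
      show "((\<lambda>h::real. h) \<longlongrightarrow> 0) (at 0)" by (rule tendsto_ident_at)
    qed (auto simp: eventually_at_filter max_def power2_eq_square)
    then show ?thesis using 3 by (simp add: DERIV_def)
  qed
qed

lemma bump_test_fun:
  assumes "-1 < a" "a < b" "b < 1"
  shows "test_fun (bump a b n)"
proof -
  define q where "q = (\<lambda>x::real. (max 0 (x - a))\<^sup>2 * (max 0 (b - x))\<^sup>2)"
  define q' where "q' = (\<lambda>x::real. 2 * max 0 (x - a) * (max 0 (b - x))\<^sup>2 - (max 0 (x - a))\<^sup>2 * (2 * max 0 (b - x)))"
  have q0: "q x + 1 / Suc n > 0" for x
    unfolding q_def by (intro add_nonneg_pos) auto
  have qd: "(q has_real_derivative q' x) (at x)" for x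
    unfolding q_def q'_def
    by (rule derivative_eq_intros DERIV_chain'[OF _ DERIV_max_square] refl)+ (auto simp: algebra_simps)
  then have d: "(bump a b n has_real_derivative (q' x * (q x + 1 / Suc n) - q x * q' x) / (q x + 1 / Suc n)\<^sup>2) (at x)" for x
  proof -
    have e: "bump a b n = (\<lambda>x. q x / (q x + 1 / Suc n))"
      by (simp add: fun_eq_iff bump_def Let_def power_mult_distrib q_def)
    show ?thesis
      unfolding e using q0[of x] qd[of x]
      by (auto intro!: derivative_eq_intros simp: power2_eq_square)
  qed
  then have "deriv (bump a b n) = (\<lambda>x. (q' x * (q x + 1 / Suc n) - q x * q' x) / (q x + 1 / Suc n)\<^sup>2)"
    by (intro ext DERIV_imp_deriv)
  moreover have "continuous_on UNIV q" "continuous_on UNIV q'"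
    unfolding q_def q'_def by (intro continuous_intros)+
  then have "continuous_on UNIV (\<lambda>x. (q' x * (q x + 1 / Suc n) - q x * q' x) / (q x + 1 / Suc n)\<^sup>2)"
    by (intro continuous_intros) (use q0 in \<open>auto simp: less_imp_neq[symmetric]\<close>)
  moreover have "bump a b n differentiable (at x)" for x
    using d real_differentiable_def by blast
  moreover have "bump a b n x = 0" if "x \<notin> {a..b}" for x
    using that by (auto simp: bump_def Let_def max_def)
  ultimately show ?thesis
    using assms unfolding test_fun_def by metis
qed

lemma bump_bounds: "0 \<le> bump a b n x" "bump a b n x \<le> 1"
  by (auto simp: bump_def Let_def divide_simps add_nonneg_pos)

lemma bump_limit: "(\<lambda>n. bump a b n x) \<longlonglongrightarrow> indicator {a<..<b} x"
proof (cases "x \<in> {a<..<b}")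
  case True
  define q where "q = (max 0 (x - a) * max 0 (b - x))\<^sup>2"
  have q: "q > 0" using True by (auto simp: q_def)
  have "(\<lambda>n. q / (q + 1 / Suc n)) \<longlonglongrightarrow> q / (q + 0)"
    by (intro tendsto_intros LIMSEQ_Suc[OF lim_1_over_n]) (use q in auto)
  then show ?thesis using True q by (simp add: bump_def Let_def q_def)
next
  case False
  then show ?thesis by (auto simp: bump_def Let_def max_def)
qed

text \<open>Testing with bump functions and dominated convergence show that \<open>h\<close> has
  integral zero over every open interval with closure in (-1,1). So the primitive of
  \<open>h\<close> cut off to such an interval vanishes and \<open>L1_vanishing_primitive\<close>
  applies; countably many of these intervals exhaust (-1,1).\<close>

lemma loc_integrable_eq_zero:
  assumes h: "loc_integrable h" and z: "\<And>phi. test_fun phi \<Longrightarrow> (LBINT x:Omega. h x * phi x) = 0"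
  shows "AE x in lborel. x \<in> Omega \<longrightarrow> h x = 0"
proof -
  have int0: "(LBINT x:{a<..<b}. h x) = 0" if ab: "-1 < a" "a < b" "b < 1" for a b
  proof -
    have i: "integrable lborel (\<lambda>x. indicator {a..b} x *\<^sub>R h x)"
      using h ab by (auto simp: loc_integrable_def set_integrable_def)
    have "(\<lambda>n. \<integral>x. bump a b n x *\<^sub>R (indicator {a..b} x *\<^sub>R h x) \<partial>lborel)
       \<longlonglongrightarrow> (\<integral>x. indicator {a<..<b} x *\<^sub>R (indicator {a..b} x *\<^sub>R h x) \<partial>lborel)"
    proof (rule integral_dominated_convergence[where w="\<lambda>x. norm (indicator {a..b} x *\<^sub>R h x)"])
      have [measurable]: "bump a b n \<in> borel_measurable borel" for n
        using test_funD(3)[OF bump_test_fun[OF ab]] by (rule borel_measurable_continuous_onI)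
      have [measurable]: "(\<lambda>x. indicator {a..b} x *\<^sub>R h x) \<in> borel_measurable borel"
        using i by auto
      show "(\<lambda>x. indicat_real {a<..<b} x *\<^sub>R indicat_real {a..b} x *\<^sub>R h x) \<in> borel_measurable lborel"
        by measurable
      show "(\<lambda>x. bump a b n x *\<^sub>R indicat_real {a..b} x *\<^sub>R h x) \<in> borel_measurable lborel" for n
        by measurable
      show "AE x in lborel. (\<lambda>n. bump a b n x *\<^sub>R indicat_real {a..b} x *\<^sub>R h x)
        \<longlonglongrightarrow> indicat_real {a<..<b} x *\<^sub>R indicat_real {a..b} x *\<^sub>R h x"
        by (intro AE_I2 tendsto_intros bump_limit)
      show "AE x in lborel. norm (bump a b n x *\<^sub>R indicat_real {a..b} x *\<^sub>R h x) \<le> norm (indicat_real {a..b} x *\<^sub>R h x)" for n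
        using bump_bounds[of a b n] by (intro AE_I2) (auto simp: abs_mult intro!: mult_left_le_one_le)
    qed (rule integrable_norm[OF i])
    moreover have "(\<integral>x. bump a b n x *\<^sub>R (indicator {a..b} x *\<^sub>R h x) \<partial>lborel) = 0" for n
    proof -
      have "(\<integral>x. bump a b n x *\<^sub>R (indicator {a..b} x *\<^sub>R h x) \<partial>lborel) = (LBINT x:Omega. h x * bump a b n x)"
        unfolding set_lebesgue_integral_def
        by (intro Bochner_Integration.integral_cong)
          (use ab in \<open>auto simp: indicator_def bump_def Let_def max_def\<close>)
      then show ?thesis using z[OF bump_test_fun[OF ab]] by simp
    qed
    ultimately have "(\<integral>x. indicator {a<..<b} x *\<^sub>R (indicator {a..b} x *\<^sub>R h x) \<partial>lborel) = 0"
      by (simp add: LIMSEQ_const_iff)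
    also have "(\<integral>x. indicator {a<..<b} x *\<^sub>R (indicator {a..b} x *\<^sub>R h x) \<partial>lborel) = (LBINT x:{a<..<b}. h x)"
      unfolding set_lebesgue_integral_def
      by (intro Bochner_Integration.integral_cong) (auto simp: indicator_def)
    finally show ?thesis .
  qed
  have ae: "AE x in lborel. x \<in> {a<..<b} \<longrightarrow> h x = 0" if ab: "-1 < a" "a < b" "b < 1" for a b
  proof -
    define H where "H = (\<lambda>x. indicator {a<..<b} x * h x)"
    have "set_integrable lborel {a..b} h"
      using h ab by (auto simp: loc_integrable_def)
    then have "set_integrable lborel {a<..<b} h"
      by (rule set_integrable_subset) auto
    then have H: "L1 H"
      unfolding set_integrable_def H_def
      by (rule back_subst[of "integrable lborel"]) (use ab in \<open>auto simp: indicator_def\<close>)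
    have "AE x in lborel. x \<in> Omega \<longrightarrow> H x = 0"
    proof (rule L1_vanishing_primitive[OF H])
      fix x :: real assume x: "x \<in> {-1..1}"
      have "integral {-1..x} H = (LBINT y:{-1<..<x}. H y)"
        using set_integral_eq_primitive(1)[OF H x] by simp
      also have "\<dots> = (LBINT y:{a<..<min x b}. h y)"
        unfolding set_lebesgue_integral_def H_def
        by (intro Bochner_Integration.integral_cong) (use ab in \<open>auto simp: indicator_def\<close>)
      also have "\<dots> = 0"
        using int0[of a "min x b"] ab by (cases "a < min x b") (auto simp: set_lebesgue_integral_def)
      finally show "integral {-1..x} H = 0" .
    qed
    then show ?thesis
      by eventually_elim (use ab in \<open>auto simp: H_def\<close>)
  qed
  \<comment> \<open>The double \<open>Suc\<close> makes the first interval already have radius 1/2;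
    with a single one it would be empty for \<open>n = 0\<close>, whereas \<open>ae\<close> asks for
    left end < right end.\<close>
  have "AE x in lborel. \<forall>n. x \<in> {- (1 - 1 / (Suc (Suc n)))<..<1 - 1 / Suc (Suc n)} \<longrightarrow> h x = 0"
    unfolding AE_all_countable
  proof
    fix n
    show "AE x in lborel. x \<in> {- (1 - 1 / (Suc (Suc n)))<..<1 - 1 / Suc (Suc n)} \<longrightarrow> h x = 0"
      by (rule ae) (auto simp: field_simps)
  qed
  then show ?thesis
  proof eventually_elim
    case (elim x)
    show ?case
    proof
      assume "x \<in> Omega"
      then have "1 - \<bar>x\<bar> > 0" by auto
      then obtain n where "inverse (real (Suc n)) < 1 - \<bar>x\<bar>"
        using reals_Archimedean by blast
      moreover have "1 / real (Suc (Suc n)) \<le> inverse (real (Suc n))"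
        by (auto simp: field_simps)
      ultimately have "x \<in> {- (1 - 1 / (Suc (Suc n)))<..<1 - 1 / Suc (Suc n)}"
        by auto
      then show "h x = 0" using elim by blast
    qed
  qed
qed

lemma loc_integrable_diff: "loc_integrable f \<Longrightarrow> loc_integrable g \<Longrightarrow> loc_integrable (\<lambda>x. f x - g x)"
  by (auto simp: loc_integrable_def)

lemma is_weak_deriv_unique:
  assumes "is_weak_deriv f g" "is_weak_deriv f g'"
  shows "AE x in lborel. x \<in> Omega \<longrightarrow> g x = g' x"
proof -
  have l: "loc_integrable g" "loc_integrable g'"
    using assms by (auto simp: is_weak_deriv_def)
  have "AE x in lborel. x \<in> Omega \<longrightarrow> g x - g' x = 0"
  proof (rule loc_integrable_eq_zero)
    fix phi assume phi: "test_fun phi"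
    have "(LBINT x:Omega. (g x - g' x) * phi x) = (LBINT x:Omega. g x * phi x) - (LBINT x:Omega. g' x * phi x)"
      using set_integral_diff(2)[OF test_fun_mult_L1(1)[OF l(1) phi] test_fun_mult_L1(1)[OF l(2) phi]]
      by (simp add: left_diff_distrib)
    also have "\<dots> = 0"
      using assms phi by (simp add: is_weak_deriv_def)
    finally show "(LBINT x:Omega. (g x - g' x) * phi x) = 0" .
  qed (use l in \<open>rule loc_integrable_diff\<close>)
  then show ?thesis by eventually_elim auto
qed

text \<open>A primitive of \<open>psi\<close> vanishes left of the support by construction, and
  right of it because the mean of \<open>psi\<close> is zero.\<close>

lemma test_fun_primitive:
  assumes psi: "continuous_on UNIV psi" and ab: "-1 < a" "a < b" "b < 1" "\<And>x. x \<notin> {a..b} \<Longrightarrow> psi x = 0"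
    and mean: "(LBINT x:Omega. psi x) = 0"
  obtains phi where "test_fun phi" "deriv phi = psi"
proof -
  \<comment> \<open>The base point -2 lies left of the support, and every \<open>x\<close> from
    \<open>a\<close> on is interior to \<open>{-2..x+1}\<close>, so the one-sided fundamental
    theorem yields a two-sided derivative there.\<close>
  define phi where "phi = (\<lambda>x. integral {-2..x} psi)"
  have ii: "psi integrable_on {x..y}" for x y
    by (rule integrable_continuous_real) (rule continuous_on_subset[OF psi], auto)
  have z: "phi x = 0" if "x < a" for x
  proof -
    have "integral {-2..x} psi = integral {-2..x} (\<lambda>_. 0)"
      by (intro Henstock_Kurzweil_Integration.integral_cong) (use that ab(4) in auto)
    then show ?thesis by (simp add: phi_def)
  qed
  have d: "(phi has_real_derivative psi x) (at x)" for x
  proof (cases "x < a")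
    case True
    have "(phi has_real_derivative 0) (at x)"
      by (rule has_field_derivative_transform_within_open[of "\<lambda>_. 0" _ _ "{..<a}"]) (use True z in auto)
    then show ?thesis using True ab(4)[of x] by simp
  next
    case False
    have "((\<lambda>y. integral {-2..y} psi) has_real_derivative psi x) (at x within {-2..x+1})"
      by (rule integral_has_real_derivative) (use False ab continuous_on_subset[OF psi] in auto)
    moreover have "at x within {-2..x+1} = at x"
      using False ab by (intro at_within_interior) auto
    ultimately show ?thesis by (simp add: phi_def)
  qed
  have 1: "phi x = 0" if "x > b" for x
  proof -
    have L: "L1 psi"
      by (rule L1_continuous) (rule continuous_on_subset[OF psi], auto)
    have "integral {-1..b} psi + integral {b..1} psi = integral {-1..1} psi"
      using ab by (intro Henstock_Kurzweil_Integration.integral_combine ii) auto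
    moreover have "integral {-1..1} psi = 0"
      using set_integral_eq_primitive(1)[OF L, of 1] mean by simp
    moreover have "integral {b..y} psi = 0" for y
    proof -
      have "integral {b<..<y} psi = integral {b<..<y} (\<lambda>_. 0)"
        by (intro Henstock_Kurzweil_Integration.integral_cong) (use ab(4) in auto)
      then show ?thesis by (simp add: integral_open_interval_real)
    qed
    moreover have "phi (-1) = 0" using z ab by auto
    moreover have "phi x = integral {-2..-1} psi + (integral {-1..b} psi + integral {b..x} psi)"
      using that ab Henstock_Kurzweil_Integration.integral_combine[OF _ _ ii[of "-2" x], of "-1"]
        Henstock_Kurzweil_Integration.integral_combine[OF _ _ ii[of "-1" x], of b]
      unfolding phi_def by simp
    ultimately show ?thesis by (simp add: phi_def)
  qed
  have dd: "deriv phi = psi"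
    using d by (intro ext DERIV_imp_deriv)
  moreover have "test_fun phi"
  proof -
    have "phi differentiable (at x)" for x using d real_differentiable_def by blast
    moreover have "phi x = 0" if "x \<notin> {a..b}" for x
      using z[of x] 1[of x] that by (cases "x < a") auto
    ultimately show ?thesis
      unfolding test_fun_def dd using psi ab by blast
  qed
  ultimately show thesis using that by blast
qed

text \<open>du Bois-Reymond: subtracting the primitive of \<open>g\<close> leaves a function whose weak derivative
  vanishes, and test functions with mean zero are exactly the derivatives of test functions.\<close>

lemma is_weak_deriv_imp_ac:
  assumes w: "is_weak_deriv f g" and L: "L1 f" "L1 g"
  obtains r where "ac r g" "AE x in lborel. x \<in> Omega \<longrightarrow> f x = r x"
proof -
  define P where "P = (\<lambda>x. integral {-1..x} g)"
  have P: "ac P g" by (rule acI[OF L(2)]) (simp add: P_def)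
  have LP: "L1 P" by (rule L1_continuous[OF ac_continuous[OF P]])
  have wP: "is_weak_deriv P g" by (rule ac_imp_is_weak_deriv[OF P])
  define h where "h = (\<lambda>x. f x - P x)"
  have Lh: "L1 h" unfolding h_def by (rule set_integral_diff(1)[OF L(1) LP])
  have h0: "(LBINT x:Omega. h x * deriv phi x) = 0" if phi: "test_fun phi" for phi
  proof -
    have "(LBINT x:Omega. h x * deriv phi x) = (LBINT x:Omega. f x * deriv phi x) - (LBINT x:Omega. P x * deriv phi x)"
      unfolding h_def using set_integral_diff(2)[OF test_fun_mult_L1(2)[OF loc_integrable_L1[OF L(1)] phi] test_fun_mult_L1(2)[OF loc_integrable_L1[OF LP] phi]]
      by (simp add: left_diff_distrib)
    also have "\<dots> = 0" using w wP phi by (simp add: is_weak_deriv_def)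
    finally show ?thesis .
  qed
  \<comment> \<open>A reference test function with nonzero mean. Subtracting the right multiple of
    \<open>p0\<close> from any test function leaves mean zero, that is, a derivative; consequently
    \<open>h\<close> must be the constant \<open>k\<close>, its average against
    \<open>p0\<close>.\<close>
  define p0 where "p0 = bump (-1/2) (1/2) 0"
  have p0: "test_fun p0" unfolding p0_def by (rule bump_test_fun) auto
  define m0 where "m0 = (LBINT x:Omega. p0 x)"
  have Lp0: "L1 p0" by (rule L1_continuous[OF test_funD(3)[OF p0]])
  have "m0 \<noteq> 0"
  proof
    assume m: "m0 = 0"
    have "AE x in lborel. indicator Omega x *\<^sub>R p0 x = 0"
      using Lp0 m unfolding set_integrable_def m0_def set_lebesgue_integral_def
      by (subst (asm) integral_nonneg_eq_0_iff_AE) (auto simp: p0_def bump_bounds)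
    then have "AE x in lborel. x \<in> Omega \<longrightarrow> p0 x = (\<lambda>_. 0) x"
      by eventually_elim auto
    then have "p0 0 = 0"
      by (rule AE_eq_imp_eq_continuous) (use test_funD(3)[OF p0] in auto)
    then show False by (simp add: p0_def bump_def Let_def power2_eq_square)
  qed
  define k where "k = (LBINT x:Omega. h x * p0 x) / m0"
  have "AE x in lborel. x \<in> Omega \<longrightarrow> h x - k = 0"
  proof (rule loc_integrable_eq_zero)
    show "loc_integrable (\<lambda>x. h x - k)"
      by (intro loc_integrable_L1 set_integral_diff(1) Lh L1_continuous continuous_intros)
    fix psi assume psi: "test_fun psi"
    define m where "m = (LBINT x:Omega. psi x)"
    have Lpsi: "L1 psi" by (rule L1_continuous[OF test_funD(3)[OF psi]])
    obtain a b where ab: "-1 < a" "a < b" "b < 1" "\<And>x. x \<notin> {a..b} \<Longrightarrow> psi x = 0"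
      using test_fun_support[OF psi] by metis
    obtain phi where phi: "test_fun phi" "deriv phi = (\<lambda>x. psi x - m / m0 * p0 x)"
    proof (rule test_fun_primitive)
      show "continuous_on UNIV (\<lambda>x. psi x - m / m0 * p0 x)"
        by (intro continuous_intros test_funD[OF psi] test_funD[OF p0])
      show "-1 < min a (-1/2)" "min a (-1/2) < max b (1/2)" "max b (1/2) < 1"
        using ab by auto
      show "psi x - m / m0 * p0 x = 0" if "x \<notin> {min a (-1/2)..max b (1/2)}" for x
      proof -
        have "x \<notin> {a..b}" "x \<notin> {-1/2..1/2}" using that by auto
        then show ?thesis using ab(4)[of x] by (auto simp: p0_def bump_def Let_def max_def)
      qed
      show "(LBINT x:Omega. psi x - m / m0 * p0 x) = 0"
        using \<open>m0 \<noteq> 0\<close> set_integral_diff(2)[OF Lpsi set_integrable_mult_right[of "m / m0", OF Lp0]]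
        by (simp add: m_def[symmetric] m0_def[symmetric])
    qed blast
    have lh: "loc_integrable h" by (rule loc_integrable_L1[OF Lh])
    have "0 = (LBINT x:Omega. h x * psi x - m / m0 * (h x * p0 x))"
      using h0[OF phi(1)] by (simp add: phi(2) algebra_simps)
    also have "\<dots> = (LBINT x:Omega. h x * psi x) - m / m0 * (LBINT x:Omega. h x * p0 x)"
      using set_integral_diff(2)[OF test_fun_mult_L1(1)[OF lh psi] set_integrable_mult_right[of "m/m0", OF test_fun_mult_L1(1)[OF lh p0]]]
      by simp
    also have "\<dots> = (LBINT x:Omega. h x * psi x) - k * m"
      by (simp add: k_def)
    also have "\<dots> = (LBINT x:Omega. (h x - k) * psi x)"
      using set_integral_diff(2)[OF test_fun_mult_L1(1)[OF lh psi] set_integrable_mult_right[of k, OF Lpsi]]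
      by (simp add: m_def left_diff_distrib)
    finally show "(LBINT x:Omega. (h x - k) * psi x) = 0" by simp
  qed
  then have "AE x in lborel. x \<in> Omega \<longrightarrow> f x = P x + k"
    by eventually_elim (auto simp: h_def)
  moreover have "ac (\<lambda>x. P x + k) g"
    using ac_add[OF P ac_const[of k]] by simp
  ultimately show thesis using that by blast
qed

lemma is_weak_deriv_cong_AE:
  assumes "is_weak_deriv f g" "AE x in lborel. x \<in> Omega \<longrightarrow> f x = f' x" "L1 f" "L1 f'"
  shows "is_weak_deriv f' g"
  unfolding is_weak_deriv_def
proof (intro conjI allI impI)
  show "loc_integrable f'" by (rule loc_integrable_L1[OF assms(4)])
  show "loc_integrable g" using assms(1) by (auto simp: is_weak_deriv_def)
  fix phi assume phi: "test_fun phi"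
  have "(LBINT x:Omega. f x * deriv phi x) = (LBINT x:Omega. f' x * deriv phi x)"
    unfolding set_lebesgue_integral_def
  proof (rule integral_cong_AE)
    show "(\<lambda>x. indicat_real Omega x *\<^sub>R (f x * deriv phi x)) \<in> borel_measurable lborel"
      "(\<lambda>x. indicat_real Omega x *\<^sub>R (f' x * deriv phi x)) \<in> borel_measurable lborel"
      using test_fun_mult_L1(2)[OF loc_integrable_L1[OF assms(3)] phi]
         test_fun_mult_L1(2)[OF loc_integrable_L1[OF assms(4)] phi]
      by (auto simp: set_integrable_def)
    show "AE x in lborel. indicat_real Omega x *\<^sub>R (f x * deriv phi x) = indicat_real Omega x *\<^sub>R (f' x * deriv phi x)"
      using assms(2) by eventually_elim (auto simp: indicator_def)
  qed
  then show "(LBINT x:Omega. f' x * deriv phi x) = - (LBINT x:Omega. g x * phi x)"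
    using assms(1) phi by (simp add: is_weak_deriv_def)
qed

section \<open>Weighted Sobolev spaces\<close>

lemma weight_measurable [measurable]: "weight nu \<in> borel_measurable borel"
  unfolding weight_def by measurable

lemma weight_nonneg: "0 \<le> weight nu x"
  by (simp add: weight_def)

text \<open>With \<open>t = (x + 1) / 2\<close> the weight equals
  \<open>4 powr nu * t powr nu * (1 - t) powr nu\<close>, which is a Beta integrand with both
  parameters \<open>nu + 1 > 0\<close>.\<close>

lemma weight_integrable:
  assumes "-1 < nu"
  shows "set_integrable lborel Omega (weight nu)"
proof -
  have "((\<lambda>t. t powr nu * (1 - t) powr nu) has_integral Beta (nu+1) (nu+1)) (cbox 0 1)"
    using has_integral_Beta_real[of "nu+1" "nu+1"] assms by simp
  from has_integral_affinity[OF this, of "1/2" "1/2"]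
  have 1: "(\<lambda>x. (x/2 + 1/2) powr nu * (1 - (x/2 + 1/2)) powr nu) integrable_on ((\<lambda>x. 2 * x - 1) ` {0..1})"
    by (auto simp: integrable_on_def)
  have 2: "(\<lambda>x::real. 2 * x - 1) ` {0..1} = {-1..1}"
  proof -
    have "x \<in> (\<lambda>x::real. 2 * x - 1) ` {0..1}" if "x \<in> {-1..1}" for x
      by (rule image_eqI[of _ _ "(x+1)/2"]) (use that in \<open>auto simp: field_simps\<close>)
    then show ?thesis by auto
  qed
  have "(\<lambda>x. 4 powr nu * ((x/2 + 1/2) powr nu * (1 - (x/2 + 1/2)) powr nu)) integrable_on {-1..1}"
    using integrable_on_cmult_left[OF 1, of "4 powr nu"] unfolding 2 by simp
  moreover have "4 powr nu * ((x/2 + 1/2) powr nu * (1 - (x/2 + 1/2)) powr nu) = weight nu x" if "x \<in> {-1..1}" for x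
  proof -
    have "4 powr nu * ((x/2 + 1/2) powr nu * (1 - (x/2 + 1/2)) powr nu)
      = (4 * ((x/2 + 1/2) * (1 - (x/2 + 1/2)))) powr nu"
      using that by (simp add: powr_mult)
    also have "4 * ((x/2 + 1/2) * (1 - (x/2 + 1/2))) = 1 - x\<^sup>2"
      by (simp add: field_simps power2_eq_square)
    finally show ?thesis by (simp add: weight_def)
  qed
  ultimately have "weight nu integrable_on {-1..1}"
    by (rule integrable_eq)
  then have "weight nu absolutely_integrable_on {-1..1}"
    by (rule nonnegative_absolutely_integrable_1) (rule weight_nonneg)
  then have "weight nu absolutely_integrable_on Omega"
    by (simp add: absolutely_integrable_on_Icc_iff_Ioo)
  then show ?thesis
    unfolding set_integrable_def by (subst (asm) integrable_completion) auto
qed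

section \<open>Embedding of the weighted L2 space into L1\<close>

definition weight_mass :: "real \<Rightarrow> real" where
  "weight_mass nu = (LBINT x:Omega. weight nu x)"

lemma weight_mass_nonneg: "0 \<le> weight_mass nu"
  unfolding weight_mass_def set_lebesgue_integral_def
  by (intro Bochner_Integration.integral_nonneg) (simp add: weight_nonneg)

lemma L2w_norm_nonneg: "0 \<le> L2w_norm mu g"
  unfolding L2w_norm_def set_lebesgue_integral_def
  by (intro real_sqrt_ge_zero Bochner_Integration.integral_nonneg) (simp add: weight_nonneg)

lemma L2w_norm_power2: "(L2w_norm mu g)\<^sup>2 = (LBINT x:Omega. (g x)\<^sup>2 * weight mu x)"
  unfolding L2w_norm_def set_lebesgue_integral_def
  by (intro real_sqrt_pow2 Bochner_Integration.integral_nonneg) (simp add: weight_nonneg)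

text \<open>The Cauchy-Schwarz constant for splitting \<open>g\<close> as \<open>g\<close> times the
  root of the weight times the root of its reciprocal \<open>weight (- mu)\<close>. Adding 1 makes
  it strictly positive, so that it may be divided by.\<close>

definition embed_const :: "real \<Rightarrow> real" where
  "embed_const mu = sqrt (weight_mass (- mu)) + 1"

lemma embed_const_pos: "embed_const mu > 0"
  unfolding embed_const_def by (intro add_nonneg_pos) (auto simp: weight_mass_nonneg)

text \<open>Cauchy-Schwarz in the form of a pointwise inequality of arithmetic and geometric means
  with a free parameter \<open>M\<close>. The pointwise bound first gives integrability and then,
  after choosing \<open>M\<close>, the estimate. The reciprocal weight has exponent
  \<open>- mu > -1\<close> and is integrable.\<close>

lemma
  assumes "mu < 1" "g \<in> L2w mu"
  shows L2w_imp_L1: "L1 g"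
    and L2w_L1_bound: "integral {-1..1} (\<lambda>x. \<bar>g x\<bar>) \<le> embed_const mu * L2w_norm mu g"
proof -
  have m: "set_borel_measurable lborel Omega g"
    and s: "set_integrable lborel Omega (\<lambda>x. (g x)\<^sup>2 * weight mu x)"
    using assms(2) by (auto simp: L2w_def)
  have w: "set_integrable lborel Omega (weight (- mu))"
    by (rule weight_integrable) (use assms in auto)
  let ?K = "embed_const mu"
  have Kp: "?K > 0" by (rule embed_const_pos)
  have amgm: "\<bar>g x\<bar> \<le> (?K / M * ((g x)\<^sup>2 * weight mu x) + M / ?K * weight (- mu) x) / 2"
    if "M > 0" "x \<in> Omega" for M x
  proof -
    define v where "v = weight mu x"
    have "x\<^sup>2 < 1" using that by (auto simp: abs_square_less_1)
    then have v: "v > 0" by (simp add: v_def weight_def)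
    have wv: "weight (- mu) x = 1 / v"
      by (simp add: v_def weight_def powr_minus_divide)
    define p where "p = sqrt (?K / M * v) * \<bar>g x\<bar>"
    define q where "q = sqrt (M / ?K / v)"
    have "2 * p * q \<le> p\<^sup>2 + q\<^sup>2"
      using sum_squares_bound[of p q] by simp
    moreover have "p * q = \<bar>g x\<bar>"
      using Kp that v by (simp add: p_def q_def real_sqrt_mult real_sqrt_divide field_simps)
    moreover have "p\<^sup>2 = ?K / M * ((g x)\<^sup>2 * v)"
      using Kp that v by (simp add: p_def power_mult_distrib)
    moreover have "q\<^sup>2 = M / ?K * (1 / v)"
      using Kp that v by (simp add: q_def)
    ultimately show ?thesis
      unfolding wv v_def[symmetric] by simp
  qed
  have S: "set_integrable lborel Omega (\<lambda>x. (?K / M * ((g x)\<^sup>2 * weight mu x) + M / ?K * weight (- mu) x) / 2)" for M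
    using s w by simp
  show L: "L1 g"
  proof (rule set_integrable_bound[OF S[of 1] m])
    show "AE x in lborel. x \<in> Omega \<longrightarrow> norm (g x)
      \<le> norm ((?K / 1 * ((g x)\<^sup>2 * weight mu x) + 1 / ?K * weight (- mu) x) / 2)"
      using amgm[of 1] by (intro AE_I2) (auto intro: order_trans[OF _ abs_ge_self])
  qed
  have La: "L1 (\<lambda>x. \<bar>g x\<bar>)" by (rule set_integrable_abs[OF L])
  \<comment> \<open>The optimal \<open>M\<close> would be the norm itself, but that may be zero and
    \<open>M\<close> is a divisor; so \<open>M\<close> is taken strictly larger and then lowered to
    the norm.\<close>
  have "integral {-1..1} (\<lambda>x. \<bar>g x\<bar>) \<le> ?K * M" if M: "M > L2w_norm mu g" for M
  proof -
    have Mp: "M > 0" using M L2w_norm_nonneg[of mu g] by linarith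
    have "integral {-1..1} (\<lambda>x. \<bar>g x\<bar>) = (LBINT x:Omega. \<bar>g x\<bar>)"
      using set_integral_eq_primitive(1)[OF La, of 1] by simp
    also have "\<dots> \<le> (LBINT x:Omega. (?K / M * ((g x)\<^sup>2 * weight mu x) + M / ?K * weight (- mu) x) / 2)"
      by (rule set_integral_mono[OF La S]) (use amgm Mp in auto)
    also have "\<dots> = (?K / M * (L2w_norm mu g)\<^sup>2 + M / ?K * weight_mass (- mu)) / 2"
      using s w by (simp add: L2w_norm_power2 weight_mass_def)
    also have "\<dots> \<le> (?K / M * M\<^sup>2 + M / ?K * ?K\<^sup>2) / 2"
    proof -
      have "(L2w_norm mu g)\<^sup>2 \<le> M\<^sup>2"
        using M L2w_norm_nonneg[of mu g] by (intro power_mono) auto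
      moreover have "weight_mass (- mu) \<le> ?K\<^sup>2"
      proof -
        have "weight_mass (- mu) = (sqrt (weight_mass (- mu)))\<^sup>2"
          by (simp add: weight_mass_nonneg)
        also have "\<dots> \<le> ?K\<^sup>2"
          unfolding embed_const_def by (intro power_mono) (auto simp: weight_mass_nonneg)
        finally show ?thesis .
      qed
      ultimately show ?thesis
        using Kp Mp by (intro divide_right_mono add_mono mult_left_mono) auto
    qed
    also have "\<dots> = ?K * M" using Kp Mp by (simp add: power2_eq_square)
    finally show ?thesis .
  qed
  note b = this
  show "integral {-1..1} (\<lambda>x. \<bar>g x\<bar>) \<le> ?K * L2w_norm mu g"
  proof (rule field_le_epsilon)
    fix e :: real assume e: "e > 0"
    have "integral {-1..1} (\<lambda>x. \<bar>g x\<bar>) \<le> ?K * (L2w_norm mu g + e / ?K)"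
      using e Kp by (intro b) auto
    then show "integral {-1..1} (\<lambda>x. \<bar>g x\<bar>) \<le> ?K * L2w_norm mu g + e"
      using Kp by (simp add: distrib_left)
  qed
qed

lemma
  assumes "g \<in> L2w mu" "AE x in lborel. x \<in> Omega \<longrightarrow> g x = g' x" "set_borel_measurable lborel Omega g'"
  shows L2w_cong_AE: "g' \<in> L2w mu"
    and L2w_norm_cong_AE: "L2w_norm mu g' = L2w_norm mu g"
proof -
  have m: "(\<lambda>x. indicator Omega x *\<^sub>R g x) \<in> borel_measurable borel"
    "(\<lambda>x. indicator Omega x *\<^sub>R g' x) \<in> borel_measurable borel"
    using assms by (auto simp: L2w_def set_borel_measurable_def)
  have e: "(\<lambda>x. indicator Omega x *\<^sub>R ((f x)\<^sup>2 * weight mu x)) = (\<lambda>x. (indicator Omega x *\<^sub>R f x)\<^sup>2 * weight mu x)" for f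
    by (auto simp: fun_eq_iff indicator_def)
  have mm: "(\<lambda>x. indicator Omega x *\<^sub>R ((g x)\<^sup>2 * weight mu x)) \<in> borel_measurable lborel"
    "(\<lambda>x. indicator Omega x *\<^sub>R ((g' x)\<^sup>2 * weight mu x)) \<in> borel_measurable lborel"
    unfolding e using m by measurable
  have ae: "AE x in lborel. indicator Omega x *\<^sub>R ((g' x)\<^sup>2 * weight mu x) = indicator Omega x *\<^sub>R ((g x)\<^sup>2 * weight mu x)"
    using assms(2) by eventually_elim (auto simp: indicator_def)
  have "integrable lborel (\<lambda>x. indicator Omega x *\<^sub>R ((g' x)\<^sup>2 * weight mu x))"
    using assms(1) integrable_cong_AE[OF mm(2,1) ae] by (auto simp: L2w_def set_integrable_def)
  then show "g' \<in> L2w mu"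
    using assms(3) by (simp add: L2w_def set_integrable_def)
  show "L2w_norm mu g' = L2w_norm mu g"
    unfolding L2w_norm_def set_lebesgue_integral_def
    using integral_cong_AE[OF mm(2,1) ae] by simp
qed

text \<open>These are the functions later encoded by coefficient triples. The factor 3 comes from
  bounding the square of a sum of three terms by three times the sum of squares. The bound scales
  like \<open>R\<close>, the sup norm of the coefficients, so uniform convergence of coefficients
  implies convergence in the weighted norm.\<close>

lemma
  assumes mu: "-1 < mu" and g: "g1 \<in> L2w mu" "g2 \<in> L2w mu"
    and c: "continuous_on {-1..1} a1" "continuous_on {-1..1} a2" "continuous_on {-1..1} a0"
    and b: "\<And>x. x \<in> {-1..1} \<Longrightarrow> \<bar>a1 x\<bar> \<le> R \<and> \<bar>a2 x\<bar> \<le> R \<and> \<bar>a0 x\<bar> \<le> R"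
  shows L2w_combination: "(\<lambda>x. a1 x * g1 x + a2 x * g2 x + a0 x) \<in> L2w mu" (is "?q \<in> _")
    and L2w_norm_combination: "(L2w_norm mu (\<lambda>x. a1 x * g1 x + a2 x * g2 x + a0 x))\<^sup>2
      \<le> 3 * R\<^sup>2 * ((L2w_norm mu g1)\<^sup>2 + (L2w_norm mu g2)\<^sup>2 + weight_mass mu)"
proof -
  have m: "(\<lambda>x. indicator Omega x *\<^sub>R g1 x) \<in> borel_measurable borel"
    "(\<lambda>x. indicator Omega x *\<^sub>R g2 x) \<in> borel_measurable borel"
    using g by (auto simp: L2w_def set_borel_measurable_def)
  have ma: "(\<lambda>x. indicator Omega x *\<^sub>R a x) \<in> borel_measurable borel" if "continuous_on {-1..1} a" for a :: "real \<Rightarrow> real"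
    by (rule borel_measurable_continuous_on_indicator) (auto intro: continuous_on_subset[OF that])
  note mm = m ma[OF c(1)] ma[OF c(2)] ma[OF c(3)]
  have eq: "(\<lambda>x. indicator Omega x *\<^sub>R ?q x) = (\<lambda>x. (indicator Omega x *\<^sub>R a1 x) * (indicator Omega x *\<^sub>R g1 x)
     + (indicator Omega x *\<^sub>R a2 x) * (indicator Omega x *\<^sub>R g2 x) + indicator Omega x *\<^sub>R a0 x)"
    by (auto simp: fun_eq_iff indicator_def)
  have mq: "(\<lambda>x. indicator Omega x *\<^sub>R ?q x) \<in> borel_measurable borel"
    unfolding eq by (intro borel_measurable_add borel_measurable_times mm)
  have mq2: "(\<lambda>x. indicator Omega x *\<^sub>R ((?q x)\<^sup>2 * weight mu x)) \<in> borel_measurable borel"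
  proof -
    have "(\<lambda>x. indicator Omega x *\<^sub>R ((?q x)\<^sup>2 * weight mu x)) = (\<lambda>x. (indicator Omega x *\<^sub>R ?q x)\<^sup>2 * weight mu x)"
      by (auto simp: fun_eq_iff indicator_def)
    then show ?thesis using mq by simp
  qed
  let ?B = "\<lambda>x. 3 * R\<^sup>2 * ((g1 x)\<^sup>2 * weight mu x + (g2 x)\<^sup>2 * weight mu x + weight mu x)"
  have iB: "set_integrable lborel Omega ?B"
    using g weight_integrable[OF mu] by (simp add: L2w_def)
  have pt: "(?q x)\<^sup>2 * weight mu x \<le> ?B x" if "x \<in> Omega" for x
  proof -
    have sq: "\<bar>a\<bar> \<le> R \<Longrightarrow> a\<^sup>2 \<le> R\<^sup>2" for a :: real
      using abs_le_square_iff[of a R] by auto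
    have three: "(p + q + r)\<^sup>2 \<le> 3 * (p\<^sup>2 + q\<^sup>2 + r\<^sup>2)" for p q r :: real
    proof -
      have "3 * (p\<^sup>2 + q\<^sup>2 + r\<^sup>2) - (p + q + r)\<^sup>2 = (p - q)\<^sup>2 + (q - r)\<^sup>2 + (p - r)\<^sup>2"
        by (simp add: power2_eq_square algebra_simps)
      then show ?thesis using zero_le_power2[of "p - q"] zero_le_power2[of "q - r"] zero_le_power2[of "p - r"] by linarith
    qed
    have "(?q x)\<^sup>2 \<le> 3 * ((a1 x * g1 x)\<^sup>2 + (a2 x * g2 x)\<^sup>2 + (a0 x)\<^sup>2)"
      by (rule three)
    also have "\<dots> \<le> 3 * (R\<^sup>2 * (g1 x)\<^sup>2 + R\<^sup>2 * (g2 x)\<^sup>2 + R\<^sup>2)"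
      unfolding power_mult_distrib
      by (intro mult_left_mono add_mono mult_right_mono sq) (use b[of x] that in auto)
    finally have "(?q x)\<^sup>2 * weight mu x \<le> 3 * (R\<^sup>2 * (g1 x)\<^sup>2 + R\<^sup>2 * (g2 x)\<^sup>2 + R\<^sup>2) * weight mu x"
      by (rule mult_right_mono) (rule weight_nonneg)
    then show ?thesis by (simp add: algebra_simps)
  qed
  have iq: "set_integrable lborel Omega (\<lambda>x. (?q x)\<^sup>2 * weight mu x)"
  proof (rule set_integrable_bound[OF iB])
    show "set_borel_measurable lborel Omega (\<lambda>x. (?q x)\<^sup>2 * weight mu x)"
      using mq2 by (simp add: set_borel_measurable_def)
    show "AE x in lborel. x \<in> Omega \<longrightarrow> norm ((?q x)\<^sup>2 * weight mu x) \<le> norm (?B x)"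
      using pt by (intro AE_I2) (auto simp: abs_mult weight_nonneg intro: order_trans[OF _ abs_ge_self])
  qed
  show "?q \<in> L2w mu"
    using iq mq by (simp add: L2w_def set_borel_measurable_def)
  have "(L2w_norm mu ?q)\<^sup>2 \<le> (LBINT x:Omega. ?B x)"
    unfolding L2w_norm_power2 by (rule set_integral_mono[OF iq iB pt])
  also have "\<dots> = 3 * R\<^sup>2 * ((L2w_norm mu g1)\<^sup>2 + (L2w_norm mu g2)\<^sup>2 + weight_mass mu)"
    using g weight_integrable[OF mu] by (simp add: L2w_def L2w_norm_power2 weight_mass_def)
  finally show "(L2w_norm mu ?q)\<^sup>2 \<le> 3 * R\<^sup>2 * ((L2w_norm mu g1)\<^sup>2 + (L2w_norm mu g2)\<^sup>2 + weight_mass mu)" .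
qed

lemma zero_L2w: "(\<lambda>_. 0) \<in> L2w mu" "L2w_norm mu (\<lambda>_. 0) = 0"
  by (auto simp: L2w_def set_borel_measurable_def set_integrable_def L2w_norm_def set_lebesgue_integral_def)

lemma L2w_continuous:
  assumes mu: "-1 < mu" and c: "continuous_on {-1..1} a"
  shows "a \<in> L2w mu"
proof -
  obtain R where R: "\<And>x. x \<in> {-1..1} \<Longrightarrow> \<bar>a x\<bar> \<le> R"
    using continuous_on_Icc_bounded[OF c] by blast
  then have "R \<ge> 0" using order_trans[OF abs_ge_zero R[of 0]] by auto
  then show ?thesis
    using L2w_combination[OF mu zero_L2w(1) zero_L2w(1) _ _ c, of "\<lambda>_. 0" "\<lambda>_. 0" R] R by auto
qed

lemma Hw_norm_nonneg: "0 \<le> Hw_norm mu k f"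
  by (simp add: Hw_norm_def sum_nonneg)

text \<open>Needed for \<open>wderiv f\<close>: of this arbitrary choice only
  \<open>is_weak_deriv\<close> is known, and membership in \<open>L2w\<close> asks for measurability
  on all of (-1,1). It is the pointwise limit of cut-offs to compact subintervals.\<close>

lemma loc_integrable_measurable:
  assumes "loc_integrable f"
  shows "set_borel_measurable lborel Omega f"
proof -
  define f' where "f' n x = indicator {- (1 - 1 / (Suc (Suc n)))..1 - 1 / Suc (Suc n)} x *\<^sub>R f x" for n x
  have "f' n \<in> borel_measurable lborel" for n
  proof -
    have "set_integrable lborel {- (1 - 1 / (Suc (Suc n)))..1 - 1 / Suc (Suc n)} f"
      using assms unfolding loc_integrable_def by (auto simp: field_simps)
    then show ?thesis by (auto simp: f'_def[abs_def] set_integrable_def)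
  qed
  moreover have "(\<lambda>n. f' n x) \<longlonglongrightarrow> indicator Omega x *\<^sub>R f x" for x
  proof (cases "x \<in> Omega")
    case True
    then have "1 - \<bar>x\<bar> > 0" by auto
    moreover have "(\<lambda>n. 1 / real (Suc (Suc n))) \<longlonglongrightarrow> 0"
      using LIMSEQ_Suc[OF LIMSEQ_Suc[OF lim_1_over_n[where 'a=real]]] by simp
    ultimately have "eventually (\<lambda>n. 1 / real (Suc (Suc n)) < 1 - \<bar>x\<bar>) sequentially"
      by (rule order_tendstoD(2)[rotated])
    then have "eventually (\<lambda>n. f' n x = indicator Omega x *\<^sub>R f x) sequentially"
      by eventually_elim (use True in \<open>auto simp: f'_def indicator_def\<close>)
    then show ?thesis by (rule tendsto_eventually)
  next
    case False
    have "f' n x = 0" for n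
    proof -
      have "0 < 1 / real (Suc (Suc n))" by simp
      then have "x \<notin> {- (1 - 1 / (Suc (Suc n)))..1 - 1 / Suc (Suc n)}"
        using False unfolding greaterThanLessThan_iff atLeastAtMost_iff by linarith
      then show ?thesis unfolding f'_def by (subst indicator_simps(2)) auto
    qed
    then show ?thesis using False by simp
  qed
  ultimately show ?thesis
    unfolding set_borel_measurable_def by (rule borel_measurable_LIMSEQ_real[where u=f', rotated])
qed

lemma is_weak_deriv_wderiv: "is_weak_deriv f g \<Longrightarrow> is_weak_deriv f (wderiv f)"
  unfolding wderiv_def by (rule someI[of "is_weak_deriv f"])

lemma wderiv_AE_eq:
  assumes "is_weak_deriv f g"
  shows "AE x in lborel. x \<in> Omega \<longrightarrow> g x = wderiv f x"
  using is_weak_deriv_unique[OF assms is_weak_deriv_wderiv[OF assms]] .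

lemma wderiv_L2w:
  assumes "is_weak_deriv f g" "g \<in> L2w mu"
  shows "wderiv f \<in> L2w mu" "L2w_norm mu (wderiv f) = L2w_norm mu g"
proof -
  have m: "set_borel_measurable lborel Omega (wderiv f)"
    using is_weak_deriv_wderiv[OF assms(1)] loc_integrable_measurable by (simp add: is_weak_deriv_def)
  show "wderiv f \<in> L2w mu" "L2w_norm mu (wderiv f) = L2w_norm mu g"
    using L2w_cong_AE[OF assms(2) wderiv_AE_eq[OF assms(1)] m]
      L2w_norm_cong_AE[OF assms(2) wderiv_AE_eq[OF assms(1)] m] by auto
qed

section \<open>Weighted Sobolev spaces described by primitives\<close>

locale weight_exponent =
  fixes mu :: real
  assumes mu: "-1 < mu" "mu < 1"
begin

lemma Hw1_intro:
  assumes "ac f g" "g \<in> L2w mu"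
  shows "f \<in> Hw mu 1" "Hw_norm mu 1 f = sqrt ((L2w_norm mu f)\<^sup>2 + (L2w_norm mu g)\<^sup>2)"
proof -
  note w = ac_imp_is_weak_deriv[OF assms(1)]
  note L = wderiv_L2w[OF w assms(2)]
  have c: "continuous_on {-1..1} f" by (rule ac_continuous[OF assms(1)])
  have "f \<in> L2w mu" by (rule L2w_continuous[OF mu(1) c])
  then show "f \<in> Hw mu 1"
    using w L(1) c by (auto simp: Hw_def le_Suc_eq)
  show "Hw_norm mu 1 f = sqrt ((L2w_norm mu f)\<^sup>2 + (L2w_norm mu g)\<^sup>2)"
    by (simp add: Hw_norm_def L)
qed

text \<open>The outer \<open>wderiv\<close> is applied to a chosen representative that agrees with
  \<open>r\<close> only almost everywhere, so the weak derivative of \<open>r\<close> has to be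
  carried over to that representative before uniqueness can be used.\<close>

lemma wderiv_wderiv_AE_eq:
  assumes "ac f r" "ac r q"
  shows "is_weak_deriv (wderiv f) q"
    and "AE x in lborel. x \<in> Omega \<longrightarrow> q x = wderiv (wderiv f) x"
proof -
  note w = ac_imp_is_weak_deriv[OF assms(1)]
  have r: "L1 r" "r \<in> L2w mu"
    using ac_continuous[OF assms(2)] L1_continuous L2w_continuous[OF mu(1)] by auto
  show "is_weak_deriv (wderiv f) q"
    by (rule is_weak_deriv_cong_AE[OF ac_imp_is_weak_deriv[OF assms(2)] wderiv_AE_eq[OF w] r(1)])
      (rule L2w_imp_L1[OF mu(2) wderiv_L2w(1)[OF w r(2)]])
  then show "AE x in lborel. x \<in> Omega \<longrightarrow> q x = wderiv (wderiv f) x"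
    by (rule wderiv_AE_eq)
qed

lemma Hw2_intro:
  assumes "ac f r" "ac r q" "q \<in> L2w mu"
  shows "f \<in> Hw mu 2" "Hw_norm mu 2 f = sqrt ((L2w_norm mu f)\<^sup>2 + (L2w_norm mu r)\<^sup>2 + (L2w_norm mu q)\<^sup>2)"
proof -
  note w = ac_imp_is_weak_deriv[OF assms(1)]
  have r: "r \<in> L2w mu" using ac_continuous[OF assms(2)] L2w_continuous[OF mu(1)] by auto
  note L = wderiv_L2w[OF w r]
  note w2 = wderiv_wderiv_AE_eq(1)[OF assms(1,2)]
  note L' = wderiv_L2w[OF w2 assms(3)]
  have c: "continuous_on {-1..1} f" by (rule ac_continuous[OF assms(1)])
  have "f \<in> L2w mu" by (rule L2w_continuous[OF mu(1) c])
  then show "f \<in> Hw mu 2"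
    using w w2 L(1) L'(1) c by (auto simp: Hw_def le_Suc_eq less_Suc_eq numeral_2_eq_2)
  show "Hw_norm mu 2 f = sqrt ((L2w_norm mu f)\<^sup>2 + (L2w_norm mu r)\<^sup>2 + (L2w_norm mu q)\<^sup>2)"
    by (simp add: Hw_norm_def numeral_2_eq_2 L L')
qed

text \<open>Here the continuous representative built into \<open>Hw\<close> pays off: du
  Bois-Reymond produces equality with a primitive almost everywhere, and continuity improves it to
  equality on [-1,1].\<close>

lemma is_weak_deriv_imp_ac_continuous:
  assumes "is_weak_deriv f g" "continuous_on {-1..1} f" "L1 g"
  shows "ac f g"
proof -
  obtain r where r: "ac r g" "AE x in lborel. x \<in> Omega \<longrightarrow> f x = r x"
    using is_weak_deriv_imp_ac[OF assms(1) L1_continuous[OF assms(2)] assms(3)] by blast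
  have "f x = r x" if "x \<in> {-1..1}" for x
    by (rule AE_eq_imp_eq_continuous[OF r(2) assms(2) ac_continuous[OF r(1)] that])
  then show ?thesis by (intro ac_cong[OF r(1)]) auto
qed

lemma Hw1_elim:
  assumes "f \<in> Hw mu 1"
  obtains g where "ac f g" "g \<in> L2w mu"
proof
  have *: "\<exists>g. is_weak_deriv f g" "wderiv f \<in> L2w mu" "continuous_on {-1..1} f"
    using assms by (auto simp: Hw_def le_Suc_eq)
  then show "wderiv f \<in> L2w mu" by simp
  show "ac f (wderiv f)"
    using * L2w_imp_L1[OF mu(2)] is_weak_deriv_wderiv is_weak_deriv_imp_ac_continuous by blast
qed

text \<open>The chosen \<open>wderiv f\<close> need not be continuous. It agrees almost everywhere
  with a primitive \<open>r\<close> of the second derivative, and replacing it by \<open>r\<close>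
  does not change the primitive \<open>f\<close>.\<close>

lemma Hw2_elim:
  assumes "f \<in> Hw mu 2"
  obtains r q where "ac f r" "ac r q" "q \<in> L2w mu"
proof -
  have *: "\<exists>g. is_weak_deriv f g" "\<exists>g. is_weak_deriv (wderiv f) g" "wderiv f \<in> L2w mu"
    "wderiv (wderiv f) \<in> L2w mu" "continuous_on {-1..1} f"
    using assms by (auto simp: Hw_def le_Suc_eq less_Suc_eq numeral_2_eq_2)
  have 1: "ac f (wderiv f)"
    using * L2w_imp_L1[OF mu(2)] is_weak_deriv_wderiv is_weak_deriv_imp_ac_continuous by blast
  have "is_weak_deriv (wderiv f) (wderiv (wderiv f))"
    using * is_weak_deriv_wderiv by blast
  then obtain r where r: "ac r (wderiv (wderiv f))" "AE x in lborel. x \<in> Omega \<longrightarrow> wderiv f x = r x"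
    using is_weak_deriv_imp_ac L2w_imp_L1[OF mu(2)] * by metis
  have "ac f r"
    by (rule ac_cong_AE[OF 1 r(2) L1_continuous[OF ac_continuous[OF r(1)]]])
  with r *(4) that show thesis by blast
qed

text \<open>The oscillation of \<open>f\<close> is at most the L1 norm \<open>J\<close> of its
  derivative. Averaging \<open>\<bar>f x\<bar> \<le> \<bar>f y\<bar> + J\<close> over
  \<open>y\<close> leaves only L1 norms of \<open>f\<close> and \<open>g\<close>, which the
  embedding controls; the factor 2 comes from bounding each of the two weighted norms by the full
  Sobolev norm.\<close>

lemma sobolev_bound:
  assumes "ac f g" "g \<in> L2w mu" "x \<in> {-1..1}"
  shows "\<bar>f x\<bar> \<le> 2 * embed_const mu * Hw_norm mu 1 f"
proof -
  let ?K = "embed_const mu"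
  have c: "continuous_on {-1..1} f" by (rule ac_continuous[OF assms(1)])
  have f: "f \<in> L2w mu" by (rule L2w_continuous[OF mu(1) c])
  have Lg: "L1 (\<lambda>x. \<bar>g x\<bar>)" by (rule set_integrable_abs[OF acD(1)[OF assms(1)]])
  define J where "J = integral {-1..1} (\<lambda>x. \<bar>g x\<bar>)"
  have d: "\<bar>f x - f y\<bar> \<le> J" if y: "y \<in> {-1..1}" for y
  proof -
    have *: "\<bar>f q - f p\<bar> \<le> J" if "p \<in> {-1..1}" "q \<in> {-1..1}" "p \<le> q" for p q
    proof -
      have "f q - f p = integral {-1..q} g - integral {-1..p} g"
        using acD(2)[OF assms(1) that(1)] acD(2)[OF assms(1) that(2)] by linarith
      also have "\<dots> = integral {p..q} g"
        using Henstock_Kurzweil_Integration.integral_combine[of "-1" p q g] that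
          L1_integrable_on[OF acD(1)[OF assms(1)], of "-1" q] by auto
      finally have "\<bar>f q - f p\<bar> \<le> integral {p..q} (\<lambda>x. \<bar>g x\<bar>)"
        using that L1_integrable_on[OF acD(1)[OF assms(1)], of p q] L1_integrable_on[OF Lg, of p q]
        by (simp add: integral_norm_bound_integral[of g "{p..q}" "\<lambda>x. \<bar>g x\<bar>", simplified])
      also have "\<dots> \<le> J"
        unfolding J_def using that by (intro integral_subset_le L1_integrable_on[OF Lg]) auto
      finally show ?thesis .
    qed
    show ?thesis
      using *[OF y assms(3)] *[OF assms(3) y] by (cases "x \<le> y") auto
  qed
  have "integral {-1..1} (\<lambda>y::real. \<bar>f x\<bar>) \<le> integral {-1..1} (\<lambda>y. \<bar>f y\<bar> + J)"
  proof (rule integral_le)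
    show "(\<lambda>y. \<bar>f y\<bar> + J) integrable_on {-1..1}"
      by (intro integrable_continuous_real continuous_intros c)
    show "\<bar>f x\<bar> \<le> \<bar>f y\<bar> + J" if "y \<in> {-1..1}" for y
      using d[OF that] by linarith
  qed (rule integrable_const_ivl)
  also have "integral {-1..1} (\<lambda>y. \<bar>f y\<bar> + J) = integral {-1..1} (\<lambda>y. \<bar>f y\<bar>) + 2 * J"
    by (subst Henstock_Kurzweil_Integration.integral_add)
      (auto intro!: integrable_continuous_real continuous_intros c)
  finally have "\<bar>f x\<bar> \<le> integral {-1..1} (\<lambda>y. \<bar>f y\<bar>) + J"
    using integral_nonneg[OF L1_integrable_on[OF set_integrable_abs[OF L1_continuous[OF c]], of "-1" 1]] by simp
  also have "\<dots> \<le> ?K * L2w_norm mu f + ?K * L2w_norm mu g"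
    unfolding J_def by (intro add_mono L2w_L1_bound mu f assms)
  also have "\<dots> \<le> ?K * Hw_norm mu 1 f + ?K * Hw_norm mu 1 f"
    unfolding Hw1_intro(2)[OF assms(1,2)] using embed_const_pos[of mu]
    by (intro add_mono mult_left_mono real_le_rsqrt) auto
  finally show ?thesis by simp
qed

lemma sobolev_bound2:
  assumes "ac f r" "ac r q" "q \<in> L2w mu" "x \<in> {-1..1}"
  shows "\<bar>f x\<bar> \<le> 2 * embed_const mu * Hw_norm mu 2 f" "\<bar>r x\<bar> \<le> 2 * embed_const mu * Hw_norm mu 2 f"
proof -
  have r: "r \<in> L2w mu" using ac_continuous[OF assms(2)] L2w_continuous[OF mu(1)] by auto
  have K: "0 \<le> 2 * embed_const mu" using embed_const_pos[of mu] by simp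
  have 1: "\<bar>f x\<bar> \<le> 2 * embed_const mu * Hw_norm mu 1 f"
    by (rule sobolev_bound[OF assms(1) r assms(4)])
  also have "\<dots> \<le> 2 * embed_const mu * Hw_norm mu 2 f"
    unfolding Hw1_intro(2)[OF assms(1) r] Hw2_intro(2)[OF assms(1-3)]
    by (intro mult_left_mono K) simp
  finally show "\<bar>f x\<bar> \<le> 2 * embed_const mu * Hw_norm mu 2 f" .
  have "\<bar>r x\<bar> \<le> 2 * embed_const mu * Hw_norm mu 1 r"
    by (rule sobolev_bound[OF assms(2-4)])
  also have "\<dots> \<le> 2 * embed_const mu * Hw_norm mu 2 f"
    unfolding Hw1_intro(2)[OF assms(2,3)] Hw2_intro(2)[OF assms(1-3)]
    by (intro mult_left_mono K) simp
  finally show "\<bar>r x\<bar> \<le> 2 * embed_const mu * Hw_norm mu 2 f" .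
qed

end

section \<open>Evolution equations in spaces of bounded continuous functions\<close>

instance bcontfun :: (metric_space, banach) banach ..

text \<open>Extends a continuous function on [a,b] by its end values to an element of the Banach
  space of bounded continuous functions on the line. It serves both in space, on [-1,1], and in
  time, on [0,S].\<close>

definition bcext :: "real \<Rightarrow> real \<Rightarrow> (real \<Rightarrow> 'a::metric_space) \<Rightarrow> (real \<Rightarrow>\<^sub>C 'a)" where
  "bcext a b f = Bcontfun (\<lambda>x. f (clamp a b x))"

lemma clamp_real:
  fixes a b :: real
  shows "a \<le> b \<Longrightarrow> clamp a b x \<in> {a..b}" "x \<in> {a..b} \<Longrightarrow> clamp a b x = x"
  using clamp_in_interval[of a b x] clamp_cancel_cbox[of x a b] by auto

lemma bcext_apply:
  assumes "continuous_on {a..b} f"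
  shows "apply_bcontfun (bcext a b f) x = f (clamp a b x)"
proof -
  obtain g :: "real \<Rightarrow>\<^sub>C 'a" where g: "\<And>x. g x = f (clamp a b x)"
    using continuous_on_cbox_bcontfunE[of a b f] assms by (metis cbox_interval)
  then have eq: "(\<lambda>x. f (clamp a b x)) = apply_bcontfun g" by auto
  show ?thesis unfolding bcext_def eq apply_bcontfun_inverse by (rule g)
qed

lemma bcext_apply_in:
  assumes "continuous_on {a..b} f" "x \<in> {a..b}"
  shows "apply_bcontfun (bcext a b f) x = f x"
  using bcext_apply[OF assms(1), of x] clamp_real(2)[OF assms(2)] by simp

lemma norm_bcext_le:
  fixes f :: "real \<Rightarrow> 'a::real_normed_vector"
  assumes "continuous_on {a..b} f" "a \<le> b" "\<And>x. x \<in> {a..b} \<Longrightarrow> norm (f x) \<le> M"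
  shows "norm (bcext a b f) \<le> M"
  by (rule norm_bound) (use assms clamp_real in \<open>auto simp: bcext_apply\<close>)

lemma bounded_linear_apply_bcontfun:
  "bounded_linear (\<lambda>f :: 'a::topological_space \<Rightarrow>\<^sub>C 'b::real_normed_vector. apply_bcontfun f x)"
  by (rule bounded_linear_intro[where K=1]) (auto simp: norm_bounded)

text \<open>Scalar times vector, so that one product covers both real functions and coefficient
  triples.\<close>

definition mulC :: "('a::topological_space \<Rightarrow>\<^sub>C real) \<Rightarrow> ('a \<Rightarrow>\<^sub>C 'b::real_normed_vector) \<Rightarrow> ('a \<Rightarrow>\<^sub>C 'b)" where
  "mulC f g = Bcontfun (\<lambda>x. f x *\<^sub>R g x)"

lemma mulC_apply [simp]: "apply_bcontfun (mulC f g) x = f x *\<^sub>R g x"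
proof -
  have "(\<lambda>x. f x *\<^sub>R g x) \<in> bcontfun"
    by (rule bcontfun_normI[where b="norm f * norm g"])
      (auto intro!: continuous_intros mult_mono norm_bounded norm_bounded[of f, simplified])
  then show ?thesis by (simp add: mulC_def Bcontfun_inverse)
qed

lemma norm_mulC: "norm (mulC f g) \<le> norm f * norm g"
  by (rule norm_bound) (auto intro!: mult_mono norm_bounded norm_bounded[of f, simplified])

lemma bounded_bilinear_mulC: "bounded_bilinear mulC"
proof
  show "\<exists>K. \<forall>a b. norm (mulC a b) \<le> norm a * norm b * K"
    using norm_mulC by (intro exI[of _ 1]) auto
qed (auto intro!: bcontfun_eqI simp: algebra_simps)

lemmas mulC_simps = bounded_bilinear.add_left[OF bounded_bilinear_mulC] bounded_bilinear.add_right[OF bounded_bilinear_mulC]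
  bounded_bilinear.diff_left[OF bounded_bilinear_mulC] bounded_bilinear.diff_right[OF bounded_bilinear_mulC]
  bounded_bilinear.scaleR_left[OF bounded_bilinear_mulC] bounded_bilinear.scaleR_right[OF bounded_bilinear_mulC]

type_synonym triple = "real \<times> real \<times> real"

text \<open>A continuous function regarded as a coefficient triple: only the slot without a singular
  factor is filled, so the function encoded by \<open>third f\<close> is \<open>f\<close>.\<close>

definition third :: "('a::topological_space \<Rightarrow>\<^sub>C real) \<Rightarrow> ('a \<Rightarrow>\<^sub>C triple)" where
  "third f = Bcontfun (\<lambda>x. (0, 0, f x))"

lemma third_apply [simp]: "apply_bcontfun (third f) x = (0, 0, f x)"
proof -
  have "(\<lambda>x. (0::real, 0::real, f x)) \<in> bcontfun"
    by (rule bcontfun_normI[where b="norm f"])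
      (auto intro!: continuous_intros simp: norm_Pair norm_bounded[of f, simplified])
  then show ?thesis by (simp add: third_def Bcontfun_inverse)
qed

lemma norm_third: "norm (third f) \<le> norm f"
  by (rule norm_bound) (auto simp: norm_Pair norm_bounded[of f, simplified])

lemma bounded_linear_third: "bounded_linear third"
  by (rule bounded_linear_intro[where K=1]) (auto intro!: bcontfun_eqI simp: norm_third)

lemmas third_simps = linear_add[OF bounded_linear.linear[OF bounded_linear_third]]
  linear_diff[OF bounded_linear.linear[OF bounded_linear_third]]
  linear_scale[OF bounded_linear.linear[OF bounded_linear_third]]

text \<open>Contraction on the ball of radius \<open>2 * \<rho>\<close> in the curves on [0,S]. From
  \<open>F 0 = 0\<close> the Lipschitz constant also bounds \<open>F\<close> by
  \<open>L * (2 * \<rho>)\<close> on that ball, so the single condition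
  \<open>S * L \<le> 1 / 2\<close> makes the integral at most \<open>\<rho>\<close>, hence the map a
  self-map, and gives contraction factor 1/2.\<close>

lemma picard_local_solution:
  fixes F :: "'a::banach \<Rightarrow> 'a"
  assumes S: "0 \<le> S" and Z0: "continuous_on {0..S} Z0" "\<And>t. t \<in> {0..S} \<Longrightarrow> norm (Z0 t) \<le> \<rho>"
    and F0: "F 0 = 0" and L: "0 \<le> L" "S * L \<le> 1 / 2"
    and lip: "\<And>x y. norm x \<le> 2 * \<rho> \<Longrightarrow> norm y \<le> 2 * \<rho> \<Longrightarrow> norm (F x - F y) \<le> L * norm (x - y)"
  obtains Z where "continuous_on {0..S} Z" "\<And>t. t \<in> {0..S} \<Longrightarrow> norm (Z t) \<le> 2 * \<rho>"
    "continuous_on {0..S} (\<lambda>t. F (Z t))"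
    "\<And>t. t \<in> {0..S} \<Longrightarrow> Z t = Z0 t + integral {0..t} (\<lambda>s. F (Z s))"
proof -
  have rho: "0 \<le> \<rho>" using Z0(2)[of 0] S norm_ge_zero order_trans by (metis atLeastAtMost_iff order_refl)
  define \<Phi>0 where "\<Phi>0 z t = Z0 t + integral {0..t} (\<lambda>s. F (apply_bcontfun z s))" for z :: "real \<Rightarrow>\<^sub>C 'a" and t
  define \<Phi> where "\<Phi> z = bcext 0 S (\<Phi>0 z)" for z
  let ?B = "cball (0 :: real \<Rightarrow>\<^sub>C 'a) (2 * \<rho>)"
  have zB: "norm (apply_bcontfun z s) \<le> 2 * \<rho>" if "z \<in> ?B" for z s
    using that norm_bounded[of z s] by auto
  have cF: "continuous_on A (\<lambda>s. F (z s))" if "continuous_on A z" "\<And>s. s \<in> A \<Longrightarrow> norm (z s) \<le> 2 * \<rho>" for A :: "real set" and z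
  proof -
    have "L-lipschitz_on (cball 0 (2 * \<rho>)) F"
      using lip L by (auto intro!: lipschitz_onI simp: dist_norm)
    then have "continuous_on (cball 0 (2 * \<rho>)) F" by (rule lipschitz_on_continuous_on)
    then show ?thesis
      by (rule continuous_on_compose2[OF _ that(1)]) (use that(2) in auto)
  qed
  have FzI: "(\<lambda>s. F (apply_bcontfun z s)) integrable_on {0..t}" if "z \<in> ?B" for z t
    by (rule integrable_continuous_real) (rule cF, use zB[OF that] in auto)
  have cPhi: "continuous_on {0..S} (\<Phi>0 z)" if "z \<in> ?B" for z
    unfolding \<Phi>0_def by (intro continuous_intros Z0 indefinite_integral_continuous_1 FzI that)
  have Fb: "norm (F x) \<le> L * (2 * \<rho>)" if "norm x \<le> 2 * \<rho>" for x
  proof -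
    have "norm (F x) \<le> L * norm x" using lip[of x 0] that rho F0 by simp
    also have "\<dots> \<le> L * (2 * \<rho>)" using that L by (intro mult_left_mono) auto
    finally show ?thesis .
  qed
  have "\<exists>!z. z \<in> ?B \<and> \<Phi> z = z"
  proof (rule Banach_fix[where c="1/2"])
    show "complete ?B" by (simp add: complete_eq_closed)
    show "?B \<noteq> {}" using rho by simp
    show "\<Phi> ` ?B \<subseteq> ?B"
    proof safe
      fix z assume z: "z \<in> ?B"
      have "norm (\<Phi> z) \<le> 2 * \<rho>"
        unfolding \<Phi>_def
      proof (rule norm_bcext_le[OF cPhi[OF z] S])
        fix t assume t: "t \<in> {0..S}"
        have "norm (integral {0..t} (\<lambda>s. F (apply_bcontfun z s))) \<le> integral {0..t} (\<lambda>s. L * (2 * \<rho>))"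
          by (rule integral_norm_bound_integral[OF FzI[OF z] integrable_const_ivl Fb]) (rule zB[OF z])
        also have "\<dots> = t * L * (2 * \<rho>)" using t by simp
        also have "\<dots> \<le> S * L * (2 * \<rho>)"
          using t L rho by (intro mult_right_mono) auto
        also have "\<dots> \<le> 1 / 2 * (2 * \<rho>)"
          using L rho by (intro mult_right_mono) auto
        finally show "norm (\<Phi>0 z t) \<le> 2 * \<rho>"
          unfolding \<Phi>0_def using Z0(2)[OF t] by (intro order_trans[OF norm_triangle_ineq]) auto
      qed
      then show "\<Phi> z \<in> ?B" by simp
    qed
    show "dist (\<Phi> x) (\<Phi> y) \<le> 1 / 2 * dist x y" if "x \<in> ?B" "y \<in> ?B" for x y
    proof (rule dist_bound)
      fix s
      define t where "t = clamp 0 S s"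
      have t: "t \<in> {0..S}" using clamp_real(1)[OF S] by (simp add: t_def)
      have "dist (\<Phi> x s) (\<Phi> y s) = norm (\<Phi>0 x t - \<Phi>0 y t)"
        unfolding \<Phi>_def bcext_apply[OF cPhi[OF that(1)]] bcext_apply[OF cPhi[OF that(2)]] t_def dist_norm ..
      also have "\<dots> = norm (integral {0..t} (\<lambda>s. F (apply_bcontfun x s) - F (apply_bcontfun y s)))"
        unfolding \<Phi>0_def
        by (subst Henstock_Kurzweil_Integration.integral_diff[OF FzI[OF that(1)] FzI[OF that(2)]]) simp
      also have "\<dots> \<le> integral {0..t} (\<lambda>s. L * norm (x - y))"
      proof (rule integral_norm_bound_integral)
        show "norm (F (apply_bcontfun x s) - F (apply_bcontfun y s)) \<le> L * norm (x - y)" for s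
        proof -
          have "norm (F (apply_bcontfun x s) - F (apply_bcontfun y s)) \<le> L * norm (apply_bcontfun (x - y) s)"
            using lip[OF zB zB] that by simp
          also have "\<dots> \<le> L * norm (x - y)"
            by (intro mult_left_mono norm_bounded L)
          finally show ?thesis .
        qed
      qed (auto intro!: integrable_diff FzI that)
      also have "\<dots> = t * L * norm (x - y)" using t by simp
      also have "\<dots> \<le> S * L * norm (x - y)" using t L by (intro mult_right_mono) auto
      also have "\<dots> \<le> 1 / 2 * dist x y" unfolding dist_norm using L by (intro mult_right_mono) auto
      finally show "dist (\<Phi> x s) (\<Phi> y s) \<le> 1 / 2 * dist x y" .
    qed
  qed auto
  then obtain z where z: "z \<in> ?B" "\<Phi> z = z" by blast
  show thesis
  proof (rule that[of "apply_bcontfun z"])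
    show "continuous_on {0..S} (\<lambda>t. F (apply_bcontfun z t))" by (rule cF) (use zB[OF z(1)] in auto)
    show "norm (apply_bcontfun z t) \<le> 2 * \<rho>" for t by (rule zB[OF z(1)])
    show "apply_bcontfun z t = Z0 t + integral {0..t} (\<lambda>s. F (apply_bcontfun z s))" if "t \<in> {0..S}" for t
      using bcext_apply_in[OF cPhi[OF z(1)] that] z(2) by (simp add: \<Phi>_def \<Phi>0_def)
  qed auto
qed

text \<open>With \<open>I\<close> the primitive of \<open>D\<close>, the derivative of
  \<open>exp (- K * t) * I t\<close> is \<open>exp (- K * t) * (D t - K * I t)\<close>, which is not
  positive. As \<open>I 0 = 0\<close>, both \<open>I\<close> and \<open>D \<le> K * I\<close> are at
  most zero.\<close>

lemma gronwall_zero: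
  fixes D :: "real \<Rightarrow> real"
  assumes D: "continuous_on {0..S} D" and K: "\<And>t. t \<in> {0..S} \<Longrightarrow> D t \<le> K * integral {0..t} D"
    and "0 \<le> K" and t: "t \<in> {0..S}"
  shows "D t \<le> 0"
proof -
  define I where "I t = integral {0..t} D" for t
  have cI: "continuous_on {0..S} I"
    unfolding I_def using integrable_continuous_real[OF D] by (rule indefinite_integral_continuous_1)
  have "exp (- K * t) * I t \<le> exp (- K * 0) * I 0"
  proof (cases "t = 0")
    case False
    show ?thesis
    proof (rule DERIV_nonpos_imp_decreasing_open[of 0 t])
      show "0 \<le> t" using t by auto
      show "continuous_on {0..t} (\<lambda>t. exp (- K * t) * I t)"
        by (intro continuous_intros continuous_on_subset[OF cI]) (use t in auto)
      fix x assume x: "0 < x" "x < t"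
      have "(I has_real_derivative D x) (at x within {0..S})"
        unfolding I_def by (rule integral_has_real_derivative[OF D]) (use x t in auto)
      moreover have "at x within {0..S} = at x"
        using x t by (intro at_within_interior) auto
      ultimately have "(I has_real_derivative D x) (at x)" by simp
      then have "((\<lambda>t. exp (- K * t) * I t) has_real_derivative exp (- K * x) * (D x - K * I x)) (at x)"
        by (auto intro!: derivative_eq_intros simp: algebra_simps)
      moreover have "exp (- K * x) * (D x - K * I x) \<le> 0"
        using K[of x] x t unfolding I_def by (intro mult_nonneg_nonpos) auto
      ultimately show "\<exists>y. ((\<lambda>t. exp (- K * t) * I t) has_real_derivative y) (at x) \<and> y \<le> 0" by blast
    qed
  qed simp
  then have "I t \<le> 0" by (simp add: I_def mult_le_0_iff)
  then have "K * I t \<le> 0" using assms(3) by (rule mult_nonneg_nonpos[rotated])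
  with K[OF t] show ?thesis unfolding I_def by linarith
qed

section \<open>The Green operator\<close>

definition dw1 :: "real \<Rightarrow> real \<Rightarrow> real" where
  "dw1 b x = cosh ((1 + x) / sqrt b) / sqrt b"

definition dw2 :: "real \<Rightarrow> real \<Rightarrow> real" where
  "dw2 b x = - cosh ((1 - x) / sqrt b) / sqrt b"

definition kap :: "real \<Rightarrow> real" where
  "kap b = - (1 / (b * wronskian b))"

lemma w_derivs:
  assumes "b > 0"
  shows "(w1 b has_real_derivative dw1 b x) (at x)" "(w2 b has_real_derivative dw2 b x) (at x)"
    "(dw1 b has_real_derivative w1 b x / b) (at x)" "(dw2 b has_real_derivative w2 b x / b) (at x)"
  unfolding w1_def w2_def dw1_def dw2_def
  using assms by (auto intro!: derivative_eq_intros simp: field_simps)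

lemma w_continuous [continuous_intros]:
  "continuous_on A (w1 b)" "continuous_on A (w2 b)" "continuous_on A (dw1 b)" "continuous_on A (dw2 b)"
  unfolding w1_def w2_def dw1_def dw2_def
  by (cases "b = 0"; auto intro!: continuous_intros)+

lemma wronskian_dw:
  assumes "b > 0"
  shows "w1 b x * dw2 b x - dw1 b x * w2 b x = wronskian b"
  using wronskian_eq[OF assms, of x] DERIV_imp_deriv[OF w_derivs(1)[OF assms]] DERIV_imp_deriv[OF w_derivs(2)[OF assms]]
  by simp

lemma wronskian_neg:
  assumes "b > 0"
  shows "wronskian b < 0"
proof -
  have "wronskian b = - (sinh (2 / sqrt b) / sqrt b)"
    using wronskian_dw[OF assms, of 1] by (simp add: w1_def w2_def dw1_def dw2_def)
  moreover have "sinh (2 / sqrt b) / sqrt b > 0" using assms by simp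
  ultimately show ?thesis by simp
qed

text \<open>The size of the jump of the kernel of \<open>A_D\<close> across the diagonal. It is the
  coefficient with which the argument reappears when \<open>A_D f\<close> is differentiated.\<close>

lemma kap_wronskian:
  assumes "b > 0"
  shows "kap b * (w2 b x * dw1 b x - w1 b x * dw2 b x) = 1 / b"
proof -
  have "w2 b x * dw1 b x - w1 b x * dw2 b x = - wronskian b"
    using wronskian_dw[OF assms, of x] by (simp add: algebra_simps)
  then show ?thesis using wronskian_neg[OF assms] assms by (simp add: kap_def)
qed

text \<open>Off the diagonal the kernel is a product of a function of \<open>x\<close> and a
  function of \<open>xi\<close>. The point \<open>xi = x\<close>, where \<open>deriv\<close> is
  unspecified, is dropped as a null set.\<close>

lemma A_D_eq:
  assumes b: "b > 0" and f: "L1 f" and x: "x \<in> {-1..1}"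
  shows "A_D b f x = kap b * (w2 b x * integral {-1..x} (\<lambda>y. dw1 b y * f y)
    + w1 b x * integral {x..1} (\<lambda>y. dw2 b y * f y))"
proof -
  have d1: "deriv (\<lambda>z. Green b x z) y = kap b * (w2 b x * dw1 b y)" if "y < x" for y
  proof (rule DERIV_imp_deriv)
    show "((\<lambda>z. Green b x z) has_real_derivative kap b * (w2 b x * dw1 b y)) (at y)"
      by (rule has_field_derivative_transform_within_open[of "\<lambda>z. kap b * (w1 b z * w2 b x)" _ _ "{..<x}"])
        (use that b wronskian_neg[OF b] in \<open>auto intro!: derivative_eq_intros w_derivs[OF b] simp: Green_def kap_def\<close>)
  qed
  have d2: "deriv (\<lambda>z. Green b x z) y = kap b * (w1 b x * dw2 b y)" if "y > x" for y
  proof (rule DERIV_imp_deriv)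
    show "((\<lambda>z. Green b x z) has_real_derivative kap b * (w1 b x * dw2 b y)) (at y)"
      by (rule has_field_derivative_transform_within_open[of "\<lambda>z. kap b * (w1 b x * w2 b z)" _ _ "{x<..}"])
        (use that b wronskian_neg[OF b] in \<open>auto intro!: derivative_eq_intros w_derivs[OF b] simp: Green_def kap_def\<close>)
  qed
  have L: "L1 (\<lambda>y. dw1 b y * f y)" "L1 (\<lambda>y. dw2 b y * f y)"
    by (intro L1_mult_continuous f w_continuous)+
  let ?h = "\<lambda>y. deriv (\<lambda>z. Green b x z) y * f y"
  have sub: "{-1<..<x} \<subseteq> Omega" "{x<..<1} \<subseteq> Omega" using x by auto
  have i1: "set_integrable lborel {-1<..<x} (\<lambda>y. (kap b * w2 b x) * (dw1 b y * f y))"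
    and i2: "set_integrable lborel {x<..<1} (\<lambda>y. (kap b * w1 b x) * (dw2 b y * f y))"
    using set_integrable_subset[OF L(1) _ sub(1)] set_integrable_subset[OF L(2) _ sub(2)] by auto
  have e1: "set_integrable lborel {-1<..<x} ?h \<longleftrightarrow> set_integrable lborel {-1<..<x} (\<lambda>y. (kap b * w2 b x) * (dw1 b y * f y))"
    by (rule set_integrable_cong) (auto simp: d1)
  have e2: "set_integrable lborel {x<..<1} ?h \<longleftrightarrow> set_integrable lborel {x<..<1} (\<lambda>y. (kap b * w1 b x) * (dw2 b y * f y))"
    by (rule set_integrable_cong) (auto simp: d2)
  have "A_D b f x = (LBINT y:{-1<..<x} \<union> {x<..<1}. ?h y)"
    unfolding A_D_def by (rule set_integral_discrete_difference[where X="{x}"]) (use x in auto)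
  also have "\<dots> = (LBINT y:{-1<..<x}. ?h y) + (LBINT y:{x<..<1}. ?h y)"
    by (rule set_integral_Un) (use e1 e2 i1 i2 in auto)
  also have "(LBINT y:{-1<..<x}. ?h y) = (LBINT y:{-1<..<x}. (kap b * w2 b x) * (dw1 b y * f y))"
    by (rule set_lebesgue_integral_cong) (auto simp: d1)
  also have "\<dots> = kap b * w2 b x * integral {-1..x} (\<lambda>y. dw1 b y * f y)"
    by (simp add: set_integral_eq_primitive(1)[OF L(1) x])
  also have "(LBINT y:{x<..<1}. ?h y) = (LBINT y:{x<..<1}. (kap b * w1 b x) * (dw2 b y * f y))"
    by (rule set_lebesgue_integral_cong) (auto simp: d2)
  also have "\<dots> = kap b * w1 b x * integral {x..1} (\<lambda>y. dw2 b y * f y)"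
    by (simp add: set_integral_eq_primitive(3)[OF L(2) x])
  finally show ?thesis by (simp add: algebra_simps)
qed

section \<open>Coefficient triples and the Green operator acting on them\<close>

abbreviation "bc \<equiv> bcext (-1) 1"

text \<open>A triple \<open>(a\<^sub>1, a\<^sub>2, a\<^sub>0)\<close> of continuous functions encodes the merely square integrable function
  \<open>a\<^sub>1 g\<^sub>1 + a\<^sub>2 g\<^sub>2 + a\<^sub>0\<close>, where \<open>g\<^sub>1\<close> and \<open>g\<^sub>2\<close> will be \<open>\<eta>\<^sub>0''\<close> and \<open>u\<^sub>0'\<close>.\<close>

definition pr :: "(real \<Rightarrow> real) \<Rightarrow> (real \<Rightarrow> real) \<Rightarrow> triple \<Rightarrow> real \<Rightarrow> real" where
  "pr g1 g2 q x = fst q * g1 x + fst (snd q) * g2 x + snd (snd q)"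

lemma pr_simps:
  "pr g1 g2 (p + q) x = pr g1 g2 p x + pr g1 g2 q x"
  "pr g1 g2 (p - q) x = pr g1 g2 p x - pr g1 g2 q x"
  "pr g1 g2 (k *\<^sub>R q) x = k * pr g1 g2 q x"
  "pr g1 g2 (0, 0, k) x = k"
  "pr g1 g2 0 x = 0"
  by (auto simp: pr_def algebra_simps)

lemma triple_components_le: "\<bar>fst q\<bar> \<le> norm q" "\<bar>fst (snd q)\<bar> \<le> norm q" "\<bar>snd (snd q)\<bar> \<le> norm q"
  for q :: triple
proof -
  obtain a b c where q: "q = (a, b, c)" by (cases q)
  show "\<bar>fst q\<bar> \<le> norm q" "\<bar>fst (snd q)\<bar> \<le> norm q" "\<bar>snd (snd q)\<bar> \<le> norm q"
    using norm_fst_le[of a "(b, c)"] norm_snd_le[of "(b, c)" a] norm_fst_le[of b c] norm_snd_le[of c b]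
    by (auto simp: q)
qed

text \<open>The integral of \<open>\<bar>g1 x\<bar> + \<bar>g2 x\<bar> + 1\<close> over [-1,1], the
  2 being the length of the interval. It is the operator norm bound for taking primitives of encoded
  functions.\<close>

definition mass :: "(real \<Rightarrow> real) \<Rightarrow> (real \<Rightarrow> real) \<Rightarrow> real" where
  "mass g1 g2 = integral {-1..1} (\<lambda>x. \<bar>g1 x\<bar>) + integral {-1..1} (\<lambda>x. \<bar>g2 x\<bar>) + 2"

definition J :: "(real \<Rightarrow> real) \<Rightarrow> (real \<Rightarrow> real) \<Rightarrow> (real \<Rightarrow>\<^sub>C triple) \<Rightarrow> (real \<Rightarrow>\<^sub>C real)" where
  "J g1 g2 Q = bc (\<lambda>x. integral {-1..x} (\<lambda>y. pr g1 g2 (Q y) y))"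

text \<open>The formula of \<open>A_D_eq\<close> with the outer factors left open: \<open>w2\<close>
  and \<open>w1\<close> give \<open>A_D\<close> itself, their derivatives give the continuous part
  of its derivative. The integral from \<open>x\<close> to 1 appears as the primitive at 1 minus the
  primitive at \<open>x\<close>.\<close>

definition green_op :: "real \<Rightarrow> (real \<Rightarrow> real) \<Rightarrow> (real \<Rightarrow> real) \<Rightarrow> (real \<Rightarrow> real) \<Rightarrow> (real \<Rightarrow> real)
    \<Rightarrow> (real \<Rightarrow>\<^sub>C triple) \<Rightarrow> (real \<Rightarrow>\<^sub>C real)" where
  "green_op b g1 g2 a2 a1 Q = kap b *\<^sub>R (mulC (bc a2) (J g1 g2 (mulC (bc (dw1 b)) Q))
    + mulC (bc a1) (const_bcontfun (apply_bcontfun (J g1 g2 (mulC (bc (dw2 b)) Q)) 1) - J g1 g2 (mulC (bc (dw2 b)) Q)))"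

definition opA where "opA b g1 g2 = green_op b g1 g2 (w2 b) (w1 b)"
definition opB where "opB b g1 g2 = green_op b g1 g2 (dw2 b) (dw1 b)"

text \<open>The sum of the four norms bounds every kernel factor. One product comes from the
  integral left of \<open>x\<close> and two from the integral right of \<open>x\<close>, which is a
  difference of primitives; hence the 3.\<close>

definition op_const :: "real \<Rightarrow> real" where
  "op_const b = \<bar>kap b\<bar> * (3 * (norm (bc (w1 b)) + norm (bc (w2 b)) + norm (bc (dw1 b)) + norm (bc (dw2 b)))\<^sup>2)"

lemma op_const_nonneg: "0 \<le> op_const b"
  by (simp add: op_const_def)

locale pairing =
  fixes g1 g2 :: "real \<Rightarrow> real"
  assumes g1: "L1 g1" and g2: "L1 g2"
begin

lemma mass_ge: "2 \<le> mass g1 g2"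
  unfolding mass_def
  using Henstock_Kurzweil_Integration.integral_nonneg[OF L1_integrable_on[OF set_integrable_abs[OF g1], of "-1" 1]]
    Henstock_Kurzweil_Integration.integral_nonneg[OF L1_integrable_on[OF set_integrable_abs[OF g2], of "-1" 1]]
  by simp

lemma pr_L1: "L1 (\<lambda>x. pr g1 g2 (apply_bcontfun Q x) x)"
proof -
  have "L1 (\<lambda>x. fst (apply_bcontfun Q x) * g1 x)" "L1 (\<lambda>x. fst (snd (apply_bcontfun Q x)) * g2 x)" "L1 (\<lambda>x. snd (snd (apply_bcontfun Q x)))"
    by (intro L1_mult_continuous g1 g2 L1_continuous continuous_intros continuous_on_apply_bcontfun)+
  then show ?thesis unfolding pr_def by (intro set_integral_add(1))
qed

lemma J_continuous: "continuous_on {-1..1} (\<lambda>x. integral {-1..x} (\<lambda>y. pr g1 g2 (apply_bcontfun Q y) y))"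
  by (rule indefinite_integral_continuous_1) (rule L1_integrable_on[OF pr_L1], auto)

lemma J_apply: "x \<in> {-1..1} \<Longrightarrow> apply_bcontfun (J g1 g2 Q) x = integral {-1..x} (\<lambda>y. pr g1 g2 (apply_bcontfun Q y) y)"
  unfolding J_def by (rule bcext_apply_in[OF J_continuous])

lemma J_apply_clamp:
  "apply_bcontfun (J g1 g2 Q) x = integral {-1..clamp (-1) 1 x} (\<lambda>y. pr g1 g2 (apply_bcontfun Q y) y)"
  unfolding J_def by (rule bcext_apply[OF J_continuous])

lemma J_ac: "ac (apply_bcontfun (J g1 g2 Q)) (\<lambda>x. pr g1 g2 (apply_bcontfun Q x) x)"
  by (rule acI[OF pr_L1]) (simp add: J_apply)

lemma J_norm: "norm (J g1 g2 Q) \<le> mass g1 g2 * norm Q"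
  unfolding J_def
proof (rule norm_bcext_le[OF J_continuous])
  fix x :: real assume x: "x \<in> {-1..1}"
  have La: "L1 (\<lambda>x. \<bar>g1 x\<bar>)" "L1 (\<lambda>x. \<bar>g2 x\<bar>)"
    using g1 g2 by (auto intro: set_integrable_abs)
  have ii: "((\<lambda>y. (\<bar>g1 y\<bar> + \<bar>g2 y\<bar> + 1) * norm Q) has_integral mass g1 g2 * norm Q) {-1..1}"
    unfolding mass_def
    using has_integral_add[OF has_integral_add[OF integrable_integral[OF L1_integrable_on[OF La(1), of "-1" 1]]
        integrable_integral[OF L1_integrable_on[OF La(2), of "-1" 1]]] has_integral_const_real[of 1 "-1" 1]]
    by (intro has_integral_mult_left) auto
  have "norm (integral {-1..x} (\<lambda>y. pr g1 g2 (apply_bcontfun Q y) y)) \<le> integral {-1..x} (\<lambda>y. (\<bar>g1 y\<bar> + \<bar>g2 y\<bar> + 1) * norm Q)"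
  proof (rule integral_norm_bound_integral)
    show "(\<lambda>y. pr g1 g2 (apply_bcontfun Q y) y) integrable_on {-1..x}"
      using x by (intro L1_integrable_on[OF pr_L1]) auto
    show "(\<lambda>y. (\<bar>g1 y\<bar> + \<bar>g2 y\<bar> + 1) * norm Q) integrable_on {-1..x}"
      by (rule integrable_subinterval_real[of _ "-1" 1]) (use ii x in \<open>auto simp: integrable_on_def\<close>)
    fix y
    have n: "norm (apply_bcontfun Q y) \<le> norm Q" by (rule norm_bounded)
    have "\<bar>pr g1 g2 (apply_bcontfun Q y) y\<bar> \<le> \<bar>fst (apply_bcontfun Q y)\<bar> * \<bar>g1 y\<bar> + \<bar>fst (snd (apply_bcontfun Q y))\<bar> * \<bar>g2 y\<bar> + \<bar>snd (snd (apply_bcontfun Q y))\<bar>"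
      unfolding pr_def by (simp add: abs_mult[symmetric])
    also have "\<dots> \<le> norm Q * \<bar>g1 y\<bar> + norm Q * \<bar>g2 y\<bar> + norm Q"
      by (intro add_mono mult_right_mono order_trans[OF triple_components_le(1) n]
        order_trans[OF triple_components_le(2) n] order_trans[OF triple_components_le(3) n]) auto
    finally show "norm (pr g1 g2 (apply_bcontfun Q y) y) \<le> (\<bar>g1 y\<bar> + \<bar>g2 y\<bar> + 1) * norm Q"
      by (simp add: algebra_simps)
  qed
  also have "\<dots> \<le> integral {-1..1} (\<lambda>y. (\<bar>g1 y\<bar> + \<bar>g2 y\<bar> + 1) * norm Q)"
    by (rule integral_subset_le) (use ii x in \<open>auto simp: integrable_on_def intro: integrable_subinterval_real[of _ "-1" 1, unfolded integrable_on_def]\<close>)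
  also have "\<dots> = mass g1 g2 * norm Q" using ii by (rule integral_unique)
  finally show "norm (integral {-1..x} (\<lambda>y. pr g1 g2 (apply_bcontfun Q y) y)) \<le> mass g1 g2 * norm Q" .
qed auto

lemma J_bounded_linear: "bounded_linear (J g1 g2)"
proof (rule bounded_linear_intro)
  have i: "(\<lambda>y. pr g1 g2 (apply_bcontfun Q y) y) integrable_on {-1..x}" if "x \<in> {-1..1}" for Q x
    using that by (intro L1_integrable_on[OF pr_L1]) auto
  have c: "clamp (- 1) 1 x \<in> {-1..1}" for x :: real by (rule clamp_real) simp
  show "J g1 g2 (P + Q) = J g1 g2 P + J g1 g2 Q" for P Q
    by (rule bcontfun_eqI) (simp add: J_apply_clamp pr_simps Henstock_Kurzweil_Integration.integral_add i[OF c])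
  show "J g1 g2 (k *\<^sub>R Q) = k *\<^sub>R J g1 g2 Q" for k Q
    by (rule bcontfun_eqI) (simp add: J_apply_clamp pr_simps)
  show "norm (J g1 g2 Q) \<le> norm Q * mass g1 g2" for Q
    using J_norm[of Q] by (simp add: mult.commute)
qed

lemmas J_simps = linear_add[OF bounded_linear.linear[OF J_bounded_linear]]
  linear_diff[OF bounded_linear.linear[OF J_bounded_linear]]
  linear_scale[OF bounded_linear.linear[OF J_bounded_linear]]

lemma green_op_norm:
  assumes "norm (bc a2) \<le> N" "norm (bc a1) \<le> N" "norm (bc (dw1 b)) \<le> N" "norm (bc (dw2 b)) \<le> N"
  shows "norm (green_op b g1 g2 a2 a1 Q) \<le> \<bar>kap b\<bar> * (3 * N\<^sup>2) * (mass g1 g2 * norm Q)"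
proof -
  have N: "0 \<le> N" using norm_ge_zero assms(1) order_trans by blast
  have m: "0 \<le> mass g1 g2 * norm Q" using mass_ge by simp
  have Jn: "norm (J g1 g2 (mulC d Q)) \<le> N * (mass g1 g2 * norm Q)" if "norm d \<le> N" for d
  proof -
    have "norm (J g1 g2 (mulC d Q)) \<le> mass g1 g2 * norm (mulC d Q)" by (rule J_norm)
    also have "\<dots> \<le> mass g1 g2 * (N * norm Q)"
      using mass_ge that by (intro mult_left_mono order_trans[OF norm_mulC] mult_right_mono) auto
    finally show ?thesis by (simp add: algebra_simps)
  qed
  let ?J1 = "J g1 g2 (mulC (bc (dw1 b)) Q)" and ?J2 = "J g1 g2 (mulC (bc (dw2 b)) Q)"
  have 1: "norm (mulC (bc a2) ?J1) \<le> N * (N * (mass g1 g2 * norm Q))"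
    using assms N by (intro order_trans[OF norm_mulC] mult_mono Jn) auto
  have "norm (const_bcontfun (apply_bcontfun ?J2 1) - ?J2 :: real \<Rightarrow>\<^sub>C real) \<le> norm (const_bcontfun (apply_bcontfun ?J2 1) :: real \<Rightarrow>\<^sub>C real) + norm ?J2"
    by (rule norm_triangle_ineq4)
  also have "\<dots> \<le> norm ?J2 + norm ?J2"
    by (intro add_right_mono norm_bound) (simp add: norm_bounded[of ?J2, simplified])
  also have "\<dots> \<le> 2 * (N * (mass g1 g2 * norm Q))"
    using Jn[OF assms(4)] by simp
  finally have 2: "norm (mulC (bc a1) (const_bcontfun (apply_bcontfun ?J2 1) - ?J2)) \<le> N * (2 * (N * (mass g1 g2 * norm Q)))"
    using assms N by (intro order_trans[OF norm_mulC] mult_mono) auto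
  have "norm (green_op b g1 g2 a2 a1 Q) \<le> \<bar>kap b\<bar> * (N * (N * (mass g1 g2 * norm Q)) + N * (2 * (N * (mass g1 g2 * norm Q))))"
    unfolding green_op_def norm_scaleR
    by (intro mult_left_mono order_trans[OF norm_triangle_ineq] add_mono 1 2) auto
  then show ?thesis by (simp add: algebra_simps power2_eq_square)
qed

lemma op_norm:
  "norm (opA b g1 g2 Q) \<le> op_const b * mass g1 g2 * norm Q"
  "norm (opB b g1 g2 Q) \<le> op_const b * mass g1 g2 * norm Q"
  unfolding opA_def opB_def op_const_def mult.assoc
  by (rule order_trans[OF green_op_norm[where N="norm (bc (w1 b)) + norm (bc (w2 b)) + norm (bc (dw1 b)) + norm (bc (dw2 b))"]];
      simp add: algebra_simps)+

lemma green_op_bounded_linear: "bounded_linear (green_op b g1 g2 a2 a1)"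
proof (rule bounded_linear_intro)
  define N where "N = norm (bc a2) + norm (bc a1) + norm (bc (dw1 b)) + norm (bc (dw2 b))"
  show "norm (green_op b g1 g2 a2 a1 Q) \<le> norm Q * (\<bar>kap b\<bar> * (3 * N\<^sup>2) * mass g1 g2)" for Q
    using green_op_norm[of a2 N a1 b Q] by (simp add: N_def algebra_simps)
qed (auto intro!: bcontfun_eqI simp: green_op_def mulC_simps J_simps algebra_simps)

lemma op_bounded_linear: "bounded_linear (opA b g1 g2)" "bounded_linear (opB b g1 g2)"
  unfolding opA_def opB_def by (rule green_op_bounded_linear)+

text \<open>For \<open>v = A_D f\<close> the equation \<open>v - b v'' = -f'\<close> is equivalent
  to the first order pair \<open>v' = p + f / b\<close>, \<open>p' = v / b\<close>, in which
  \<open>f\<close> is never differentiated; \<open>opB\<close> is this \<open>p\<close>. In the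
  derivative of \<open>opA\<close> the terms from the moving limits combine to \<open>f / b\<close>
  by the Wronskian identity, in that of \<open>opB\<close> they cancel.\<close>

lemma op_ac:
  assumes b: "b > 0"
  shows "ac (apply_bcontfun (opA b g1 g2 Q)) (\<lambda>x. apply_bcontfun (opB b g1 g2 Q) x + 1 / b * pr g1 g2 (apply_bcontfun Q x) x)" (is ?A)
    and "ac (apply_bcontfun (opB b g1 g2 Q)) (\<lambda>x. 1 / b * apply_bcontfun (opA b g1 g2 Q) x)" (is ?B)
proof -
  have bw: "apply_bcontfun (bc (w1 b)) x = w1 b x" "apply_bcontfun (bc (w2 b)) x = w2 b x"
    "apply_bcontfun (bc (dw1 b)) x = dw1 b x" "apply_bcontfun (bc (dw2 b)) x = dw2 b x" if "x \<in> {-1..1}" for x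
    by (rule bcext_apply_in[OF w_continuous(1) that] bcext_apply_in[OF w_continuous(2) that]
      bcext_apply_in[OF w_continuous(3) that] bcext_apply_in[OF w_continuous(4) that])+
  define q where "q x = pr g1 g2 (apply_bcontfun Q x) x" for x
  define J1 where "J1 = apply_bcontfun (J g1 g2 (mulC (bc (dw1 b)) Q))"
  define J2 where "J2 = apply_bcontfun (J g1 g2 (mulC (bc (dw2 b)) Q))"
  have e: "pr g1 g2 (apply_bcontfun (mulC d Q) x) x = apply_bcontfun d x * q x" for d x
    by (simp add: pr_simps q_def)
  have J1: "ac J1 (\<lambda>x. dw1 b x * q x)"
    using J_ac[of "mulC (bc (dw1 b)) Q"] unfolding e J1_def by (rule ac_cong) (auto simp: bw)
  have J2: "ac J2 (\<lambda>x. dw2 b x * q x)"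
    using J_ac[of "mulC (bc (dw2 b)) Q"] unfolding e J2_def by (rule ac_cong) (auto simp: bw)
  have acw: "ac (w1 b) (dw1 b)" "ac (w2 b) (dw2 b)" "ac (dw1 b) (\<lambda>x. w1 b x / b)" "ac (dw2 b) (\<lambda>x. w2 b x / b)"
    using b by (auto intro!: ac_C1 w_derivs continuous_intros)
  have J2': "ac (\<lambda>x. J2 1 - J2 x) (\<lambda>x. 0 - dw2 b x * q x)"
    by (rule ac_diff[OF ac_const J2])
  have opA: "apply_bcontfun (opA b g1 g2 Q) x = kap b * (w2 b x * J1 x + w1 b x * (J2 1 - J2 x))" if "x \<in> {-1..1}" for x
    using bw[OF that] by (simp add: opA_def green_op_def J1_def J2_def)
  have opB: "apply_bcontfun (opB b g1 g2 Q) x = kap b * (dw2 b x * J1 x + dw1 b x * (J2 1 - J2 x))" if "x \<in> {-1..1}" for x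
    using bw[OF that] by (simp add: opB_def green_op_def J1_def J2_def)
  show ?A
  proof (rule ac_cong[OF ac_cmult[OF ac_add[OF ac_mult[OF acw(2) J1] ac_mult[OF acw(1) J2']], of "kap b"]])
    fix x :: real assume "x \<in> Omega"
    then have x: "x \<in> {-1..1}" by auto
    have "kap b * (w2 b x * (dw1 b x * q x) + J1 x * dw2 b x + (w1 b x * (0 - dw2 b x * q x) + (J2 1 - J2 x) * dw1 b x))
       = apply_bcontfun (opB b g1 g2 Q) x + (kap b * (w2 b x * dw1 b x - w1 b x * dw2 b x)) * q x"
      unfolding opB[OF x] by (simp add: algebra_simps)
    also have "\<dots> = apply_bcontfun (opB b g1 g2 Q) x + 1 / b * q x"
      unfolding kap_wronskian[OF b] ..
    finally show "kap b * (w2 b x * (dw1 b x * q x) + J1 x * dw2 b x + (w1 b x * (0 - dw2 b x * q x) + (J2 1 - J2 x) * dw1 b x))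
       = apply_bcontfun (opB b g1 g2 Q) x + 1 / b * pr g1 g2 (apply_bcontfun Q x) x"
      by (simp add: q_def)
  qed (simp add: opA)
  show ?B
  proof (rule ac_cong[OF ac_cmult[OF ac_add[OF ac_mult[OF acw(4) J1] ac_mult[OF acw(3) J2']], of "kap b"]])
    fix x :: real assume "x \<in> Omega"
    then have x: "x \<in> {-1..1}" by auto
    show "kap b * (dw2 b x * (dw1 b x * q x) + J1 x * (w2 b x / b) + (dw1 b x * (0 - dw2 b x * q x) + (J2 1 - J2 x) * (w1 b x / b)))
       = 1 / b * apply_bcontfun (opA b g1 g2 Q) x"
      unfolding opA[OF x] by (simp add: algebra_simps add_divide_distrib diff_divide_distrib)
  qed (simp add: opB)
qed

lemma opA_eq_A_D:
  assumes b: "b > 0" and x: "x \<in> {-1..1}"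
  shows "apply_bcontfun (opA b g1 g2 Q) x = A_D b (\<lambda>y. pr g1 g2 (apply_bcontfun Q y) y) x"
proof -
  have bw: "apply_bcontfun (bc (w1 b)) x = w1 b x" "apply_bcontfun (bc (w2 b)) x = w2 b x"
    "apply_bcontfun (bc (dw1 b)) x = dw1 b x" "apply_bcontfun (bc (dw2 b)) x = dw2 b x" if "x \<in> {-1..1}" for x
    by (rule bcext_apply_in[OF w_continuous(1) that] bcext_apply_in[OF w_continuous(2) that]
      bcext_apply_in[OF w_continuous(3) that] bcext_apply_in[OF w_continuous(4) that])+
  define q where "q x = pr g1 g2 (apply_bcontfun Q x) x" for x
  have L: "L1 (\<lambda>y. dw2 b y * q y)"
    unfolding q_def by (intro L1_mult_continuous pr_L1 w_continuous)
  have J1: "apply_bcontfun (J g1 g2 (mulC (bc (dw1 b)) Q)) y = integral {-1..y} (\<lambda>y. dw1 b y * q y)"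
    and J2: "apply_bcontfun (J g1 g2 (mulC (bc (dw2 b)) Q)) y = integral {-1..y} (\<lambda>y. dw2 b y * q y)"
    if "y \<in> {-1..1}" for y
    unfolding J_apply[OF that]
    by (rule Henstock_Kurzweil_Integration.integral_cong; use that bw in \<open>auto simp: pr_simps q_def\<close>)+
  have "integral {-1..1} (\<lambda>y. dw2 b y * q y) - integral {-1..x} (\<lambda>y. dw2 b y * q y) = integral {x..1} (\<lambda>y. dw2 b y * q y)"
    using Henstock_Kurzweil_Integration.integral_combine[of "-1" x 1 "\<lambda>y. dw2 b y * q y"] x L1_integrable_on[OF L, of "-1" 1] by auto
  then show ?thesis
    using A_D_eq[OF b pr_L1[of Q] x] bw[OF x] x
    by (simp add: opA_def green_op_def J1 J2 q_def[symmetric])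
qed

end

section \<open>Derivative relations between unknowns\<close>

context pairing begin

definition acC :: "(real \<Rightarrow>\<^sub>C real) \<Rightarrow> (real \<Rightarrow>\<^sub>C triple) \<Rightarrow> bool" where
  "acC e Q \<longleftrightarrow> ac (apply_bcontfun e) (\<lambda>x. pr g1 g2 (apply_bcontfun Q x) x)"

lemma acC_third: "acC e (third r) \<longleftrightarrow> ac (apply_bcontfun e) (apply_bcontfun r)"
  by (simp add: acC_def pr_simps)

text \<open>In this form the relation is the vanishing, for each \<open>x\<close>, of an expression
  linear and bounded in the pair \<open>(e, Q)\<close>. Such expressions commute with Banach space
  valued time integrals, which is all that \<open>acC_integral\<close> needs.\<close>

lemma acC_iff: "acC e Q \<longleftrightarrow> (\<forall>x\<in>{-1..1}. apply_bcontfun (e - J g1 g2 Q) x - apply_bcontfun e (-1) = 0)"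
proof
  assume a: "acC e Q"
  show "\<forall>x\<in>{-1..1}. apply_bcontfun (e - J g1 g2 Q) x - apply_bcontfun e (-1) = 0"
  proof
    fix x :: real assume x: "x \<in> {-1..1}"
    show "apply_bcontfun (e - J g1 g2 Q) x - apply_bcontfun e (-1) = 0"
      using acD(2)[OF a[unfolded acC_def] x] J_apply[OF x, of Q] by simp
  qed
next
  assume *: "\<forall>x\<in>{-1..1}. apply_bcontfun (e - J g1 g2 Q) x - apply_bcontfun e (-1) = 0"
  show "acC e Q"
    unfolding acC_def
  proof (rule acI[OF pr_L1])
    fix x :: real assume x: "x \<in> {-1..1}"
    from bspec[OF * x] show "e x = e (-1) + integral {-1..x} (\<lambda>x. pr g1 g2 (apply_bcontfun Q x) x)"
      by (simp add: J_apply[OF x])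
  qed
qed

lemma acC_add: "acC e Q \<Longrightarrow> acC e' Q' \<Longrightarrow> acC (e + e') (Q + Q')"
  using ac_add by (simp add: acC_def pr_simps)

lemma acC_scale: "acC e Q \<Longrightarrow> acC (k *\<^sub>R e) (k *\<^sub>R Q)"
  using ac_cmult by (simp add: acC_def pr_simps)

lemma acC_diff: "acC e Q \<Longrightarrow> acC e' Q' \<Longrightarrow> acC (e - e') (Q - Q')"
  using acC_add[OF _ acC_scale[of e' Q' "-1"]] by simp

lemma acC_integral:
  fixes t :: real
  assumes "continuous_on {0..t} e" "continuous_on {0..t} Q" "\<And>s. s \<in> {0..t} \<Longrightarrow> acC (e s) (Q s)"
  shows "acC (integral {0..t} e) (integral {0..t} Q)"
  unfolding acC_iff
proof
  fix x :: real assume x: "x \<in> {-1..1}"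
  have ie: "e integrable_on {0..t}" "Q integrable_on {0..t}"
    using assms integrable_continuous_real by auto
  have iq: "(\<lambda>s. J g1 g2 (Q s)) integrable_on {0..t}" "J g1 g2 (integral {0..t} Q) = integral {0..t} (\<lambda>s. J g1 g2 (Q s))"
    using integrable_linear[OF ie(2) J_bounded_linear] integral_linear[OF ie(2) J_bounded_linear]
    by (auto simp: o_def)
  have blx: "bounded_linear (\<lambda>f :: real \<Rightarrow>\<^sub>C real. apply_bcontfun f y)" for y
    by (rule bounded_linear_apply_bcontfun)
  have "apply_bcontfun (integral {0..t} e - J g1 g2 (integral {0..t} Q)) x - apply_bcontfun (integral {0..t} e) (-1)
    = apply_bcontfun (integral {0..t} (\<lambda>s. e s - J g1 g2 (Q s))) x - apply_bcontfun (integral {0..t} e) (-1)"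
    by (subst Henstock_Kurzweil_Integration.integral_diff[OF ie(1) iq(1)]) (simp add: iq)
  also have "\<dots> = integral {0..t} (\<lambda>s. apply_bcontfun (e s - J g1 g2 (Q s)) x - apply_bcontfun (e s) (-1))"
    using integral_linear[OF integrable_diff[OF ie(1) iq(1)] blx, of x] integral_linear[OF ie(1) blx, of "-1"]
      integrable_linear[OF integrable_diff[OF ie(1) iq(1)] blx, of x] integrable_linear[OF ie(1) blx, of "-1"]
    by (simp add: o_def Henstock_Kurzweil_Integration.integral_diff del: minus_bcontfun.rep_eq)
  also have "\<dots> = integral {0..t} (\<lambda>s. 0)"
    using assms(3) x unfolding acC_iff by (intro Henstock_Kurzweil_Integration.integral_cong) auto
  finally show "apply_bcontfun (integral {0..t} e - J g1 g2 (integral {0..t} Q)) x - apply_bcontfun (integral {0..t} e) (-1) = 0"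
    by simp
qed

lemma acC_opA: "b > 0 \<Longrightarrow> acC (opA b g1 g2 Q) (third (opB b g1 g2 Q) + (1 / b) *\<^sub>R Q)"
  using op_ac(1) by (simp add: acC_def pr_simps)

lemma acC_opB: "b > 0 \<Longrightarrow> acC (opB b g1 g2 Q) (third ((1 / b) *\<^sub>R opA b g1 g2 Q))"
  using op_ac(2) by (simp add: acC_def pr_simps)

lemma acC_mulC:
  assumes "acC e (third r)" "acC u P"
  shows "acC (mulC e u) (mulC e P + third (mulC r u))"
proof -
  have "ac (\<lambda>x. apply_bcontfun e x * apply_bcontfun u x) (\<lambda>x. apply_bcontfun e x * pr g1 g2 (apply_bcontfun P x) x + apply_bcontfun u x * apply_bcontfun r x)"
    using assms ac_mult by (simp add: acC_def pr_simps)
  then show ?thesis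
    unfolding acC_def by (rule ac_cong) (simp_all add: pr_simps mult.commute)
qed

end

lemma integral_third:
  fixes f :: "real \<Rightarrow> (real \<Rightarrow>\<^sub>C real)"
  assumes "continuous_on {0..t} f"
  shows "integral {0..t} (\<lambda>s. third (f s)) = third (integral {0..t} f)"
  using integral_linear[OF integrable_continuous_real[OF assms] bounded_linear_third] by (simp add: o_def)

lemma continuous_on_third [continuous_intros]: "continuous_on A f \<Longrightarrow> continuous_on A (\<lambda>s. third (f s))"
  by (rule bounded_linear.continuous_on[OF bounded_linear_third])

lemma continuous_on_mulC [continuous_intros]:
  "continuous_on A f \<Longrightarrow> continuous_on A g \<Longrightarrow> continuous_on A (\<lambda>s. mulC (f s) (g s))"
  by (rule bounded_bilinear.continuous_on[OF bounded_bilinear_mulC])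

lemma has_vector_derivative_quotient:
  assumes "(f has_vector_derivative f') (at t within A)"
  shows "((\<lambda>s. norm ((1 / (s - t)) *\<^sub>R (f s - f t) - f')) \<longlongrightarrow> 0) (at t within A)"
proof -
  have "((\<lambda>s. norm (f s - f t - (s - t) *\<^sub>R f') / norm (s - t)) \<longlongrightarrow> 0) (at t within A)"
    using assms unfolding has_vector_derivative_def has_derivative_iff_norm by auto
  then show ?thesis
  proof (rule Lim_transform_eventually)
    show "\<forall>\<^sub>F s in at t within A. norm (f s - f t - (s - t) *\<^sub>R f') / norm (s - t) = norm ((1 / (s - t)) *\<^sub>R (f s - f t) - f')"
      unfolding eventually_at_filter
    proof (rule always_eventually, intro allI impI)
      fix s assume s: "s \<noteq> t"
      have "(1 / (s - t)) *\<^sub>R (f s - f t) - f' = (1 / (s - t)) *\<^sub>R (f s - f t - (s - t) *\<^sub>R f')"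
        using s by (simp add: scaleR_diff_right)
      then show "norm (f s - f t - (s - t) *\<^sub>R f') / norm (s - t) = norm ((1 / (s - t)) *\<^sub>R (f s - f t) - f')"
        by (simp add: divide_inverse mult.commute)
    qed
  qed
qed

section \<open>Weighted norms of encoded functions\<close>

locale sobolev_pairing = weight_exponent +
  fixes g1 g2 :: "real \<Rightarrow> real"
  assumes g1_L2w: "g1 \<in> L2w mu" and g2_L2w: "g2 \<in> L2w mu"

sublocale sobolev_pairing \<subseteq> pairing g1 g2
  by unfold_locales (use L2w_imp_L1[OF mu(2)] g1_L2w g2_L2w in auto)

context sobolev_pairing begin

text \<open>Lipschitz constant of the map from triples, in sup norm, to the weighted L2 space; the
  factor 3 is that of \<open>L2w_norm_combination\<close>.\<close>

definition gK :: real where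
  "gK = sqrt (3 * ((L2w_norm mu g1)\<^sup>2 + (L2w_norm mu g2)\<^sup>2 + weight_mass mu))"

lemma gK_nonneg: "0 \<le> gK"
  unfolding gK_def by (intro real_sqrt_ge_zero) (simp add: weight_mass_nonneg)

lemma gK_sq: "gK\<^sup>2 = 3 * ((L2w_norm mu g1)\<^sup>2 + (L2w_norm mu g2)\<^sup>2 + weight_mass mu)"
  unfolding gK_def by (intro real_sqrt_pow2) (simp add: weight_mass_nonneg)

lemma pr_L2w:
  "(\<lambda>x. pr g1 g2 (apply_bcontfun Q x) x) \<in> L2w mu"
  "(L2w_norm mu (\<lambda>x. pr g1 g2 (apply_bcontfun Q x) x))\<^sup>2 \<le> (gK * norm Q)\<^sup>2"
proof -
  have c: "continuous_on {-1..1} (\<lambda>x. fst (apply_bcontfun Q x))" "continuous_on {-1..1} (\<lambda>x. fst (snd (apply_bcontfun Q x)))"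
    "continuous_on {-1..1} (\<lambda>x. snd (snd (apply_bcontfun Q x)))"
    by (intro continuous_intros continuous_on_apply_bcontfun)+
  have n: "norm (apply_bcontfun Q y) \<le> norm Q" for y by (rule norm_bounded)
  have b: "\<bar>fst (apply_bcontfun Q x)\<bar> \<le> norm Q \<and> \<bar>fst (snd (apply_bcontfun Q x))\<bar> \<le> norm Q \<and> \<bar>snd (snd (apply_bcontfun Q x))\<bar> \<le> norm Q" for x
    using triple_components_le[of "apply_bcontfun Q x"] n[of x] by linarith
  show "(\<lambda>x. pr g1 g2 (apply_bcontfun Q x) x) \<in> L2w mu"
    unfolding pr_def by (rule L2w_combination[OF mu(1) g1_L2w g2_L2w c b])
  have "(L2w_norm mu (\<lambda>x. pr g1 g2 (apply_bcontfun Q x) x))\<^sup>2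
     \<le> 3 * (norm Q)\<^sup>2 * ((L2w_norm mu g1)\<^sup>2 + (L2w_norm mu g2)\<^sup>2 + weight_mass mu)"
    unfolding pr_def by (rule L2w_norm_combination[OF mu(1) g1_L2w g2_L2w c b])
  then show "(L2w_norm mu (\<lambda>x. pr g1 g2 (apply_bcontfun Q x) x))\<^sup>2 \<le> (gK * norm Q)\<^sup>2"
    unfolding power_mult_distrib gK_sq by (simp add: algebra_simps)
qed

lemma L2w_norm_bcontfun: "(L2w_norm mu (apply_bcontfun e))\<^sup>2 \<le> (gK * norm e)\<^sup>2"
proof -
  have "(L2w_norm mu (\<lambda>x. pr g1 g2 (apply_bcontfun (third e) x) x))\<^sup>2 \<le> (gK * norm (third e))\<^sup>2"
    by (rule pr_L2w)
  also have "\<dots> \<le> (gK * norm e)\<^sup>2"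
    by (intro power_mono mult_left_mono norm_third gK_nonneg mult_nonneg_nonneg norm_ge_zero)
  finally show ?thesis by (simp add: pr_simps)
qed

lemma acC_Hw1:
  assumes "acC e Q"
  shows "apply_bcontfun e \<in> Hw mu 1" "Hw_norm mu 1 (apply_bcontfun e) \<le> gK * (norm e + norm Q)"
proof -
  note H = Hw1_intro[OF assms[unfolded acC_def] pr_L2w(1)]
  show "apply_bcontfun e \<in> Hw mu 1" by (rule H)
  have "Hw_norm mu 1 (apply_bcontfun e) \<le> sqrt ((gK * norm e)\<^sup>2 + (gK * norm Q)\<^sup>2)"
    unfolding H(2) by (intro real_sqrt_le_mono add_mono L2w_norm_bcontfun pr_L2w)
  also have "\<dots> \<le> gK * norm e + gK * norm Q"
    by (intro sqrt_sum_squares_le_sum mult_nonneg_nonneg gK_nonneg norm_ge_zero)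
  finally show "Hw_norm mu 1 (apply_bcontfun e) \<le> gK * (norm e + norm Q)" by (simp add: algebra_simps)
qed

lemma acC_Hw2:
  assumes "acC e (third r)" "acC r Q"
  shows "apply_bcontfun e \<in> Hw mu 2" "Hw_norm mu 2 (apply_bcontfun e) \<le> gK * (norm e + norm r + norm Q)"
proof -
  note H = Hw2_intro[OF assms(1)[unfolded acC_third] assms(2)[unfolded acC_def] pr_L2w(1)]
  show "apply_bcontfun e \<in> Hw mu 2" by (rule H)
  have "Hw_norm mu 2 (apply_bcontfun e) \<le> sqrt ((gK * norm e)\<^sup>2 + (gK * norm r)\<^sup>2 + (gK * norm Q)\<^sup>2)"
    unfolding H(2) by (intro real_sqrt_le_mono add_mono L2w_norm_bcontfun pr_L2w)
  also have "\<dots> \<le> gK * norm e + gK * norm r + gK * norm Q"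
  proof (rule real_le_lsqrt)
    have "0 \<le> gK * norm e" "0 \<le> gK * norm r" "0 \<le> gK * norm Q"
      by (intro mult_nonneg_nonneg gK_nonneg norm_ge_zero)+
    then show "(gK * norm e)\<^sup>2 + (gK * norm r)\<^sup>2 + (gK * norm Q)\<^sup>2 \<le> (gK * norm e + gK * norm r + gK * norm Q)\<^sup>2"
      "0 \<le> gK * norm e + gK * norm r + gK * norm Q"
      by (auto simp: power2_sum)
  qed
  finally show "Hw_norm mu 2 (apply_bcontfun e) \<le> gK * (norm e + norm r + norm Q)" by (simp add: algebra_simps)
qed

end

section \<open>The Bona-Smith vector field\<close>

lemma norm_mulC_diff:
  assumes "norm b \<le> R" "norm a' \<le> R" "norm (a - a') \<le> d" "norm (b - b') \<le> d" "0 \<le> R"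
  shows "norm (mulC a b - mulC a' b') \<le> 2 * R * d"
proof -
  have "mulC a b - mulC a' b' = mulC (a - a') b + mulC a' (b - b')"
    by (simp add: mulC_simps)
  also have "norm \<dots> \<le> norm (a - a') * norm b + norm a' * norm (b - b')"
    by (intro order_trans[OF norm_triangle_ineq] add_mono norm_mulC)
  also have "\<dots> \<le> d * R + R * d"
    using assms order_trans[OF norm_ge_zero assms(3)] by (intro add_mono mult_mono) auto
  finally show ?thesis by simp
qed

text \<open>Five summands, the Lipschitz constants on the ball of radius \<open>R\<close> of
  \<open>Fe\<close>, \<open>Fr\<close>, \<open>Fu\<close>, \<open>FQ\<close>, \<open>FP\<close> in
  this order. The operator norm is kept as a parameter because it depends on the initial data and
  has to be replaced by a uniform bound later.\<close>

definition lipc :: "real \<Rightarrow> real \<Rightarrow> real \<Rightarrow> real \<Rightarrow> real" where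
  "lipc b c op_bound R = op_bound * (1 + 2 * R) + (op_bound + 1 / b) * (1 + 2 * R) + op_bound * (\<bar>c\<bar> + 1 + R)
    + 1 / b * (1 + 4 * R + op_bound * (1 + 2 * R)) + (\<bar>c\<bar> / b + op_bound * (\<bar>c\<bar> + 1 + R) + 1 / b * (1 + R))"

lemma lipc_mono:
  assumes "0 < b" "0 \<le> op_bound" "op_bound \<le> op_bound'" "0 \<le> R"
  shows "lipc b c op_bound R \<le> lipc b c op_bound' R" "0 \<le> lipc b c op_bound R"
proof -
  have p: "0 \<le> 1 + 2 * R" "0 \<le> \<bar>c\<bar> + 1 + R" using assms by auto
  note m = mult_right_mono[OF assms(3) p(1)] mult_right_mono[OF assms(3) p(2)]
  have k: "0 \<le> 1 / b" using assms by simp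
  show "lipc b c op_bound R \<le> lipc b c op_bound' R"
    unfolding lipc_def
    by (rule add_mono[OF add_mono[OF add_mono[OF add_mono[OF m(1) mult_right_mono[OF add_right_mono[OF assms(3)] p(1)]] m(2)]
      mult_left_mono[OF add_left_mono[OF m(1)] k]] add_right_mono[OF add_left_mono[OF m(2)]]])
  have "0 \<le> op_bound * (1 + 2 * R)" "0 \<le> (op_bound + 1 / b) * (1 + 2 * R)" "0 \<le> op_bound * (\<bar>c\<bar> + 1 + R)"
    "0 \<le> 1 / b * (1 + R)" "0 \<le> \<bar>c\<bar> / b"
    using assms p by (auto intro!: mult_nonneg_nonneg)
  moreover have "0 \<le> 1 / b * (1 + 4 * R + op_bound * (1 + 2 * R))"
    using assms p by (intro mult_nonneg_nonneg add_nonneg_nonneg) auto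
  ultimately show "0 \<le> lipc b c op_bound R"
    unfolding lipc_def by linarith
qed

locale bs_system = sobolev_pairing +
  fixes b c :: real
  assumes b: "b > 0"
begin

abbreviation "oA \<equiv> opA b g1 g2"
abbreviation "oB \<equiv> opB b g1 g2"

definition op_bound :: real where "op_bound = op_const b * mass g1 g2"

text \<open>\<open>flux\<close> and \<open>force\<close> are the arguments of \<open>A_D\<close> in
  the two equations. \<open>flux\<close> is continuous, while \<open>force\<close> contains the
  second derivative of \<eta> and must be a triple; \<open>pot\<close> is its continuous
  part.\<close>

definition flux :: "(real \<Rightarrow>\<^sub>C real) \<Rightarrow> (real \<Rightarrow>\<^sub>C real) \<Rightarrow> (real \<Rightarrow>\<^sub>C real)" where
  "flux e u = u + mulC e u"
definition pot :: "(real \<Rightarrow>\<^sub>C real) \<Rightarrow> (real \<Rightarrow>\<^sub>C real) \<Rightarrow> (real \<Rightarrow>\<^sub>C real)" where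
  "pot e u = e + (1/2) *\<^sub>R mulC u u"
definition force :: "(real \<Rightarrow>\<^sub>C real) \<Rightarrow> (real \<Rightarrow>\<^sub>C real) \<Rightarrow> (real \<Rightarrow>\<^sub>C triple) \<Rightarrow> (real \<Rightarrow>\<^sub>C triple)" where
  "force e u Q = c *\<^sub>R Q + third (pot e u)"

text \<open>\<open>Fe\<close>, \<open>Fr\<close>, \<open>Fu\<close> are the time derivatives of the interior parts of \<open>\<eta>\<close>, \<open>\<eta>\<^sub>x\<close>, \<open>u\<close>, and \<open>FQ\<close>, \<open>FP\<close> those of
  the triples encoding \<open>\<eta>\<^sub>x\<^sub>x\<close> and \<open>u\<^sub>x\<close>.\<close>

definition Fe where "Fe e u = oA (third (flux e u))"
definition Fr where "Fr e u = oB (third (flux e u)) + (1/b) *\<^sub>R flux e u"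
definition Fu where "Fu e u Q = oA (force e u Q)"
definition FQ where "FQ e r u P = (1/b) *\<^sub>R (P + mulC e P + third (Fe e u + mulC r u))"
definition FP where "FP e u Q = (c/b) *\<^sub>R Q + third (oB (force e u Q) + (1/b) *\<^sub>R pot e u)"

lemma op_bound_nonneg: "0 \<le> op_bound"
  unfolding op_bound_def using op_const_nonneg mass_ge by (intro mult_nonneg_nonneg) (auto intro: order_trans)

lemma op_diff_norm:
  "norm (oA Q - oA Q') \<le> op_bound * norm (Q - Q')" "norm (oB Q - oB Q') \<le> op_bound * norm (Q - Q')"
  using op_norm[of b "Q - Q'"] linear_diff[OF bounded_linear.linear[OF op_bounded_linear(1)], of b Q Q']
    linear_diff[OF bounded_linear.linear[OF op_bounded_linear(2)], of b Q Q'] by (auto simp: op_bound_def)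

lemma norm_third_diff: "norm (third f - third g) \<le> norm (f - g)"
  using norm_third[of "f - g"] by (simp add: third_simps)

lemma norm_add_diff: "norm (x - x') \<le> p \<Longrightarrow> norm (y - y') \<le> q \<Longrightarrow> norm ((x + y) - (x' + y')) \<le> p + q"
  for x :: "'z::real_normed_vector"
  by (rule order_trans[OF norm_diff_triangle_ineq add_mono])

lemma norm_scale_diff: "norm (a - a') \<le> p \<Longrightarrow> 0 \<le> k \<Longrightarrow> norm (k *\<^sub>R a - k *\<^sub>R a') \<le> k * p"
  for a :: "'z::real_normed_vector"
  by (simp add: scaleR_diff_right[symmetric] mult_left_mono)

context
  fixes R d :: real and e r u e' r' u' :: "real \<Rightarrow>\<^sub>C real" and Q P Q' P' :: "real \<Rightarrow>\<^sub>C triple"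
  assumes R: "0 \<le> R" and n: "norm e \<le> R" "norm r \<le> R" "norm u \<le> R" "norm P \<le> R"
    "norm e' \<le> R" "norm r' \<le> R" "norm u' \<le> R"
    and d: "norm (e - e') \<le> d" "norm (r - r') \<le> d" "norm (u - u') \<le> d" "norm (Q - Q') \<le> d" "norm (P - P') \<le> d"
begin

lemma flux_lip: "norm (flux e u - flux e' u') \<le> (1 + 2 * R) * d"
proof -
  have "norm (flux e u - flux e' u') \<le> d + 2 * R * d"
    unfolding flux_def by (intro norm_add_diff norm_mulC_diff n d R)
  then show ?thesis by (simp add: algebra_simps)
qed

lemma pot_lip: "norm (pot e u - pot e' u') \<le> (1 + R) * d"
proof -
  have "norm (pot e u - pot e' u') \<le> d + (1/2) * (2 * R * d)"
    unfolding pot_def by (intro norm_add_diff norm_scale_diff norm_mulC_diff n d R) simp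
  then show ?thesis by (simp add: algebra_simps)
qed

lemma force_lip: "norm (force e u Q - force e' u' Q') \<le> (\<bar>c\<bar> + 1 + R) * d"
proof -
  have "norm (force e u Q - force e' u' Q') \<le> \<bar>c\<bar> * d + (1 + R) * d"
    unfolding force_def
  proof (rule norm_add_diff)
    show "norm (c *\<^sub>R Q - c *\<^sub>R Q') \<le> \<bar>c\<bar> * d"
      using d(4) by (simp add: scaleR_diff_right[symmetric] mult_left_mono)
    show "norm (third (pot e u) - third (pot e' u')) \<le> (1 + R) * d"
      using norm_third_diff pot_lip by (rule order_trans)
  qed
  then show ?thesis by (simp add: algebra_simps)
qed

lemma Fe_lip: "norm (Fe e u - Fe e' u') \<le> op_bound * ((1 + 2 * R) * d)"
  unfolding Fe_def
  by (rule order_trans[OF op_diff_norm(1)])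
    (intro mult_left_mono op_bound_nonneg order_trans[OF norm_third_diff] flux_lip)

lemma Fr_lip: "norm (Fr e u - Fr e' u') \<le> op_bound * ((1 + 2 * R) * d) + 1 / b * ((1 + 2 * R) * d)"
  unfolding Fr_def using b
  by (intro norm_add_diff norm_scale_diff flux_lip order_trans[OF op_diff_norm(2)]
    mult_left_mono op_bound_nonneg order_trans[OF norm_third_diff]) auto

lemma Fu_lip: "norm (Fu e u Q - Fu e' u' Q') \<le> op_bound * ((\<bar>c\<bar> + 1 + R) * d)"
  unfolding Fu_def by (rule order_trans[OF op_diff_norm(1)]) (intro mult_left_mono op_bound_nonneg force_lip)

lemma FQ_lip: "norm (FQ e r u P - FQ e' r' u' P') \<le> 1 / b * (d + 2 * R * d + (op_bound * ((1 + 2 * R) * d) + 2 * R * d))"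
  unfolding FQ_def using b
  by (intro norm_add_diff norm_scale_diff norm_mulC_diff n d R order_trans[OF norm_third_diff] Fe_lip) auto

lemma FP_lip: "norm (FP e u Q - FP e' u' Q') \<le> \<bar>c\<bar> / b * d + (op_bound * ((\<bar>c\<bar> + 1 + R) * d) + 1 / b * ((1 + R) * d))"
  unfolding FP_def
proof (intro norm_add_diff order_trans[OF norm_third_diff] norm_scale_diff pot_lip)
  show "norm ((c / b) *\<^sub>R Q - (c / b) *\<^sub>R Q') \<le> \<bar>c\<bar> / b * d"
    unfolding scaleR_diff_right[symmetric] using d(4) b by (simp add: mult_left_mono divide_right_mono)
  show "norm (oB (force e u Q) - oB (force e' u' Q')) \<le> op_bound * ((\<bar>c\<bar> + 1 + R) * d)"
    by (rule order_trans[OF op_diff_norm(2)]) (intro mult_left_mono op_bound_nonneg force_lip)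
qed (use b in auto)

lemma F_sum_lip:
  "norm (Fe e u - Fe e' u') + norm (Fr e u - Fr e' u') + norm (Fu e u Q - Fu e' u' Q')
    + norm (FQ e r u P - FQ e' r' u' P') + norm (FP e u Q - FP e' u' Q') \<le> lipc b c op_bound R * d"
proof -
  have "norm (Fe e u - Fe e' u') + norm (Fr e u - Fr e' u') + norm (Fu e u Q - Fu e' u' Q')
      + norm (FQ e r u P - FQ e' r' u' P') + norm (FP e u Q - FP e' u' Q')
    \<le> op_bound * ((1 + 2 * R) * d) + (op_bound * ((1 + 2 * R) * d) + 1 / b * ((1 + 2 * R) * d)) + op_bound * ((\<bar>c\<bar> + 1 + R) * d)
       + 1 / b * (d + 2 * R * d + (op_bound * ((1 + 2 * R) * d) + 2 * R * d))
       + (\<bar>c\<bar> / b * d + (op_bound * ((\<bar>c\<bar> + 1 + R) * d) + 1 / b * ((1 + R) * d)))"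
    by (intro add_mono Fe_lip Fr_lip Fu_lip FQ_lip FP_lip)
  also have "\<dots> = lipc b c op_bound R * d"
    unfolding lipc_def by (simp add: algebra_simps add_divide_distrib)
  finally show ?thesis .
qed

end

lemma F_zero: "Fe 0 0 = 0" "Fr 0 0 = 0" "Fu 0 0 0 = 0" "FQ 0 0 0 0 = 0" "FP 0 0 0 = 0"
proof -
  have z: "oA 0 = 0" "oB 0 = 0" "third 0 = (0 :: real \<Rightarrow>\<^sub>C triple)" "mulC 0 (0::real \<Rightarrow>\<^sub>C real) = 0" "mulC 0 (0::real \<Rightarrow>\<^sub>C triple) = 0"
    using linear_0[OF bounded_linear.linear[OF op_bounded_linear(1)]] linear_0[OF bounded_linear.linear[OF op_bounded_linear(2)]]
      linear_0[OF bounded_linear.linear[OF bounded_linear_third]] bounded_bilinear.zero_left[OF bounded_bilinear_mulC] by auto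
  show "Fe 0 0 = 0" "Fr 0 0 = 0" "Fu 0 0 0 = 0" "FQ 0 0 0 0 = 0" "FP 0 0 0 = 0"
    by (simp_all add: Fe_def Fr_def Fu_def FQ_def FP_def flux_def pot_def force_def z)
qed

lemma F_sum_bound:
  assumes "norm e \<le> R" "norm r \<le> R" "norm u \<le> R" "norm Q \<le> R" "norm P \<le> R"
  shows "norm (Fe e u) + norm (Fr e u) + norm (Fu e u Q) + norm (FQ e r u P) + norm (FP e u Q) \<le> lipc b c op_bound R * R"
proof -
  have "0 \<le> R" using order_trans[OF norm_ge_zero assms(1)] .
  then show ?thesis
    using F_sum_lip[of R e r u P 0 0 0 R Q 0 0] assms by (simp add: F_zero)
qed

lemma continuous_on_op [continuous_intros]:
  "continuous_on A f \<Longrightarrow> continuous_on A (\<lambda>s. oA (f s))" "continuous_on A f \<Longrightarrow> continuous_on A (\<lambda>s. oB (f s))"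
  by (rule bounded_linear.continuous_on[OF op_bounded_linear(1)] bounded_linear.continuous_on[OF op_bounded_linear(2)]; assumption)+

lemma continuous_on_F [continuous_intros]:
  assumes "continuous_on A e" "continuous_on A u"
  shows "continuous_on A (\<lambda>s. flux (e s) (u s))" "continuous_on A (\<lambda>s. pot (e s) (u s))"
    "continuous_on A (\<lambda>s. Fe (e s) (u s))" "continuous_on A (\<lambda>s. Fr (e s) (u s))"
    "continuous_on A Q \<Longrightarrow> continuous_on A (\<lambda>s. force (e s) (u s) (Q s))"
    "continuous_on A Q \<Longrightarrow> continuous_on A (\<lambda>s. Fu (e s) (u s) (Q s))"
    "continuous_on A Q \<Longrightarrow> continuous_on A (\<lambda>s. FP (e s) (u s) (Q s))"
    "continuous_on A r \<Longrightarrow> continuous_on A P \<Longrightarrow> continuous_on A (\<lambda>s. FQ (e s) (r s) (u s) (P s))"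
  unfolding Fe_def Fr_def Fu_def FQ_def FP_def flux_def pot_def force_def
  by (intro continuous_intros assms; assumption)+

lemma bounded_system_solution:
  assumes S: "0 \<le> S"
    and c0: "continuous_on {0..S} e0" "continuous_on {0..S} r0" "continuous_on {0..S} u0" "continuous_on {0..S} Q0" "continuous_on {0..S} P0"
    and n0: "\<And>t. t \<in> {0..S} \<Longrightarrow> norm (e0 t) + norm (r0 t) + norm (u0 t) + norm (Q0 t) + norm (P0 t) \<le> \<rho>"
    and SL: "S * lipc b c op_bound (2 * \<rho>) \<le> 1 / 2"
  obtains e r u Q P where "continuous_on {0..S} e" "continuous_on {0..S} r" "continuous_on {0..S} u" "continuous_on {0..S} Q" "continuous_on {0..S} P"
    "\<And>t. t \<in> {0..S} \<Longrightarrow> norm (e t) \<le> 2 * \<rho> \<and> norm (r t) \<le> 2 * \<rho> \<and> norm (u t) \<le> 2 * \<rho> \<and> norm (Q t) \<le> 2 * \<rho> \<and> norm (P t) \<le> 2 * \<rho>"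
    "\<And>t. t \<in> {0..S} \<Longrightarrow> e t = e0 t + integral {0..t} (\<lambda>s. Fe (e s) (u s))"
    "\<And>t. t \<in> {0..S} \<Longrightarrow> r t = r0 t + integral {0..t} (\<lambda>s. Fr (e s) (u s))"
    "\<And>t. t \<in> {0..S} \<Longrightarrow> u t = u0 t + integral {0..t} (\<lambda>s. Fu (e s) (u s) (Q s))"
    "\<And>t. t \<in> {0..S} \<Longrightarrow> Q t = Q0 t + integral {0..t} (\<lambda>s. FQ (e s) (r s) (u s) (P s))"
    "\<And>t. t \<in> {0..S} \<Longrightarrow> P t = P0 t + integral {0..t} (\<lambda>s. FP (e s) (u s) (Q s))"
proof -
  define F where "F = (\<lambda>(e, r, u, Q, P). (Fe e u, Fr e u, Fu e u Q, FQ e r u P, FP e u Q))"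
  define Z0 where "Z0 t = (e0 t, r0 t, u0 t, Q0 t, P0 t)" for t
  have rho: "0 \<le> \<rho>"
    using n0[of 0] S by (intro order_trans[OF _ n0[of 0]] add_nonneg_nonneg) auto
  have five: "norm (p, q, s, v, w) \<le> norm p + norm q + norm s + norm v + norm w"
    for p q s :: "real \<Rightarrow>\<^sub>C real" and v w :: "real \<Rightarrow>\<^sub>C triple"
    using norm_Pair_le[of p "(q, s, v, w)"] norm_Pair_le[of q "(s, v, w)"] norm_Pair_le[of s "(v, w)"] norm_Pair_le[of v w]
    by linarith
  have comp: "norm p \<le> norm (p, q, s, v, w)" "norm q \<le> norm (p, q, s, v, w)" "norm s \<le> norm (p, q, s, v, w)"
    "norm v \<le> norm (p, q, s, v, w)" "norm w \<le> norm (p, q, s, v, w)"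
    for p q s :: "real \<Rightarrow>\<^sub>C real" and v w :: "real \<Rightarrow>\<^sub>C triple"
    using norm_fst_le[of p "(q, s, v, w)"] norm_snd_le[of "(q, s, v, w)" p]
      norm_fst_le[of q "(s, v, w)"] norm_snd_le[of "(s, v, w)" q]
      norm_fst_le[of s "(v, w)"] norm_snd_le[of "(v, w)" s] norm_fst_le[of v w] norm_snd_le[of w v]
    by linarith+
  let ?L = "lipc b c op_bound (2 * \<rho>)"
  obtain Z where Z: "continuous_on {0..S} Z" "\<And>t. t \<in> {0..S} \<Longrightarrow> norm (Z t) \<le> 2 * \<rho>"
    "continuous_on {0..S} (\<lambda>t. F (Z t))"
    "\<And>t. t \<in> {0..S} \<Longrightarrow> Z t = Z0 t + integral {0..t} (\<lambda>s. F (Z s))"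
  proof (rule picard_local_solution[of S Z0 \<rho> F ?L])
    show "continuous_on {0..S} Z0" unfolding Z0_def by (intro continuous_intros c0)
    show "norm (Z0 t) \<le> \<rho>" if "t \<in> {0..S}" for t
      unfolding Z0_def by (rule order_trans[OF five n0[OF that]])
    show "F 0 = 0" by (simp add: F_def F_zero zero_prod_def)
    show "0 \<le> ?L" using lipc_mono(2)[OF b op_bound_nonneg order_refl, of "2 * \<rho>"] rho by simp
    fix x y :: "(real \<Rightarrow>\<^sub>C real) \<times> (real \<Rightarrow>\<^sub>C real) \<times> (real \<Rightarrow>\<^sub>C real) \<times> (real \<Rightarrow>\<^sub>C triple) \<times> (real \<Rightarrow>\<^sub>C triple)"
    assume xy: "norm x \<le> 2 * \<rho>" "norm y \<le> 2 * \<rho>"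
    obtain e r u Q P where x: "x = (e, r, u, Q, P)" by (cases x)
    obtain e' r' u' Q' P' where y: "y = (e', r', u', Q', P')" by (cases y)
    let ?d = "norm (x - y)" and ?R = "2 * \<rho>"
    have R: "0 \<le> ?R" using rho by simp
    have nx: "norm e \<le> ?R" "norm r \<le> ?R" "norm u \<le> ?R" "norm P \<le> ?R"
      using comp[where p=e and q=r and s=u and v=Q and w=P] xy(1) unfolding x by linarith+
    have ny: "norm e' \<le> ?R" "norm r' \<le> ?R" "norm u' \<le> ?R"
      using comp[where p=e' and q=r' and s=u' and v=Q' and w=P'] xy(2) unfolding y by linarith+
    have dd: "norm (e - e') \<le> ?d" "norm (r - r') \<le> ?d" "norm (u - u') \<le> ?d" "norm (Q - Q') \<le> ?d" "norm (P - P') \<le> ?d"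
      using comp[where p="e-e'" and q="r-r'" and s="u-u'" and v="Q-Q'" and w="P-P'"] unfolding x y by simp_all
    have "norm (F x - F y) \<le> norm (Fe e u - Fe e' u') + norm (Fr e u - Fr e' u') + norm (Fu e u Q - Fu e' u' Q')
       + norm (FQ e r u P - FQ e' r' u' P') + norm (FP e u Q - FP e' u' Q')"
      unfolding F_def x y using five by simp
    also have "\<dots> \<le> ?L * ?d"
      by (rule F_sum_lip[OF R nx ny dd])
    finally show "norm (F x - F y) \<le> ?L * ?d" .
  qed (use S SL in auto)
  define e where "e t = fst (Z t)" for t
  define r where "r t = fst (snd (Z t))" for t
  define u where "u t = fst (snd (snd (Z t)))" for t
  define Q where "Q t = fst (snd (snd (snd (Z t))))" for t
  define P where "P t = snd (snd (snd (snd (Z t))))" for t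
  have Zeq: "Z t = (e t, r t, u t, Q t, P t)" for t
    by (simp add: e_def r_def u_def Q_def P_def)
  have FZ: "F (Z t) = (Fe (e t) (u t), Fr (e t) (u t), Fu (e t) (u t) (Q t), FQ (e t) (r t) (u t) (P t), FP (e t) (u t) (Q t))" for t
    by (simp add: F_def Zeq)
  have ints: "(\<lambda>s. F (Z s)) integrable_on {0..t}" if "t \<in> {0..S}" for t
    by (rule integrable_continuous_real) (rule continuous_on_subset[OF Z(3)], use that in auto)
  \<comment> \<open>The components are read off by projections, which are bounded and linear and
    therefore pass through the time integral.\<close>
  have lin: "h (Z t) = h (Z0 t) + integral {0..t} (\<lambda>s. h (F (Z s)))" if "bounded_linear h" "t \<in> {0..S}" for h :: "_ \<Rightarrow> 'z::banach" and t
  proof -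
    have "h (Z t) = h (Z0 t) + h (integral {0..t} (\<lambda>s. F (Z s)))"
      by (subst Z(4)[OF that(2)]) (rule linear_add[OF bounded_linear.linear[OF that(1)]])
    also have "h (integral {0..t} (\<lambda>s. F (Z s))) = integral {0..t} (\<lambda>s. h (F (Z s)))"
      using integral_linear[OF ints[OF that(2)] that(1)] by (simp add: o_def)
    finally show ?thesis .
  qed
  show thesis
  proof (rule that[of e r u Q P])
    show "continuous_on {0..S} e" "continuous_on {0..S} r" "continuous_on {0..S} u" "continuous_on {0..S} Q" "continuous_on {0..S} P"
      unfolding e_def r_def u_def Q_def P_def by (intro continuous_intros Z)+
    show "norm (e t) \<le> 2 * \<rho> \<and> norm (r t) \<le> 2 * \<rho> \<and> norm (u t) \<le> 2 * \<rho> \<and> norm (Q t) \<le> 2 * \<rho> \<and> norm (P t) \<le> 2 * \<rho>"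
      if "t \<in> {0..S}" for t
      using comp[where p="e t" and q="r t" and s="u t" and v="Q t" and w="P t"] Z(2)[OF that] unfolding Zeq by linarith
    fix t assume t: "t \<in> {0..S}"
    show "e t = e0 t + integral {0..t} (\<lambda>s. Fe (e s) (u s))"
      using lin[OF bounded_linear_fst t] by (simp add: FZ Z0_def e_def)
    show "r t = r0 t + integral {0..t} (\<lambda>s. Fr (e s) (u s))"
      using lin[OF bounded_linear_fst_comp[OF bounded_linear_snd] t] by (simp add: FZ Z0_def r_def)
    show "u t = u0 t + integral {0..t} (\<lambda>s. Fu (e s) (u s) (Q s))"
      using lin[OF bounded_linear_fst_comp[OF bounded_linear_snd_comp[OF bounded_linear_snd]] t] by (simp add: FZ Z0_def u_def)
    show "Q t = Q0 t + integral {0..t} (\<lambda>s. FQ (e s) (r s) (u s) (P s))"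
      using lin[OF bounded_linear_fst_comp[OF bounded_linear_snd_comp[OF bounded_linear_snd_comp[OF bounded_linear_snd]]] t]
      by (simp add: FZ Z0_def Q_def)
    show "P t = P0 t + integral {0..t} (\<lambda>s. FP (e s) (u s) (Q s))"
      using lin[OF bounded_linear_snd_comp[OF bounded_linear_snd_comp[OF bounded_linear_snd_comp[OF bounded_linear_snd]]] t]
      by (simp add: FZ Z0_def P_def)
  qed
qed

lemma Fe_acC: "acC (Fe e u) (third (Fr e u))"
  using acC_opA[OF b, of "third (flux e u)"] by (simp add: Fe_def Fr_def third_simps)

text \<open>The \<open>oB\<close> term of \<open>Fr\<close> contributes \<open>Fe / b\<close> and
  the term \<open>flux / b\<close> contributes the product rule. The only non-continuous term of the
  result is \<open>(1 + e) / b\<close> times the function encoded by \<open>P\<close>, a pointwise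
  multiple: the system closes without a further derivative.\<close>

lemma Fr_acC:
  assumes "acC e (third r)" "acC u P"
  shows "acC (Fr e u) (FQ e r u P)"
proof -
  have "acC (flux e u) (P + (mulC e P + third (mulC r u)))"
    unfolding flux_def by (intro acC_add acC_mulC assms)
  then have "acC (Fr e u) (third ((1 / b) *\<^sub>R Fe e u) + (1/b) *\<^sub>R (P + (mulC e P + third (mulC r u))))"
    unfolding Fr_def Fe_def by (intro acC_add acC_scale acC_opB b)
  then show ?thesis by (simp add: FQ_def third_simps algebra_simps)
qed

lemma Fu_acC: "acC (Fu e u Q) (FP e u Q)"
  using acC_opA[OF b, of "force e u Q"] by (simp add: Fu_def FP_def force_def third_simps algebra_simps)

text \<open>The order matters. The vector fields for the pairs \<open>(e, r)\<close> and
  \<open>(u, P)\<close> satisfy the relation for arbitrary arguments, so these two pairs are settled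
  by integration alone. The pair \<open>(r, Q)\<close> needs both of them at every earlier time, by
  \<open>Fr_acC\<close>.\<close>

lemma solution_acC:
  fixes S :: real
  assumes "continuous_on {0..S} e" "continuous_on {0..S} r" "continuous_on {0..S} u" "continuous_on {0..S} Q" "continuous_on {0..S} P"
    "\<And>t. t \<in> {0..S} \<Longrightarrow> e t = e0 t + integral {0..t} (\<lambda>s. Fe (e s) (u s))"
    "\<And>t. t \<in> {0..S} \<Longrightarrow> r t = r0 t + integral {0..t} (\<lambda>s. Fr (e s) (u s))"
    "\<And>t. t \<in> {0..S} \<Longrightarrow> u t = u0 t + integral {0..t} (\<lambda>s. Fu (e s) (u s) (Q s))"
    "\<And>t. t \<in> {0..S} \<Longrightarrow> Q t = Q0 t + integral {0..t} (\<lambda>s. FQ (e s) (r s) (u s) (P s))"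
    "\<And>t. t \<in> {0..S} \<Longrightarrow> P t = P0 t + integral {0..t} (\<lambda>s. FP (e s) (u s) (Q s))"
    and a: "\<And>t. t \<in> {0..S} \<Longrightarrow> acC (e0 t) (third (r0 t))" "\<And>t. t \<in> {0..S} \<Longrightarrow> acC (r0 t) (Q0 t)"
      "\<And>t. t \<in> {0..S} \<Longrightarrow> acC (u0 t) (P0 t)"
    and t: "t \<in> {0..S}"
  shows "acC (e t) (third (r t))" "acC (r t) (Q t)" "acC (u t) (P t)"
proof -
  have c: "continuous_on {0..t} e" "continuous_on {0..t} r" "continuous_on {0..t} u" "continuous_on {0..t} Q" "continuous_on {0..t} P"
    if "t \<in> {0..S}" for t
  proof -
    have "{0..t} \<subseteq> {0..S}" using that by auto
    then show "continuous_on {0..t} e" "continuous_on {0..t} r" "continuous_on {0..t} u" "continuous_on {0..t} Q" "continuous_on {0..t} P"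
      using assms(1-5) continuous_on_subset by blast+
  qed
  have e: "acC (e t) (third (r t))" if t: "t \<in> {0..S}" for t
  proof -
    have "acC (integral {0..t} (\<lambda>s. Fe (e s) (u s))) (integral {0..t} (\<lambda>s. third (Fr (e s) (u s))))"
      by (intro acC_integral continuous_intros c[OF t] Fe_acC)
    then show ?thesis
      unfolding assms(6)[OF t] assms(7)[OF t] third_simps
      by (intro acC_add a t) (simp add: integral_third continuous_on_F c[OF t])
  qed
  have u: "acC (u t) (P t)" if t: "t \<in> {0..S}" for t
    unfolding assms(8)[OF t] assms(10)[OF t]
    by (intro acC_add a t acC_integral continuous_intros c[OF t] Fu_acC)
  show "acC (r t) (Q t)"
    unfolding assms(7)[OF t] assms(9)[OF t]
    by (intro acC_add a t acC_integral continuous_intros c[OF t] Fr_acC e u) (use t in auto)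
  show "acC (e t) (third (r t))" "acC (u t) (P t)" using e u t by auto
qed

end

section \<open>Change of pairing and lifting of boundary values\<close>

text \<open>A triple \<open>third f\<close> has no component along the singular functions. This
  allows the pairing to be exchanged when \<open>c = 0\<close>, where only such triples enter the
  equation for \<open>u\<close>.\<close>

lemma green_op_third: "green_op b g1 g2 a2 a1 (third f) = green_op b g3 g4 a2 a1 (third f)"
proof -
  have "J g1 g2 (mulC d (third f)) = J g3 g4 (mulC d (third f))" for d
    unfolding J_def by (simp add: pr_def)
  then show ?thesis by (simp only: green_op_def)
qed

lemma opA_third: "opA b g1 g2 (third f) = opA b g3 g4 (third f)"
  and opB_third: "opB b g1 g2 (third f) = opB b g3 g4 (third f)"
  unfolding opA_def opB_def by (rule green_op_third)+

text \<open>With \<open>w2\<close>, \<open>w1\<close> this is the function with boundary increments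
  \<open>p\<close> at -1 and \<open>q\<close> at 1 that occurs in \<open>lifting\<close>; with
  \<open>dw2\<close>, \<open>dw1\<close> it is the spatial derivative of that function.\<close>

definition boundary_lift :: "real \<Rightarrow> (real \<Rightarrow> real) \<Rightarrow> (real \<Rightarrow> real) \<Rightarrow> real \<Rightarrow> real \<Rightarrow> (real \<Rightarrow>\<^sub>C real)" where
  "boundary_lift b a2 a1 p q = (p / sinh (2 / sqrt b)) *\<^sub>R bc a2 + (q / sinh (2 / sqrt b)) *\<^sub>R bc a1"

lemma boundary_lift_lifting:
  assumes "continuous_on {-1..1} f" "x \<in> {-1..1}"
  shows "apply_bcontfun (bc f + boundary_lift b (w2 b) (w1 b) (g t - g 0) (h t - h 0)) x = lifting b f g h t x"
  by (simp add: boundary_lift_def lifting_def bcext_apply_in[OF assms] bcext_apply_in[OF w_continuous(1) assms(2)]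
    bcext_apply_in[OF w_continuous(2) assms(2)] mult.commute)

definition w_mass :: "real \<Rightarrow> real" where
  "w_mass b = (norm (bc (w1 b)) + norm (bc (w2 b)) + norm (bc (dw1 b)) + norm (bc (dw2 b))) / sinh (2 / sqrt b)"

lemma boundary_lift_norm:
  assumes "b > 0" "\<bar>p\<bar> \<le> m" "\<bar>q\<bar> \<le> m"
  shows "norm (boundary_lift b (w2 b) (w1 b) p q) \<le> w_mass b * m" "norm (boundary_lift b (dw2 b) (dw1 b) p q) \<le> w_mass b * m"
proof -
  have s: "sinh (2 / sqrt b) > 0" using assms by simp
  have m: "0 \<le> m" using assms by linarith
  have *: "norm (boundary_lift b a2 a1 p q) \<le> w_mass b * m"
    if "norm (bc a2) + norm (bc a1) \<le> norm (bc (w1 b)) + norm (bc (w2 b)) + norm (bc (dw1 b)) + norm (bc (dw2 b))" for a2 a1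
  proof -
    have "norm (boundary_lift b a2 a1 p q) \<le> \<bar>p\<bar> / sinh (2 / sqrt b) * norm (bc a2) + \<bar>q\<bar> / sinh (2 / sqrt b) * norm (bc a1)"
      unfolding boundary_lift_def using s by (intro order_trans[OF norm_triangle_ineq]) simp
    also have "\<dots> \<le> m / sinh (2 / sqrt b) * norm (bc a2) + m / sinh (2 / sqrt b) * norm (bc a1)"
      using s assms by (intro add_mono mult_right_mono divide_right_mono) auto
    also have "\<dots> = m / sinh (2 / sqrt b) * (norm (bc a2) + norm (bc a1))" by (simp add: distrib_left)
    also have "\<dots> \<le> m / sinh (2 / sqrt b) * (norm (bc (w1 b)) + norm (bc (w2 b)) + norm (bc (dw1 b)) + norm (bc (dw2 b)))"
      using s m that by (intro mult_left_mono) auto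
    finally show ?thesis by (simp add: w_mass_def mult.commute)
  qed
  show "norm (boundary_lift b (w2 b) (w1 b) p q) \<le> w_mass b * m" "norm (boundary_lift b (dw2 b) (dw1 b) p q) \<le> w_mass b * m"
    by (rule *; simp)+
qed

lemma w_mass_nonneg: "b > 0 \<Longrightarrow> 0 \<le> w_mass b"
  unfolding w_mass_def by (intro divide_nonneg_nonneg) auto

lemma continuous_on_boundary_lift [continuous_intros]:
  "continuous_on A p \<Longrightarrow> continuous_on A q \<Longrightarrow> continuous_on A (\<lambda>t. boundary_lift b a2 a1 (p t) (q t))"
  unfolding boundary_lift_def by (cases "sinh (2 / sqrt b) = 0") (auto intro!: continuous_intros)

text \<open>\<open>w1\<close> and \<open>w2\<close> solve \<open>b w'' = w\<close>, so the second
  derivative of the lift is the lift divided by \<open>b\<close> and stays continuous.\<close>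

lemma (in pairing) boundary_lift_acC:
  assumes "b > 0"
  shows "acC (boundary_lift b (w2 b) (w1 b) p q) (third (boundary_lift b (dw2 b) (dw1 b) p q))"
    "acC (boundary_lift b (dw2 b) (dw1 b) p q) (third ((1/b) *\<^sub>R boundary_lift b (w2 b) (w1 b) p q))"
proof -
  have B: "ac (apply_bcontfun (bc f)) (apply_bcontfun (bc f'))"
    if "\<And>x. (f has_real_derivative f' x) (at x)" "continuous_on {-1..1} f'" for f f'
  proof (rule ac_cong)
    show a: "ac f f'" by (rule ac_C1) (use that in auto)
    show "f x = apply_bcontfun (bc f) x" if "x \<in> {-1..1}" for x
      using bcext_apply_in[OF ac_continuous[OF a] that] by simp
    show "f' x = apply_bcontfun (bc f') x" if "x \<in> Omega" for x
      using bcext_apply_in[OF \<open>continuous_on {-1..1} f'\<close>, of x] that by simp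
  qed
  have s: "bc (\<lambda>x. f x / b) = (1 / b) *\<^sub>R bc f" if "continuous_on {-1..1} f" for f
  proof (rule bcontfun_eqI)
    fix x
    have "continuous_on {-1..1} (\<lambda>x. f x / b)" using that assms by (intro continuous_intros) auto
    from bcext_apply[OF this, of x] bcext_apply[OF that, of x]
    show "apply_bcontfun (bc (\<lambda>x. f x / b)) x = apply_bcontfun ((1 / b) *\<^sub>R bc f) x" by simp
  qed
  have c: "continuous_on {-1..1} (\<lambda>x. w1 b x / b)" "continuous_on {-1..1} (\<lambda>x. w2 b x / b)"
    using assms by (auto intro!: continuous_intros)
  have "acC (bc (w1 b)) (third (bc (dw1 b)))" "acC (bc (w2 b)) (third (bc (dw2 b)))"
    unfolding acC_third by (intro B w_derivs assms w_continuous)+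
  then show "acC (boundary_lift b (w2 b) (w1 b) p q) (third (boundary_lift b (dw2 b) (dw1 b) p q))"
    unfolding boundary_lift_def third_simps by (intro acC_add acC_scale)
  have "acC (bc (dw1 b)) (third ((1/b) *\<^sub>R bc (w1 b)))" "acC (bc (dw2 b)) (third ((1/b) *\<^sub>R bc (w2 b)))"
    unfolding acC_third s[OF w_continuous(1), symmetric] s[OF w_continuous(2), symmetric]
    by (intro B w_derivs assms c)+
  then have "acC (boundary_lift b (dw2 b) (dw1 b) p q) ((p / sinh (2 / sqrt b)) *\<^sub>R third ((1/b) *\<^sub>R bc (w2 b)) + (q / sinh (2 / sqrt b)) *\<^sub>R third ((1/b) *\<^sub>R bc (w1 b)))"
    unfolding boundary_lift_def by (intro acC_add acC_scale)
  then show "acC (boundary_lift b (dw2 b) (dw1 b) p q) (third ((1/b) *\<^sub>R boundary_lift b (w2 b) (w1 b) p q))"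
    unfolding boundary_lift_def by (simp add: third_simps scaleR_add_right mult.commute)
qed

lemma norm_integral_le:
  fixes f :: "real \<Rightarrow> 'a::banach"
  assumes "continuous_on {0..t} f" "\<And>s. s \<in> {0..t} \<Longrightarrow> norm (f s) \<le> B" "0 \<le> t" "t \<le> S" "0 \<le> B"
  shows "norm (integral {0..t} f) \<le> S * B"
proof -
  have "norm (integral {0..t} f) \<le> integral {0..t} (\<lambda>_. B)"
    by (rule integral_norm_bound_integral[OF integrable_continuous_real[OF assms(1)]]) (use assms in auto)
  also have "\<dots> = t * B" using assms by simp
  also have "\<dots> \<le> S * B" using assms by (intro mult_right_mono) auto
  finally show ?thesis .
qed

lemma C1_interval_bound:
  assumes "C1_interval S h"
  obtains h' M where "\<And>t. t \<in> {0..S} \<Longrightarrow> (h has_real_derivative h' t) (at t within {0..S})" "continuous_on {0..S} h'"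
    "\<And>t. t \<in> {0..S} \<Longrightarrow> \<bar>h' t\<bar> \<le> M"
proof -
  obtain h' where h': "\<And>t. t \<in> {0..S} \<Longrightarrow> (h has_real_derivative h' t) (at t within {0..S})" "continuous_on {0..S} h'"
    using assms unfolding C1_interval_def by blast
  obtain M where "\<And>t. t \<in> {0..S} \<Longrightarrow> \<bar>h' t\<bar> \<le> M"
    using continuous_on_Icc_bounded[OF h'(2)] by blast
  with h' that show thesis by blast
qed

section \<open>Uniqueness\<close>

lemma A_D_cong: "(\<And>y. y \<in> Omega \<Longrightarrow> f y = g y) \<Longrightarrow> A_D b f x = A_D b g x"
  unfolding A_D_def by (rule set_lebesgue_integral_cong) auto

lemma L1_integral_cong_AE:
  assumes "L1 f" "L1 g" "AE x in lborel. x \<in> Omega \<longrightarrow> f x = g x" "x \<in> {-1..1}"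
  shows "integral {-1..x} f = integral {-1..x} g" "integral {x..1} f = integral {x..1} g"
proof -
  have 1: "integral {-1..x} f = integral {-1..x} g" if "x \<in> {-1..1}" for x
  proof -
    have "ac (\<lambda>x. integral {-1..x} f) f" by (rule acI[OF assms(1)]) simp
    then have "ac (\<lambda>x. integral {-1..x} f) g" using assms(3,2) by (rule ac_cong_AE)
    from acD(2)[OF this that] show ?thesis by simp
  qed
  then show "integral {-1..x} f = integral {-1..x} g" using assms(4) .
  have "integral {-1..x} f + integral {x..1} f = integral {-1..1} f" "integral {-1..x} g + integral {x..1} g = integral {-1..1} g"
    using assms(4) by (intro Henstock_Kurzweil_Integration.integral_combine L1_integrable_on assms; simp)+
  with 1[OF assms(4)] 1[of 1] show "integral {x..1} f = integral {x..1} g" by simp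
qed

lemma A_D_cong_AE:
  assumes "b > 0" "L1 f" "L1 g" "AE x in lborel. x \<in> Omega \<longrightarrow> f x = g x" "x \<in> {-1..1}"
  shows "A_D b f x = A_D b g x"
proof -
  have L: "L1 (\<lambda>y. dw1 b y * f y)" "L1 (\<lambda>y. dw1 b y * g y)" "L1 (\<lambda>y. dw2 b y * f y)" "L1 (\<lambda>y. dw2 b y * g y)"
    by (intro L1_mult_continuous assms w_continuous)+
  have ae: "AE x in lborel. x \<in> Omega \<longrightarrow> k x * f x = k x * g x" for k :: "real \<Rightarrow> real"
    using assms(4) by eventually_elim auto
  show ?thesis
    unfolding A_D_eq[OF assms(1,2,5)] A_D_eq[OF assms(1,3,5)]
    using L1_integral_cong_AE(1)[OF L(1,2) ae assms(5)] L1_integral_cong_AE(2)[OF L(3,4) ae assms(5)] by simp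
qed

lemma A_D_linear:
  assumes b: "b > 0" and f: "L1 f" and g: "L1 g" and x: "x \<in> {-1..1}"
  shows "A_D b (\<lambda>y. k * f y + g y) x = k * A_D b f x + A_D b g x"
proof -
  have kfg: "L1 (\<lambda>y. k * f y + g y)" using f g by simp
  have lin: "integral {p..q} (\<lambda>y. d y * (k * f y + g y)) = k * integral {p..q} (\<lambda>y. d y * f y) + integral {p..q} (\<lambda>y. d y * g y)"
    if "continuous_on {-1..1} d" "-1 \<le> p" "q \<le> 1" for d p q
  proof -
    have i: "(\<lambda>y. d y * f y) integrable_on {p..q}" "(\<lambda>y. d y * g y) integrable_on {p..q}"
      using that by (intro L1_integrable_on[OF L1_mult_continuous[OF f that(1)]] L1_integrable_on[OF L1_mult_continuous[OF g that(1)]]; simp)+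
    have "((\<lambda>y. k * (d y * f y) + d y * g y) has_integral k * integral {p..q} (\<lambda>y. d y * f y) + integral {p..q} (\<lambda>y. d y * g y)) {p..q}"
      by (intro has_integral_add has_integral_mult_right integrable_integral i)
    then show ?thesis by (intro integral_unique) (simp add: algebra_simps)
  qed
  have l1: "integral {-1..x} (\<lambda>y. dw1 b y * (k * f y + g y)) = k * integral {-1..x} (\<lambda>y. dw1 b y * f y) + integral {-1..x} (\<lambda>y. dw1 b y * g y)"
    and l2: "integral {x..1} (\<lambda>y. dw2 b y * (k * f y + g y)) = k * integral {x..1} (\<lambda>y. dw2 b y * f y) + integral {x..1} (\<lambda>y. dw2 b y * g y)"
    using x by (intro lin w_continuous; simp)+
  show ?thesis
    unfolding A_D_eq[OF b kfg x] A_D_eq[OF b f x] A_D_eq[OF b g x] l1 l2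
    by (simp add: algebra_simps)
qed

text \<open>\<open>M\<close> bounds all kernel factors. Integration by parts of one integral leaves
  two boundary terms, giving the first 2, and an integral over length at most 2 with kernel
  derivative at most \<open>M / b\<close>, giving \<open>2 / b\<close>. The outer 2 counts the
  integrals on both sides of \<open>x\<close>.\<close>

definition parts_const :: "real \<Rightarrow> real" where
  "parts_const b = (let M = norm (bc (w1 b)) + norm (bc (w2 b)) + norm (bc (dw1 b)) + norm (bc (dw2 b))
    in \<bar>kap b\<bar> * (2 * (M * (M * (2 + 2 / b)))))"

lemma parts_const_nonneg: "b > 0 \<Longrightarrow> 0 \<le> parts_const b"
  unfolding parts_const_def Let_def by (intro mult_nonneg_nonneg) auto

text \<open>Integration by parts moves the derivative in \<open>A\<^sub>D q = A\<^sub>D r'\<close> onto the smooth kernel, so only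
  the sup norm of \<open>r\<close> is needed.\<close>

lemma A_D_deriv_bound:
  assumes b: "b > 0" and r: "ac r q" and x: "x \<in> {-1..1}" and m: "\<And>y. y \<in> {-1..1} \<Longrightarrow> \<bar>r y\<bar> \<le> m"
  shows "\<bar>A_D b q x\<bar> \<le> parts_const b * m"
proof -
  define M where "M = norm (bc (w1 b)) + norm (bc (w2 b)) + norm (bc (dw1 b)) + norm (bc (dw2 b))"
  have wb: "\<bar>w1 b y\<bar> \<le> M" "\<bar>w2 b y\<bar> \<le> M" "\<bar>dw1 b y\<bar> \<le> M" "\<bar>dw2 b y\<bar> \<le> M" if "y \<in> {-1..1}" for y
    using norm_bounded[of "bc (w1 b)" y] norm_bounded[of "bc (w2 b)" y] norm_bounded[of "bc (dw1 b)" y] norm_bounded[of "bc (dw2 b)" y]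
    unfolding M_def bcext_apply_in[OF w_continuous(1) that] bcext_apply_in[OF w_continuous(2) that]
      bcext_apply_in[OF w_continuous(3) that] bcext_apply_in[OF w_continuous(4) that] real_norm_def
    using norm_ge_zero[of "bc (w1 b)"] norm_ge_zero[of "bc (w2 b)"] norm_ge_zero[of "bc (dw1 b)"] norm_ge_zero[of "bc (dw2 b)"]
    by linarith+
  have M0: "0 \<le> M" by (simp add: M_def)
  have m0: "0 \<le> m" using order_trans[OF abs_ge_zero m[of 0]] by simp
  note rc = ac_continuous[OF r]
  have key: "\<bar>integral {p..p'} (\<lambda>y. d y * q y)\<bar> \<le> M * (2 + 2 / b) * m"
    if d: "ac d (\<lambda>y. w y / b)" and w: "continuous_on {-1..1} w" "\<And>y. y \<in> {-1..1} \<Longrightarrow> \<bar>w y\<bar> \<le> M" "\<And>y. y \<in> {-1..1} \<Longrightarrow> \<bar>d y\<bar> \<le> M"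
      and p: "-1 \<le> p" "p \<le> p'" "p' \<le> 1" for d w p p'
  proof -
    have dr: "ac (\<lambda>y. d y * r y) (\<lambda>y. d y * q y + r y * (w y / b))" by (rule ac_mult[OF d r])
    have i1: "(\<lambda>y. d y * q y) integrable_on {p..p'}"
      using p by (intro L1_integrable_on L1_mult_continuous acD(1)[OF r] ac_continuous[OF d])
    have cw: "continuous_on {-1..1} (\<lambda>y. r y * (w y / b))" using b by (intro continuous_intros rc w) auto
    have i2: "(\<lambda>y. r y * (w y / b)) integrable_on {p..p'}"
      using p by (intro L1_integrable_on L1_continuous cw)
    have "integral {-1..p} (\<lambda>y. d y * q y + r y * (w y / b)) + integral {p..p'} (\<lambda>y. d y * q y + r y * (w y / b))
      = integral {-1..p'} (\<lambda>y. d y * q y + r y * (w y / b))"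
      using p by (intro Henstock_Kurzweil_Integration.integral_combine L1_integrable_on acD(1)[OF dr]) auto
    then have "d p' * r p' - d p * r p = integral {p..p'} (\<lambda>y. d y * q y + r y * (w y / b))"
      using acD(2)[OF dr, of p] acD(2)[OF dr, of p'] p by auto
    also have "\<dots> = integral {p..p'} (\<lambda>y. d y * q y) + integral {p..p'} (\<lambda>y. r y * (w y / b))"
      by (rule Henstock_Kurzweil_Integration.integral_add[OF i1 i2])
    finally have eq: "integral {p..p'} (\<lambda>y. d y * q y) = d p' * r p' - d p * r p - integral {p..p'} (\<lambda>y. r y * (w y / b))" by simp
    have dm: "\<bar>d y * r y\<bar> \<le> M * m" if "y \<in> {-1..1}" for y
      unfolding abs_mult by (intro mult_mono w m that M0) auto
    have "norm (integral {p..p'} (\<lambda>y. r y * (w y / b))) \<le> integral {p..p'} (\<lambda>_. m * (M / b))"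
    proof (rule integral_norm_bound_integral[OF i2 integrable_const_ivl])
      fix y assume "y \<in> {p..p'}"
      then have y: "y \<in> {-1..1}" using p by auto
      show "norm (r y * (w y / b)) \<le> m * (M / b)"
        unfolding real_norm_def abs_mult abs_divide using b by (intro mult_mono m y m0 frac_le w) (auto intro: M0 w y)
    qed
    also have "\<dots> = (p' - p) * (m * (M / b))" using p by simp
    also have "\<dots> \<le> 2 * (m * (M / b))" using p m0 M0 b by (intro mult_right_mono) auto
    finally have "\<bar>integral {p..p'} (\<lambda>y. r y * (w y / b))\<bar> \<le> 2 * (m * (M / b))" by simp
    moreover have "\<bar>d p' * r p'\<bar> \<le> M * m" "\<bar>d p * r p\<bar> \<le> M * m" using p by (auto intro!: dm)
    ultimately have "\<bar>integral {p..p'} (\<lambda>y. d y * q y)\<bar> \<le> M * m + M * m + 2 * (m * (M / b))"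
      unfolding eq by linarith
    also have "\<dots> = M * (2 + 2 / b) * m" by (simp add: algebra_simps)
    finally show ?thesis .
  qed
  have acd: "ac (dw1 b) (\<lambda>y. w1 b y / b)" "ac (dw2 b) (\<lambda>y. w2 b y / b)"
    using b by (auto intro!: ac_C1 w_derivs continuous_intros)
  have k1: "\<bar>integral {-1..x} (\<lambda>y. dw1 b y * q y)\<bar> \<le> M * (2 + 2 / b) * m"
    by (rule key[OF acd(1) w_continuous(1) wb(1,3)]) (use x in auto)
  have k2: "\<bar>integral {x..1} (\<lambda>y. dw2 b y * q y)\<bar> \<le> M * (2 + 2 / b) * m"
    by (rule key[OF acd(2) w_continuous(2) wb(2,4)]) (use x in auto)
  have "\<bar>A_D b q x\<bar> = \<bar>kap b\<bar> * \<bar>w2 b x * integral {-1..x} (\<lambda>y. dw1 b y * q y) + w1 b x * integral {x..1} (\<lambda>y. dw2 b y * q y)\<bar>"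
    unfolding A_D_eq[OF b acD(1)[OF r] x] by (simp add: abs_mult)
  also have "\<dots> \<le> \<bar>kap b\<bar> * (M * (M * (2 + 2 / b) * m) + M * (M * (2 + 2 / b) * m))"
  proof (intro mult_left_mono order_trans[OF abs_triangle_ineq] add_mono)
    show "\<bar>w2 b x * integral {-1..x} (\<lambda>y. dw1 b y * q y)\<bar> \<le> M * (M * (2 + 2 / b) * m)"
      unfolding abs_mult by (intro mult_mono k1 wb x M0) auto
    show "\<bar>w1 b x * integral {x..1} (\<lambda>y. dw2 b y * q y)\<bar> \<le> M * (M * (2 + 2 / b) * m)"
      unfolding abs_mult by (intro mult_mono k2 wb x M0) auto
  qed auto
  also have "\<dots> = parts_const b * m"
    unfolding parts_const_def Let_def M_def[symmetric] by (simp add: algebra_simps)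
  finally show ?thesis .
qed

text \<open>The system is stated with a Lebesgue integral in time at each fixed \<open>x\<close>,
  the iteration with an integral in the Banach space; evaluation at \<open>x\<close> is bounded and
  linear.\<close>

lemma LBINT_apply_bcontfun:
  fixes f :: "real \<Rightarrow> (real \<Rightarrow>\<^sub>C real)"
  assumes "continuous_on {0..t} f"
  shows "(LBINT s:{0..t}. apply_bcontfun (f s) x) = apply_bcontfun (integral {0..t} f) x"
proof -
  have c: "continuous_on {0..t} (\<lambda>s. apply_bcontfun (f s) x)"
    by (rule bounded_linear.continuous_on[OF bounded_linear_apply_bcontfun assms])
  have "(LBINT s:{0..t}. apply_bcontfun (f s) x) = integral {0..t} (\<lambda>s. apply_bcontfun (f s) x)"
    by (rule set_borel_integral_eq_integral(2)[OF borel_integrable_atLeastAtMost'[OF c]])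
  also have "\<dots> = apply_bcontfun (integral {0..t} f) x"
    using integral_linear[OF integrable_continuous_real[OF assms] bounded_linear_apply_bcontfun, of x] by (simp add: o_def)
  finally show ?thesis .
qed

section \<open>From the evolution equation to the integral system\<close>

context bs_system begin

lemma Fe_eq_A_D:
  assumes "x \<in> {-1..1}"
  shows "apply_bcontfun (Fe e u) x = A_D b (\<lambda>y. apply_bcontfun u y + apply_bcontfun e y * apply_bcontfun u y) x"
  unfolding Fe_def opA_eq_A_D[OF b assms] by (simp add: pr_simps flux_def)

text \<open>The function encoded by \<open>Q\<close> and the arbitrarily chosen second weak
  derivative agree almost everywhere, and \<open>A_D\<close> does not see the difference.\<close>

lemma Fu_eq_A_D:
  assumes "acC e (third r)" "acC r Q" "x \<in> {-1..1}"
  shows "apply_bcontfun (Fu e u Q) x = A_D b (\<lambda>y. c * wderiv (wderiv (apply_bcontfun e)) y + apply_bcontfun e y + (apply_bcontfun u y)\<^sup>2 / 2) x"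
proof -
  note w = wderiv_wderiv_AE_eq[OF assms(1)[unfolded acC_third] assms(2)[unfolded acC_def]]
  have Lw: "L1 (wderiv (wderiv (apply_bcontfun e)))"
    by (rule L2w_imp_L1[OF mu(2)]) (rule wderiv_L2w(1)[OF w(1) pr_L2w(1)])
  have Lp: "L1 (\<lambda>y. apply_bcontfun e y + (apply_bcontfun u y)\<^sup>2 / 2)"
    by (intro L1_continuous continuous_intros continuous_on_apply_bcontfun) auto
  have "apply_bcontfun (Fu e u Q) x = A_D b (\<lambda>y. pr g1 g2 (apply_bcontfun (force e u Q) y) y) x"
    unfolding Fu_def by (rule opA_eq_A_D[OF b assms(3)])
  also have "\<dots> = A_D b (\<lambda>y. c * wderiv (wderiv (apply_bcontfun e)) y + (apply_bcontfun e y + (apply_bcontfun u y)\<^sup>2 / 2)) x"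
  proof (rule A_D_cong_AE[OF b pr_L1 _ _ assms(3)])
    show "L1 (\<lambda>y. c * wderiv (wderiv (apply_bcontfun e)) y + (apply_bcontfun e y + (apply_bcontfun u y)\<^sup>2 / 2))"
      using Lw Lp by simp
    show "AE y in lborel. y \<in> Omega \<longrightarrow> pr g1 g2 (apply_bcontfun (force e u Q) y) y
      = c * wderiv (wderiv (apply_bcontfun e)) y + (apply_bcontfun e y + (apply_bcontfun u y)\<^sup>2 / 2)"
      using w(2) by eventually_elim (auto simp: force_def pot_def pr_simps power2_eq_square)
  qed
  finally show ?thesis by (simp add: add.assoc)
qed

lemma solution_solves_system:
  fixes S :: real
  assumes c: "continuous_on {0..S} e" "continuous_on {0..S} u" "continuous_on {0..S} Q"
    and a: "\<And>t. t \<in> {0..S} \<Longrightarrow> acC (e t) (third (r t))" "\<And>t. t \<in> {0..S} \<Longrightarrow> acC (r t) (Q t)"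
    and i: "continuous_on {-1..1} eta0" "continuous_on {-1..1} u0"
    and e: "\<And>t. t \<in> {0..S} \<Longrightarrow> e t = bc eta0 + boundary_lift b (w2 b) (w1 b) (h1 t - h1 0) (h2 t - h2 0) + integral {0..t} (\<lambda>s. Fe (e s) (u s))"
    and u: "\<And>t. t \<in> {0..S} \<Longrightarrow> u t = bc u0 + boundary_lift b (w2 b) (w1 b) (v1 t - v1 0) (v2 t - v2 0) + integral {0..t} (\<lambda>s. Fu (e s) (u s) (Q s))"
  shows "solves_system b c S h1 h2 v1 v2 eta0 u0 (\<lambda>t. apply_bcontfun (e t)) (\<lambda>t. apply_bcontfun (u t))"
  unfolding solves_system_def
proof (intro ballI conjI)
  fix t x :: real assume t: "t \<in> {0..S}" and x: "x \<in> {-1..1}"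
  have sub: "{0..t} \<subseteq> {0..S}" using t by auto
  have ct: "continuous_on {0..t} e" "continuous_on {0..t} u" "continuous_on {0..t} Q"
    using c sub continuous_on_subset by blast+
  have "(LBINT s:{0..t}. A_D b (\<lambda>y. apply_bcontfun (u s) y + apply_bcontfun (e s) y * apply_bcontfun (u s) y) x)
     = (LBINT s:{0..t}. apply_bcontfun (Fe (e s) (u s)) x)"
    by (simp add: Fe_eq_A_D[OF x])
  also have "\<dots> = apply_bcontfun (integral {0..t} (\<lambda>s. Fe (e s) (u s))) x"
    by (intro LBINT_apply_bcontfun continuous_intros ct)
  finally show "apply_bcontfun (e t) x = lifting b eta0 h1 h2 t x
     + (LBINT s:{0..t}. A_D b (\<lambda>y. apply_bcontfun (u s) y + apply_bcontfun (e s) y * apply_bcontfun (u s) y) x)"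
    unfolding boundary_lift_lifting[OF i(1) x, symmetric] by (subst e[OF t]) simp
  have "(LBINT s:{0..t}. A_D b (\<lambda>y. c * wderiv (wderiv (apply_bcontfun (e s))) y + apply_bcontfun (e s) y + (apply_bcontfun (u s) y)\<^sup>2 / 2) x)
     = (LBINT s:{0..t}. apply_bcontfun (Fu (e s) (u s) (Q s)) x)"
    using sub by (intro set_lebesgue_integral_cong) (auto intro!: Fu_eq_A_D[OF a(1) a(2) x, symmetric])
  also have "\<dots> = apply_bcontfun (integral {0..t} (\<lambda>s. Fu (e s) (u s) (Q s))) x"
    by (intro LBINT_apply_bcontfun continuous_intros ct)
  finally show "apply_bcontfun (u t) x = lifting b u0 v1 v2 t x
     + (LBINT s:{0..t}. A_D b (\<lambda>y. c * wderiv (wderiv (apply_bcontfun (e s))) y + apply_bcontfun (e s) y + (apply_bcontfun (u s) y)\<^sup>2 / 2) x)"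
    unfolding boundary_lift_lifting[OF i(2) x, symmetric] by (subst u[OF t]) simp
qed

end

section \<open>Comparison of two solutions in the sup norm\<close>

context weight_exponent begin

text \<open>The first assumption is a Sobolev bound for differences; with it continuity in time
  transfers from the weighted norm to the sup norm, where Gronwall is applied.\<close>

lemma CHw_imp_continuous_on:
  fixes g :: "real \<Rightarrow> (real \<Rightarrow>\<^sub>C real)"
  assumes "\<And>s t. s \<in> {0..S} \<Longrightarrow> t \<in> {0..S} \<Longrightarrow> norm (g s - g t) \<le> K * Hw_norm mu k (\<lambda>x. f s x - f t x)"
    "f \<in> CHw mu k S"
  shows "continuous_on {0..S} g"
  unfolding continuous_on_def
proof
  fix t assume t: "t \<in> {0..S}"
  have "((\<lambda>s. norm (g s - g t)) \<longlongrightarrow> 0) (at t within {0..S})"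
  proof (rule tendsto_sandwich[OF _ _ tendsto_const])
    show "((\<lambda>s. K * Hw_norm mu k (\<lambda>x. f s x - f t x)) \<longlongrightarrow> 0) (at t within {0..S})"
      using assms(2) t by (intro tendsto_mult_right_zero) (auto simp: CHw_def)
    show "\<forall>\<^sub>F s in at t within {0..S}. norm (g s - g t) \<le> K * Hw_norm mu k (\<lambda>x. f s x - f t x)"
      using assms(1) t by (auto simp: eventually_at_filter)
  qed simp
  then show "(g \<longlongrightarrow> g t) (at t within {0..S})"
    by (simp add: tendsto_norm_zero_iff LIM_zero_iff)
qed

lemma bc_apply_in: "continuous_on {-1..1} f \<Longrightarrow> x \<in> {-1..1} \<Longrightarrow> apply_bcontfun (bc f) x = f x"
  by (rule bcext_apply_in)

lemma bc_diff_norm_le: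
  assumes "continuous_on {-1..1} f" "continuous_on {-1..1} g" "\<And>x. x \<in> {-1..1} \<Longrightarrow> \<bar>f x - g x\<bar> \<le> B"
  shows "norm (bc f - bc g) \<le> (B :: real)"
proof (rule norm_bound)
  fix x
  have "clamp (-1) 1 x \<in> {-1..1::real}" by (rule clamp_real) simp
  then show "norm (apply_bcontfun (bc f - bc g) x) \<le> B"
    using assms(3) by (simp add: bcext_apply assms(1,2))
qed

text \<open>The derivatives \<open>r t\<close> are chosen separately for each time. They
  nevertheless depend continuously on time, because the Sobolev bound applied to differences of two
  times controls the first derivative as well.\<close>

lemma CHw2_profile:
  assumes "eta \<in> CHw mu 2 S"
  obtains r q where "\<And>t. t \<in> {0..S} \<Longrightarrow> ac (eta t) (r t)" "\<And>t. t \<in> {0..S} \<Longrightarrow> ac (r t) (q t)"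
    "\<And>t. t \<in> {0..S} \<Longrightarrow> q t \<in> L2w mu"
    "continuous_on {0..S} (\<lambda>t. bc (eta t))" "continuous_on {0..S} (\<lambda>t. bc (r t))"
proof -
  have "\<forall>t\<in>{0..S}. \<exists>r q. ac (eta t) r \<and> ac r q \<and> q \<in> L2w mu"
    using assms Hw2_elim unfolding CHw_def by (metis (no_types, lifting) mem_Collect_eq)
  then obtain r q where rq: "\<And>t. t \<in> {0..S} \<Longrightarrow> ac (eta t) (r t)" "\<And>t. t \<in> {0..S} \<Longrightarrow> ac (r t) (q t)"
    "\<And>t. t \<in> {0..S} \<Longrightarrow> q t \<in> L2w mu" by metis
  have b: "\<bar>eta s x - eta t x\<bar> \<le> 2 * embed_const mu * Hw_norm mu 2 (\<lambda>x. eta s x - eta t x)"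
    "\<bar>r s x - r t x\<bar> \<le> 2 * embed_const mu * Hw_norm mu 2 (\<lambda>x. eta s x - eta t x)"
    if "s \<in> {0..S}" "t \<in> {0..S}" "x \<in> {-1..1}" for s t x
  proof -
    have "(\<lambda>x. (1::real) * q s x + (-1) * q t x + 0) \<in> L2w mu"
      by (rule L2w_combination[OF mu(1) rq(3)[OF that(1)] rq(3)[OF that(2)], where R=1]) auto
    then have L: "(\<lambda>x. q s x - q t x) \<in> L2w mu" by simp
    show "\<bar>eta s x - eta t x\<bar> \<le> 2 * embed_const mu * Hw_norm mu 2 (\<lambda>x. eta s x - eta t x)"
      "\<bar>r s x - r t x\<bar> \<le> 2 * embed_const mu * Hw_norm mu 2 (\<lambda>x. eta s x - eta t x)"
      using sobolev_bound2[OF ac_diff[OF rq(1)[OF that(1)] rq(1)[OF that(2)]] ac_diff[OF rq(2)[OF that(1)] rq(2)[OF that(2)]] L that(3)]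
      by auto
  qed
  have "continuous_on {0..S} (\<lambda>t. bc (eta t))" "continuous_on {0..S} (\<lambda>t. bc (r t))"
    by (rule CHw_imp_continuous_on[OF bc_diff_norm_le assms, where K="2 * embed_const mu"];
        use b ac_continuous[OF rq(1)] ac_continuous[OF rq(2)] in auto)+
  with rq that show thesis by blast
qed

lemma CHw1_profile:
  assumes "u \<in> CHw mu 1 S"
  shows "\<And>t. t \<in> {0..S} \<Longrightarrow> continuous_on {-1..1} (u t)" "continuous_on {0..S} (\<lambda>t. bc (u t))"
proof -
  have "\<forall>t\<in>{0..S}. \<exists>p. ac (u t) p \<and> p \<in> L2w mu"
    using assms Hw1_elim unfolding CHw_def by (metis (no_types, lifting) mem_Collect_eq)
  then obtain p where p: "\<And>t. t \<in> {0..S} \<Longrightarrow> ac (u t) (p t)" "\<And>t. t \<in> {0..S} \<Longrightarrow> p t \<in> L2w mu" by metis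
  show c: "continuous_on {-1..1} (u t)" if "t \<in> {0..S}" for t by (rule ac_continuous[OF p(1)[OF that]])
  have b: "\<bar>u s x - u t x\<bar> \<le> 2 * embed_const mu * Hw_norm mu 1 (\<lambda>x. u s x - u t x)"
    if "s \<in> {0..S}" "t \<in> {0..S}" "x \<in> {-1..1}" for s t x
  proof -
    have "(\<lambda>x. (1::real) * p s x + (-1) * p t x + 0) \<in> L2w mu"
      by (rule L2w_combination[OF mu(1) p(2)[OF that(1)] p(2)[OF that(2)], where R=1]) auto
    then have L: "(\<lambda>x. p s x - p t x) \<in> L2w mu" by simp
    show ?thesis using sobolev_bound[OF ac_diff[OF p(1)[OF that(1)] p(1)[OF that(2)]] L that(3)] .
  qed
  show "continuous_on {0..S} (\<lambda>t. bc (u t))"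
    by (rule CHw_imp_continuous_on[OF bc_diff_norm_le assms, where K="2 * embed_const mu"]) (use b c in auto)
qed

text \<open>Membership in \<open>CHw mu 1 S\<close> is all that is asked of \<open>u\<close>, so the
  lemma serves both regularity classes. The estimates for \<eta> and its first derivative reuse the
  Lipschitz bounds of the vector field; only the term with the second derivative is estimated
  separately.\<close>

lemma system_unique:
  assumes b: "b > 0"
    and c1: "eta1 \<in> CHw mu 2 S" "u1 \<in> CHw mu 1 S" and c2: "eta2 \<in> CHw mu 2 S" "u2 \<in> CHw mu 1 S"
    and s1: "solves_system b c S h1 h2 v1 v2 eta0 u0 eta1 u1" and s2: "solves_system b c S h1 h2 v1 v2 eta0 u0 eta2 u2"
    and t: "t \<in> {0..S}" and x: "x \<in> {-1..1}"
  shows "eta1 t x = eta2 t x \<and> u1 t x = u2 t x"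
proof -
  \<comment> \<open>The competitors are arbitrary, so their second derivatives need not be
    combinations of fixed singular functions. The pairing with zero functions is enough, since the
    vector field is applied here to continuous functions only.\<close>
  interpret Z: bs_system mu "\<lambda>_. 0" "\<lambda>_. 0" b c
    by unfold_locales (use b zero_L2w in auto)
  obtain r1 q1 where rq1: "\<And>t. t \<in> {0..S} \<Longrightarrow> ac (eta1 t) (r1 t)" "\<And>t. t \<in> {0..S} \<Longrightarrow> ac (r1 t) (q1 t)"
    "\<And>t. t \<in> {0..S} \<Longrightarrow> q1 t \<in> L2w mu"
    "continuous_on {0..S} (\<lambda>t. bc (eta1 t))" "continuous_on {0..S} (\<lambda>t. bc (r1 t))"
    using CHw2_profile[OF c1(1)] by metis
  obtain r2 q2 where rq2: "\<And>t. t \<in> {0..S} \<Longrightarrow> ac (eta2 t) (r2 t)" "\<And>t. t \<in> {0..S} \<Longrightarrow> ac (r2 t) (q2 t)"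
    "\<And>t. t \<in> {0..S} \<Longrightarrow> q2 t \<in> L2w mu"
    "continuous_on {0..S} (\<lambda>t. bc (eta2 t))" "continuous_on {0..S} (\<lambda>t. bc (r2 t))"
    using CHw2_profile[OF c2(1)] by metis
  note u1 = CHw1_profile[OF c1(2)] and u2 = CHw1_profile[OF c2(2)]
  define D where "D s = norm (bc (eta1 s) - bc (eta2 s)) + norm (bc (r1 s) - bc (r2 s)) + norm (bc (u1 s) - bc (u2 s))" for s
  have cD: "continuous_on {0..S} D"
    unfolding D_def by (intro continuous_intros rq1 rq2 u1 u2)
  obtain R where R: "\<And>s. s \<in> {0..S} \<Longrightarrow> norm (bc (eta1 s)) \<le> R \<and> norm (bc (r1 s)) \<le> R \<and> norm (bc (u1 s)) \<le> R
      \<and> norm (bc (eta2 s)) \<le> R \<and> norm (bc (r2 s)) \<le> R \<and> norm (bc (u2 s)) \<le> R"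
  proof -
    have "continuous_on {0..S} (\<lambda>s. norm (bc (eta1 s)) + norm (bc (r1 s)) + norm (bc (u1 s)) + norm (bc (eta2 s)) + norm (bc (r2 s)) + norm (bc (u2 s)))"
      by (intro continuous_intros rq1 rq2 u1 u2)
    then obtain R where R: "\<And>s. s \<in> {0..S} \<Longrightarrow> \<bar>norm (bc (eta1 s)) + norm (bc (r1 s)) + norm (bc (u1 s)) + norm (bc (eta2 s)) + norm (bc (r2 s)) + norm (bc (u2 s))\<bar> \<le> R"
      using continuous_on_Icc_bounded by blast
    show thesis
    proof (rule that[of R])
      fix s assume "s \<in> {0..S}"
      from R[OF this] show "norm (bc (eta1 s)) \<le> R \<and> norm (bc (r1 s)) \<le> R \<and> norm (bc (u1 s)) \<le> R
        \<and> norm (bc (eta2 s)) \<le> R \<and> norm (bc (r2 s)) \<le> R \<and> norm (bc (u2 s)) \<le> R"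
        using norm_ge_zero[of "bc (eta1 s)"] norm_ge_zero[of "bc (r1 s)"] norm_ge_zero[of "bc (u1 s)"]
          norm_ge_zero[of "bc (eta2 s)"] norm_ge_zero[of "bc (r2 s)"] norm_ge_zero[of "bc (u2 s)"] by linarith
    qed
  qed
  have R0: "0 \<le> R" using R[OF t] norm_ge_zero order_trans by blast
  have Dle: "norm (bc (eta1 s) - bc (eta2 s)) \<le> D s" "norm (bc (r1 s) - bc (r2 s)) \<le> D s" "norm (bc (u1 s) - bc (u2 s)) \<le> D s" for s
    by (auto simp: D_def)
  \<comment> \<open>Zero triples fill the slots \<open>Q\<close> and \<open>P\<close> of the
    Lipschitz lemmas, on which \<open>Fe\<close>, \<open>Fr\<close> and \<open>pot\<close> do not
    depend.\<close>
  have D0: "norm (0 - 0 :: real \<Rightarrow>\<^sub>C triple) \<le> D s" "norm (0 :: real \<Rightarrow>\<^sub>C triple) \<le> R" for s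
    using R0 by (auto simp: D_def)
  define Ke where "Ke = Z.op_bound * (1 + 2 * R)"
  define Kr where "Kr = Z.op_bound * (1 + 2 * R) + 1 / b * (1 + 2 * R)"
  define Ku where "Ku = \<bar>c\<bar> * parts_const b + Z.op_bound * (1 + R)"
  define E1 where "E1 s = Z.Fe (bc (eta1 s)) (bc (u1 s))" for s
  define E2 where "E2 s = Z.Fe (bc (eta2 s)) (bc (u2 s))" for s
  define Q1 where "Q1 s = Z.Fr (bc (eta1 s)) (bc (u1 s))" for s
  define Q2 where "Q2 s = Z.Fr (bc (eta2 s)) (bc (u2 s))" for s
  have cE: "continuous_on {0..S} E1" "continuous_on {0..S} E2" "continuous_on {0..S} Q1" "continuous_on {0..S} Q2"
    unfolding E1_def E2_def Q1_def Q2_def by (intro Z.continuous_on_F rq1 rq2 u1 u2)+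
  have lipE: "norm (E1 s - E2 s) \<le> Ke * D s" "norm (Q1 s - Q2 s) \<le> Kr * D s" if "s \<in> {0..S}" for s
  proof -
    have n: "norm (bc (eta1 s)) \<le> R" "norm (bc (r1 s)) \<le> R" "norm (bc (u1 s)) \<le> R"
      "norm (bc (eta2 s)) \<le> R" "norm (bc (r2 s)) \<le> R" "norm (bc (u2 s)) \<le> R" using R[OF that] by auto
    show "norm (E1 s - E2 s) \<le> Ke * D s" "norm (Q1 s - Q2 s) \<le> Kr * D s"
      using Z.Fe_lip[OF R0 n(1,2,3) D0(2) n(4,5,6) Dle(1,2,3) D0(1) D0(1)]
        Z.Fr_lip[OF R0 n(1,2,3) D0(2) n(4,5,6) Dle(1,2,3) D0(1) D0(1)]
      by (simp_all add: E1_def E2_def Q1_def Q2_def Ke_def Kr_def algebra_simps)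
  qed
  have intb: "norm (integral {0..t} f) \<le> K * integral {0..t} D"
    if "t \<in> {0..S}" "continuous_on {0..S} f" "\<And>s. s \<in> {0..S} \<Longrightarrow> norm (f s) \<le> K * D s" for t K and f :: "real \<Rightarrow> 'z::banach"
  proof -
    have sub: "{0..t} \<subseteq> {0..S}" using that by auto
    have "norm (integral {0..t} f) \<le> integral {0..t} (\<lambda>s. K * D s)"
      using sub that(3) by (intro integral_norm_bound_integral integrable_continuous_real continuous_intros
        continuous_on_subset[OF that(2) sub] continuous_on_subset[OF cD sub]) auto
    then show ?thesis by simp
  qed
  have eta_eq: "eta t x = lifting b eta0 h1 h2 t x + apply_bcontfun (integral {0..t} (\<lambda>s. Z.Fe (bc (eta s)) (bc (u s)))) x"
    if sol: "solves_system b c S h1 h2 v1 v2 eta0 u0 eta u" and t: "t \<in> {0..S}" and x: "x \<in> {-1..1}"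
      and ce: "continuous_on {0..S} (\<lambda>t. bc (eta t))" and cu: "continuous_on {0..S} (\<lambda>t. bc (u t))"
      and e: "\<And>t. t \<in> {0..S} \<Longrightarrow> continuous_on {-1..1} (eta t)" and u: "\<And>t. t \<in> {0..S} \<Longrightarrow> continuous_on {-1..1} (u t)"
    for eta u t x
  proof -
    have sub: "{0..t} \<subseteq> {0..S}" using t by auto
    have "(LBINT s:{0..t}. A_D b (\<lambda>y. u s y + eta s y * u s y) x) = (LBINT s:{0..t}. apply_bcontfun (Z.Fe (bc (eta s)) (bc (u s))) x)"
    proof (rule set_lebesgue_integral_cong, simp, intro allI impI)
      fix s assume "s \<in> {0..t}"
      then have s: "s \<in> {0..S}" using sub by auto
      show "A_D b (\<lambda>y. u s y + eta s y * u s y) x = apply_bcontfun (Z.Fe (bc (eta s)) (bc (u s))) x"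
        unfolding Z.Fe_eq_A_D[OF x] by (rule A_D_cong) (use bc_apply_in[OF e[OF s]] bc_apply_in[OF u[OF s]] in auto)
    qed
    also have "\<dots> = apply_bcontfun (integral {0..t} (\<lambda>s. Z.Fe (bc (eta s)) (bc (u s)))) x"
      by (intro LBINT_apply_bcontfun Z.continuous_on_F continuous_on_subset[OF ce sub] continuous_on_subset[OF cu sub])
    finally show ?thesis using sol t x by (simp add: solves_system_def)
  qed
  have eta_c: "continuous_on {-1..1} (eta1 t)" "continuous_on {-1..1} (eta2 t)" "continuous_on {-1..1} (r1 t)" "continuous_on {-1..1} (r2 t)"
    if "t \<in> {0..S}" for t
    using ac_continuous[OF rq1(1)[OF that]] ac_continuous[OF rq2(1)[OF that]] ac_continuous[OF rq1(2)[OF that]] ac_continuous[OF rq2(2)[OF that]] .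
  have deta: "eta1 t x - eta2 t x = apply_bcontfun (integral {0..t} (\<lambda>s. E1 s - E2 s)) x" if t: "t \<in> {0..S}" and x: "x \<in> {-1..1}" for t x
  proof -
    have sub: "{0..t} \<subseteq> {0..S}" using t by auto
    have "integral {0..t} (\<lambda>s. E1 s - E2 s) = integral {0..t} E1 - integral {0..t} E2"
      by (intro Henstock_Kurzweil_Integration.integral_diff integrable_continuous_real continuous_on_subset[OF cE(1) sub] continuous_on_subset[OF cE(2) sub])
    then show ?thesis
      using eta_eq[OF s1 t x rq1(4) u1(2) eta_c(1) u1(1)] eta_eq[OF s2 t x rq2(4) u2(2) eta_c(2) u2(1)]
      by (simp add: E1_def[abs_def] E2_def[abs_def])
  qed
  \<comment> \<open>In the difference of two solutions the lifting cancels, so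
    \<open>E1 - E2\<close> integrates to the difference of the \<eta> components. Its density in
    \<open>x\<close> is both \<open>r1 - r2\<close> and the time integral of \<open>Q1 - Q2\<close>;
    both are continuous, hence equal at every point.\<close>
  have dr: "r1 t x - r2 t x = apply_bcontfun (integral {0..t} (\<lambda>s. Q1 s - Q2 s)) x" if t: "t \<in> {0..S}" and x: "x \<in> {-1..1}" for t x
  proof -
    have sub: "{0..t} \<subseteq> {0..S}" using t by auto
    have cs: "continuous_on {0..t} (\<lambda>s. E1 s - E2 s)" "continuous_on {0..t} (\<lambda>s. Q1 s - Q2 s)"
      by (intro continuous_intros continuous_on_subset[OF cE(1) sub] continuous_on_subset[OF cE(2) sub] continuous_on_subset[OF cE(3) sub] continuous_on_subset[OF cE(4) sub])+
    have "Z.acC (integral {0..t} (\<lambda>s. E1 s - E2 s)) (integral {0..t} (\<lambda>s. third (Q1 s - Q2 s)))"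
      unfolding third_simps
      by (intro Z.acC_integral cs(1) continuous_intros continuous_on_subset[OF cE(3) sub] continuous_on_subset[OF cE(4) sub])
        (auto simp: E1_def E2_def Q1_def Q2_def intro!: Z.acC_diff Z.Fe_acC)
    then have a: "ac (apply_bcontfun (integral {0..t} (\<lambda>s. E1 s - E2 s))) (apply_bcontfun (integral {0..t} (\<lambda>s. Q1 s - Q2 s)))"
      unfolding integral_third[OF cs(2)] Z.acC_third .
    have "ac (\<lambda>x. eta1 t x - eta2 t x) (\<lambda>x. r1 t x - r2 t x)"
      by (intro ac_diff rq1 rq2 t)
    then have "ac (apply_bcontfun (integral {0..t} (\<lambda>s. E1 s - E2 s))) (\<lambda>x. r1 t x - r2 t x)"
      by (rule ac_cong) (use deta[OF t] in auto)
    from ac_unique_continuous[OF this a _ _ x] show ?thesis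
      using eta_c[OF t] by (auto intro!: continuous_intros)
  qed
  have be: "norm (bc (eta1 t) - bc (eta2 t)) \<le> Ke * integral {0..t} D" if t: "t \<in> {0..S}" for t
  proof (rule bc_diff_norm_le[OF eta_c(1,2)[OF t]])
    fix x :: real assume x: "x \<in> {-1..1}"
    have "\<bar>eta1 t x - eta2 t x\<bar> \<le> norm (integral {0..t} (\<lambda>s. E1 s - E2 s))"
      unfolding deta[OF t x] using norm_bounded[of _ x] by (metis real_norm_def)
    also have "\<dots> \<le> Ke * integral {0..t} D" by (intro intb t continuous_intros cE lipE)
    finally show "\<bar>eta1 t x - eta2 t x\<bar> \<le> Ke * integral {0..t} D" .
  qed
  have br: "norm (bc (r1 t) - bc (r2 t)) \<le> Kr * integral {0..t} D" if t: "t \<in> {0..S}" for t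
  proof (rule bc_diff_norm_le[OF eta_c(3,4)[OF t]])
    fix x :: real assume x: "x \<in> {-1..1}"
    have "\<bar>r1 t x - r2 t x\<bar> \<le> norm (integral {0..t} (\<lambda>s. Q1 s - Q2 s))"
      unfolding dr[OF t x] using norm_bounded[of _ x] by (metis real_norm_def)
    also have "\<dots> \<le> Kr * integral {0..t} D" by (intro intb t continuous_intros cE lipE)
    finally show "\<bar>r1 t x - r2 t x\<bar> \<le> Kr * integral {0..t} D" .
  qed
  define pot1 where "pot1 s = Z.pot (bc (eta1 s)) (bc (u1 s))" for s
  define pot2 where "pot2 s = Z.pot (bc (eta2 s)) (bc (u2 s))" for s
  have cpot: "continuous_on {0..S} pot1" "continuous_on {0..S} pot2"
    unfolding pot1_def pot2_def by (intro Z.continuous_on_F rq1 rq2 u1 u2)+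
  have u_eq: "u t x = lifting b u0 v1 v2 t x + integral {0..t} (\<lambda>s. c * A_D b (q s) x + apply_bcontfun (Z.oA (third (Z.pot (bc (eta s)) (bc (u s))))) x)"
    and u_cont: "continuous_on {0..S} (\<lambda>s. c * A_D b (q s) x + apply_bcontfun (Z.oA (third (Z.pot (bc (eta s)) (bc (u s))))) x)"
    if sol: "solves_system b c S h1 h2 v1 v2 eta0 u0 eta u" and t: "t \<in> {0..S}" and x: "x \<in> {-1..1}"
      and ce: "continuous_on {0..S} (\<lambda>t. bc (eta t))" and cr: "continuous_on {0..S} (\<lambda>t. bc (r t))" and cu: "continuous_on {0..S} (\<lambda>t. bc (u t))"
      and e: "\<And>t. t \<in> {0..S} \<Longrightarrow> ac (eta t) (r t)" "\<And>t. t \<in> {0..S} \<Longrightarrow> ac (r t) (q t)" "\<And>t. t \<in> {0..S} \<Longrightarrow> q t \<in> L2w mu"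
      and u: "\<And>t. t \<in> {0..S} \<Longrightarrow> continuous_on {-1..1} (u t)"
    for eta u r q t x
  proof -
    let ?g = "\<lambda>s. c * A_D b (q s) x + apply_bcontfun (Z.oA (third (Z.pot (bc (eta s)) (bc (u s))))) x"
    have Lq: "L1 (q s)" if "s \<in> {0..S}" for s by (rule acD(1)[OF e(2)[OF that]])
    \<comment> \<open>The second derivatives \<open>q s\<close> come from separate choices at each
      time and are not known to be continuous in sup norm. The integrated-by-parts bound expresses
      \<open>A_D\<close> of their differences through \<open>r\<close>, which is; this makes the
      time integral of the first summand legitimate.\<close>
    have cA: "continuous_on {0..S} (\<lambda>s. A_D b (q s) x)"
      unfolding continuous_on_def
    proof
      fix t assume t: "t \<in> {0..S}"
      have "((\<lambda>s. A_D b (q s) x - A_D b (q t) x) \<longlongrightarrow> 0) (at t within {0..S})"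
      proof (rule Lim_null_comparison)
        have "((\<lambda>s. bc (r s) - bc (r t)) \<longlongrightarrow> 0) (at t within {0..S})"
          using cr t by (simp add: continuous_on_def LIM_zero_iff)
        then show "((\<lambda>s. parts_const b * norm (bc (r s) - bc (r t))) \<longlongrightarrow> 0) (at t within {0..S})"
          by (intro tendsto_mult_right_zero tendsto_norm_zero)
        show "\<forall>\<^sub>F s in at t within {0..S}. norm (A_D b (q s) x - A_D b (q t) x) \<le> parts_const b * norm (bc (r s) - bc (r t))"
          unfolding eventually_at_filter
        proof (rule always_eventually, intro allI impI)
          fix s assume "s \<in> {0..S}"
          note s = this
          have "A_D b (q s) x - A_D b (q t) x = A_D b (\<lambda>y. q s y - q t y) x"
            using A_D_linear[OF b Lq[OF t] Lq[OF s] x, of "-1"] by simp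
          also have "\<bar>\<dots>\<bar> \<le> parts_const b * norm (bc (r s) - bc (r t))"
          proof (rule A_D_deriv_bound[OF b ac_diff[OF e(2)[OF s] e(2)[OF t]] x])
            fix y :: real assume y: "y \<in> {-1..1}"
            show "\<bar>r s y - r t y\<bar> \<le> norm (bc (r s) - bc (r t))"
              using norm_bounded[of "bc (r s) - bc (r t)" y]
              by (simp add: bc_apply_in[OF ac_continuous[OF e(2)[OF s]] y] bc_apply_in[OF ac_continuous[OF e(2)[OF t]] y])
          qed
          finally show "norm (A_D b (q s) x - A_D b (q t) x) \<le> parts_const b * norm (bc (r s) - bc (r t))" by simp
        qed
      qed
      then show "((\<lambda>s. A_D b (q s) x) \<longlongrightarrow> A_D b (q t) x) (at t within {0..S})"
        by (simp add: LIM_zero_iff)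
    qed
    have cO: "continuous_on {0..S} (\<lambda>s. apply_bcontfun (Z.oA (third (Z.pot (bc (eta s)) (bc (u s))))) x)"
      by (intro bounded_linear.continuous_on[OF bounded_linear_apply_bcontfun] Z.continuous_on_op continuous_on_third Z.continuous_on_F ce cu)
    show cg: "continuous_on {0..S} ?g"
      by (intro continuous_intros cA cO)
    have sub: "{0..t} \<subseteq> {0..S}" using t by auto
    have "(LBINT s:{0..t}. A_D b (\<lambda>y. c * wderiv (wderiv (eta s)) y + eta s y + (u s y)\<^sup>2 / 2) x) = (LBINT s:{0..t}. ?g s)"
    proof (rule set_lebesgue_integral_cong, simp, intro allI impI)
      fix s assume "s \<in> {0..t}"
      then have s: "s \<in> {0..S}" using sub by auto
      note ec = ac_continuous[OF e(1)[OF s]]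
      note w = wderiv_wderiv_AE_eq[OF e(1)[OF s] e(2)[OF s]]
      have Lw: "L1 (wderiv (wderiv (eta s)))"
        by (rule L2w_imp_L1[OF mu(2)]) (rule wderiv_L2w(1)[OF w(1) e(3)[OF s]])
      have Lp: "L1 (\<lambda>y. eta s y + (u s y)\<^sup>2 / 2)"
        by (intro L1_continuous continuous_intros ec u[OF s]) auto
      have "A_D b (\<lambda>y. c * wderiv (wderiv (eta s)) y + eta s y + (u s y)\<^sup>2 / 2) x
        = c * A_D b (wderiv (wderiv (eta s))) x + A_D b (\<lambda>y. eta s y + (u s y)\<^sup>2 / 2) x"
        using A_D_linear[OF b Lw Lp x, of c] by (simp add: add.assoc)
      also have "A_D b (wderiv (wderiv (eta s))) x = A_D b (q s) x"
        by (rule A_D_cong_AE[OF b Lw Lq[OF s] _ x]) (use w(2) in \<open>eventually_elim, auto\<close>)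
      also have "A_D b (\<lambda>y. eta s y + (u s y)\<^sup>2 / 2) x = apply_bcontfun (Z.oA (third (Z.pot (bc (eta s)) (bc (u s))))) x"
        unfolding Z.opA_eq_A_D[OF b x]
        by (rule A_D_cong) (use bc_apply_in[OF ec] bc_apply_in[OF u[OF s]] in \<open>auto simp: pr_simps Z.pot_def power2_eq_square\<close>)
      finally show "A_D b (\<lambda>y. c * wderiv (wderiv (eta s)) y + eta s y + (u s y)\<^sup>2 / 2) x = ?g s" .
    qed
    also have "\<dots> = integral {0..t} ?g"
      by (rule set_borel_integral_eq_integral(2)[OF borel_integrable_atLeastAtMost'[OF continuous_on_subset[OF cg sub]]])
    finally show "u t x = lifting b u0 v1 v2 t x + integral {0..t} ?g"
      using sol t x by (simp add: solves_system_def)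
  qed
  have bu: "norm (bc (u1 t) - bc (u2 t)) \<le> Ku * integral {0..t} D" if t: "t \<in> {0..S}" for t
  proof (rule bc_diff_norm_le[OF u1(1)[OF t] u2(1)[OF t]])
    fix x :: real assume x: "x \<in> {-1..1}"
    let ?g1 = "\<lambda>s. c * A_D b (q1 s) x + apply_bcontfun (Z.oA (third (Z.pot (bc (eta1 s)) (bc (u1 s))))) x"
    let ?g2 = "\<lambda>s. c * A_D b (q2 s) x + apply_bcontfun (Z.oA (third (Z.pot (bc (eta2 s)) (bc (u2 s))))) x"
    have sub: "{0..t} \<subseteq> {0..S}" using t by auto
    note eq1 = u_eq[OF s1 t x rq1(4,5) u1(2) rq1(1,2,3) u1(1)] and eq2 = u_eq[OF s2 t x rq2(4,5) u2(2) rq2(1,2,3) u2(1)]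
    have cg1: "continuous_on {0..S} ?g1" by (rule u_cont[OF s1 t x rq1(4,5) u1(2) rq1(1,2,3) u1(1)])
    have cg2: "continuous_on {0..S} ?g2" by (rule u_cont[OF s2 t x rq2(4,5) u2(2) rq2(1,2,3) u2(1)])
    have A: "u1 t x - u2 t x = integral {0..t} (\<lambda>s. ?g1 s - ?g2 s)"
      using eq1 eq2 Henstock_Kurzweil_Integration.integral_diff[OF
        integrable_continuous_real[OF continuous_on_subset[OF cg1 sub]] integrable_continuous_real[OF continuous_on_subset[OF cg2 sub]]]
      by linarith
    have B: "norm (integral {0..t} (\<lambda>s. ?g1 s - ?g2 s)) \<le> Ku * integral {0..t} D"
    proof (rule intb[OF t])
      show "continuous_on {0..S} (\<lambda>s. ?g1 s - ?g2 s)" by (rule continuous_on_diff[OF cg1 cg2])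
      fix s assume s: "s \<in> {0..S}"
      have n: "norm (bc (eta1 s)) \<le> R" "norm (bc (r1 s)) \<le> R" "norm (bc (u1 s)) \<le> R"
        "norm (bc (eta2 s)) \<le> R" "norm (bc (r2 s)) \<le> R" "norm (bc (u2 s)) \<le> R" using R[OF s] by auto
      have "A_D b (q1 s) x - A_D b (q2 s) x = A_D b (\<lambda>y. q1 s y - q2 s y) x"
        using A_D_linear[OF b acD(1)[OF rq2(2)[OF s]] acD(1)[OF rq1(2)[OF s]] x, of "-1"] by simp
      also have "\<bar>\<dots>\<bar> \<le> parts_const b * D s"
      proof (rule A_D_deriv_bound[OF b ac_diff[OF rq1(2)[OF s] rq2(2)[OF s]] x])
        fix y :: real assume y: "y \<in> {-1..1}"
        have "\<bar>r1 s y - r2 s y\<bar> \<le> norm (bc (r1 s) - bc (r2 s))"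
          using norm_bounded[of "bc (r1 s) - bc (r2 s)" y]
          by (simp add: bc_apply_in[OF eta_c(3)[OF s] y] bc_apply_in[OF eta_c(4)[OF s] y])
        then show "\<bar>r1 s y - r2 s y\<bar> \<le> D s" using Dle(2)[of s] by linarith
      qed
      finally have 1: "\<bar>A_D b (q1 s) x - A_D b (q2 s) x\<bar> \<le> parts_const b * D s" .
      have "\<bar>apply_bcontfun (Z.oA (third (pot1 s))) x - apply_bcontfun (Z.oA (third (pot2 s))) x\<bar>
        \<le> norm (Z.oA (third (pot1 s)) - Z.oA (third (pot2 s)))"
        using norm_bounded[of "Z.oA (third (pot1 s)) - Z.oA (third (pot2 s))" x] by simp
      also have "\<dots> \<le> Z.op_bound * ((1 + R) * D s)"
        unfolding pot1_def pot2_def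
        by (intro order_trans[OF Z.op_diff_norm(1)] mult_left_mono Z.op_bound_nonneg order_trans[OF Z.norm_third_diff]
          Z.pot_lip[OF R0 n(1,2,3) D0(2) n(4,5,6) Dle(1,2,3) D0(1) D0(1)])
      finally have 2: "\<bar>apply_bcontfun (Z.oA (third (pot1 s))) x - apply_bcontfun (Z.oA (third (pot2 s))) x\<bar> \<le> Z.op_bound * ((1 + R) * D s)" .
      have "\<bar>?g1 s - ?g2 s\<bar> = \<bar>c * (A_D b (q1 s) x - A_D b (q2 s) x) + (apply_bcontfun (Z.oA (third (pot1 s))) x - apply_bcontfun (Z.oA (third (pot2 s))) x)\<bar>"
        by (simp add: pot1_def pot2_def algebra_simps)
      also have "\<dots> \<le> \<bar>c\<bar> * (parts_const b * D s) + Z.op_bound * ((1 + R) * D s)"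
        by (intro order_trans[OF abs_triangle_ineq] add_mono 2) (simp add: abs_mult mult_left_mono 1)
      also have "\<dots> = Ku * D s" by (simp add: Ku_def algebra_simps)
      finally show "norm (?g1 s - ?g2 s) \<le> Ku * D s" by (simp only: real_norm_def)
    qed
    show "\<bar>u1 t x - u2 t x\<bar> \<le> Ku * integral {0..t} D"
      unfolding A using B by (simp only: real_norm_def)
  qed
  have "D t \<le> 0"
  proof (rule gronwall_zero[OF cD _ _ t])
    show "D t \<le> (Ke + Kr + Ku) * integral {0..t} D" if "t \<in> {0..S}" for t
      using be[OF that] br[OF that] bu[OF that] by (simp add: D_def distrib_right)
    show "0 \<le> Ke + Kr + Ku"
      unfolding Ke_def Kr_def Ku_def using R0 b Z.op_bound_nonneg parts_const_nonneg[OF b]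
      by (intro add_nonneg_nonneg mult_nonneg_nonneg) auto
  qed
  then have "norm (bc (eta1 t) - bc (eta2 t)) = 0" "norm (bc (u1 t) - bc (u2 t)) = 0"
    using norm_ge_zero[of "bc (eta1 t) - bc (eta2 t)"] norm_ge_zero[of "bc (r1 t) - bc (r2 t)"] norm_ge_zero[of "bc (u1 t) - bc (u2 t)"]
    unfolding D_def by linarith+
  then have "bc (eta1 t) = bc (eta2 t)" "bc (u1 t) = bc (u2 t)" by simp_all
  then show ?thesis
    using bc_apply_in[OF eta_c(1)[OF t] x] bc_apply_in[OF eta_c(2)[OF t] x] bc_apply_in[OF u1(1)[OF t] x] bc_apply_in[OF u2(1)[OF t] x]
    by simp
qed

end

section \<open>Local well-posedness\<close>

definition C1_bounded :: "real \<Rightarrow> (real \<Rightarrow> real) \<Rightarrow> (real \<Rightarrow> real) \<Rightarrow> real \<Rightarrow> bool" where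
  "C1_bounded S h1 h2 M \<longleftrightarrow> (\<exists>h1' h2'.
    (\<forall>t\<in>{0..S}. (h1 has_real_derivative h1' t) (at t within {0..S}) \<and> (h2 has_real_derivative h2' t) (at t within {0..S})
      \<and> \<bar>h1' t\<bar> \<le> M \<and> \<bar>h2' t\<bar> \<le> M) \<and> continuous_on {0..S} h1' \<and> continuous_on {0..S} h2')"

text \<open>The implication is under the existential quantifier, so that a number \<open>M\<close>
  is available before it is known whether the boundary data are differentiable. It depends only on
  \<open>S\<close> and the boundary data.\<close>

lemma C1_interval_pair_bounded: "\<exists>M. C1_interval S h1 \<and> C1_interval S h2 \<longrightarrow> C1_bounded S h1 h2 M"
proof (cases "C1_interval S h1 \<and> C1_interval S h2")
  case True
  obtain h1' M1 where 1: "\<And>t. t \<in> {0..S} \<Longrightarrow> (h1 has_real_derivative h1' t) (at t within {0..S})" "continuous_on {0..S} h1'"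
    "\<And>t. t \<in> {0..S} \<Longrightarrow> \<bar>h1' t\<bar> \<le> M1" using C1_interval_bound True by metis
  obtain h2' M2 where 2: "\<And>t. t \<in> {0..S} \<Longrightarrow> (h2 has_real_derivative h2' t) (at t within {0..S})" "continuous_on {0..S} h2'"
    "\<And>t. t \<in> {0..S} \<Longrightarrow> \<bar>h2' t\<bar> \<le> M2" using C1_interval_bound True by metis
  have "C1_bounded S h1 h2 (max M1 M2)"
    unfolding C1_bounded_def using 1 2 by (intro exI[of _ h1'] exI[of _ h2']) (auto simp: le_max_iff_disj)
  then show ?thesis by blast
qed auto

lemma norm_const_bcontfun_le: "norm (const_bcontfun v :: real \<Rightarrow>\<^sub>C 'b::real_normed_vector) \<le> norm v"
  by (rule norm_bound) simp

lemma norm_third_ge: "norm f \<le> norm (third f)"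
proof (rule norm_bound)
  fix x
  have "norm (apply_bcontfun f x) = norm (apply_bcontfun (third f) x)" by (simp add: norm_Pair)
  also have "\<dots> \<le> norm (third f)" by (rule norm_bounded)
  finally show "norm (apply_bcontfun f x) \<le> norm (third f)" .
qed

text \<open>\<open>Y\<close> bounds the time derivative as a function of the bound \<open>M\<close>
  for the derivatives of the boundary data, since existence of a time derivative is conditional on
  them.\<close>

definition regular_solution ::
  "real \<Rightarrow> nat \<Rightarrow> real \<Rightarrow> (real \<Rightarrow> real) \<Rightarrow> (real \<Rightarrow> real) \<Rightarrow> (real \<Rightarrow> real \<Rightarrow> real) \<Rightarrow> real \<Rightarrow> (real \<Rightarrow> real) \<Rightarrow> bool" where
  "regular_solution mu k S h1 h2 f X Y \<longleftrightarrow> f \<in> CHw mu k S \<and> CHw_norm mu k S f \<le> X \<and>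
    (\<forall>M. C1_bounded S h1 h2 M \<longrightarrow> (\<exists>ft\<in>CHw mu k S. has_time_deriv mu k S f ft \<and> CHw_norm mu k S ft \<le> Y M))"

text \<open>\<open>G\<close> is the chart constant, \<open>N\<close> bounds the initial value,
  \<open>M * l\<close> the boundary lift and \<open>S * B\<close> the integral of a vector field
  bounded by \<open>B\<close>.\<close>

definition evolution_bound :: "real \<Rightarrow> real \<Rightarrow> real \<Rightarrow> real \<Rightarrow> real \<Rightarrow> real \<Rightarrow> real" where
  "evolution_bound G N l S M B = G * (N + M * l + S * B)"

definition evolution_rate :: "real \<Rightarrow> real \<Rightarrow> real \<Rightarrow> real \<Rightarrow> real" where
  "evolution_rate G l B M = G * (M * l + B)"

text \<open>A linear parametrisation of part of \<open>H\<^sup>k\<^sub>w\<close> by a closed subspace \<open>V\<close> of a Banach space; all limits in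
  \<open>H\<^sup>k\<^sub>w\<close> are taken upstairs, so completeness of \<open>H\<^sup>k\<^sub>w\<close> is never needed.\<close>

locale Hw_chart = weight_exponent +
  fixes V :: "'x::banach set" and ev :: "'x \<Rightarrow> real \<Rightarrow> real" and k :: nat and G :: real
  assumes V_add: "z \<in> V \<Longrightarrow> w \<in> V \<Longrightarrow> z + w \<in> V"
    and V_scale: "z \<in> V \<Longrightarrow> a *\<^sub>R z \<in> V"
    and V_integral: "continuous_on {0..t} f \<Longrightarrow> (\<And>s. s \<in> {0..t} \<Longrightarrow> f s \<in> V) \<Longrightarrow> integral {0..t::real} f \<in> V"
    and ev_diff: "ev (z - w) = (\<lambda>x. ev z x - ev w x)"
    and ev_scale: "ev (a *\<^sub>R z) = (\<lambda>x. a * ev z x)"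
    and ev_Hw: "z \<in> V \<Longrightarrow> ev z \<in> Hw mu k"
    and ev_norm: "z \<in> V \<Longrightarrow> Hw_norm mu k (ev z) \<le> G * norm z"
    and G_nonneg: "0 \<le> G"
begin

lemma V_diff: "z \<in> V \<Longrightarrow> w \<in> V \<Longrightarrow> z - w \<in> V"
  using V_add[OF _ V_scale[of w "-1"]] by simp

lemma tendsto_ev_zero:
  assumes "\<And>s. s \<in> A \<Longrightarrow> z s \<in> V" "((\<lambda>s. norm (z s)) \<longlongrightarrow> 0) (at t within A)"
    and "\<And>s. s \<in> A \<Longrightarrow> F s = ev (z s)"
  shows "((\<lambda>s. Hw_norm mu k (F s)) \<longlongrightarrow> 0) (at t within A)"
proof (rule tendsto_sandwich[OF _ _ tendsto_const])
  show "((\<lambda>s. G * norm (z s)) \<longlongrightarrow> 0) (at t within A)"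
    by (rule tendsto_mult_right_zero[OF assms(2)])
  show "\<forall>\<^sub>F s in at t within A. Hw_norm mu k (F s) \<le> G * norm (z s)"
    using assms(1,3) ev_norm by (auto simp: eventually_at_filter)
qed (simp add: Hw_norm_def sum_nonneg)

lemma CHw_intro:
  assumes "continuous_on {0..S} z" "\<And>t. t \<in> {0..S} \<Longrightarrow> z t \<in> V" "\<And>t. t \<in> {0..S} \<Longrightarrow> f t = ev (z t)"
  shows "f \<in> CHw mu k S"
  unfolding CHw_def
proof (intro CollectI ballI conjI)
  fix t assume t: "t \<in> {0..S}"
  show "f t \<in> Hw mu k" using ev_Hw assms(2,3) t by simp
  have "((\<lambda>s. norm (z s - z t)) \<longlongrightarrow> 0) (at t within {0..S})"
    using assms(1) t by (simp add: continuous_on_def LIM_zero_iff tendsto_norm_zero_iff)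
  then show "((\<lambda>s. Hw_norm mu k (\<lambda>x. f s x - f t x)) \<longlongrightarrow> 0) (at t within {0..S})"
    by (rule tendsto_ev_zero[rotated]) (use assms t V_diff ev_diff in auto)
qed

lemma time_deriv_intro:
  assumes "\<And>t. t \<in> {0..S} \<Longrightarrow> (z has_vector_derivative z' t) (at t within {0..S})"
    "\<And>t. t \<in> {0..S} \<Longrightarrow> z t \<in> V" "\<And>t. t \<in> {0..S} \<Longrightarrow> z' t \<in> V" "\<And>t. t \<in> {0..S} \<Longrightarrow> f t = ev (z t)"
  shows "has_time_deriv mu k S f (\<lambda>t. ev (z' t))"
  unfolding has_time_deriv_def
proof (intro ballI conjI)
  fix t assume t: "t \<in> {0..S}"
  show "ev (z' t) \<in> Hw mu k" using ev_Hw assms(3) t by simp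
  show "((\<lambda>s. Hw_norm mu k (\<lambda>x. (f s x - f t x) / (s - t) - ev (z' t) x)) \<longlongrightarrow> 0) (at t within {0..S})"
  proof (rule tendsto_ev_zero[OF _ has_vector_derivative_quotient[OF assms(1)[OF t]]])
    fix s assume s: "s \<in> {0..S}"
    show "(1 / (s - t)) *\<^sub>R (z s - z t) - z' t \<in> V"
      using assms(2,3) s t by (intro V_diff V_scale)
    show "(\<lambda>x. (f s x - f t x) / (s - t) - ev (z' t) x) = ev ((1 / (s - t)) *\<^sub>R (z s - z t) - z' t)"
      using assms(4) s t by (simp add: ev_diff ev_scale)
  qed
qed

lemma CHw_norm_le:
  assumes "0 \<le> S" "\<And>t. t \<in> {0..S} \<Longrightarrow> z t \<in> V \<and> f t = ev (z t) \<and> norm (z t) \<le> N"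
  shows "CHw_norm mu k S f \<le> G * N"
  unfolding CHw_norm_def
proof (rule cSUP_least)
  fix t assume "t \<in> {0..S}"
  note z = assms(2)[OF this]
  then have "Hw_norm mu k (f t) \<le> G * norm (z t)" using ev_norm by simp
  also have "\<dots> \<le> G * N" using z by (intro mult_left_mono G_nonneg) simp
  finally show "Hw_norm mu k (f t) \<le> G * N" .
qed (use assms(1) in auto)

text \<open>All estimates concern a curve in the Banach space: initial value, boundary increments
  times two fixed vectors, and an integral. The integral is always differentiable in time, so the
  curve is as smooth as the boundary data up to class C1.\<close>

lemma evolution_regular:
  assumes S: "0 \<le> S" and B: "0 \<le> B"
    and c: "continuous_on {0..S} f" and n: "\<And>s. s \<in> {0..S} \<Longrightarrow> norm (f s) \<le> B" and fV: "\<And>s. s \<in> {0..S} \<Longrightarrow> f s \<in> V"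
    and z0: "z0 \<in> V" "norm z0 \<le> N" and l: "l1 \<in> V" "l2 \<in> V"
    and h: "continuous_on {0..S} h1" "continuous_on {0..S} h2" "\<And>t. t \<in> {0..S} \<Longrightarrow> \<bar>h1 t - h1 0\<bar> \<le> M" "\<And>t. t \<in> {0..S} \<Longrightarrow> \<bar>h2 t - h2 0\<bar> \<le> M"
    and u: "\<And>t. t \<in> {0..S} \<Longrightarrow> u t = ev (z0 + ((h1 t - h1 0) *\<^sub>R l1 + (h2 t - h2 0) *\<^sub>R l2) + integral {0..t} f)"
  shows "regular_solution mu k S h1 h2 u (evolution_bound G N (norm l1 + norm l2) S M B) (evolution_rate G (norm l1 + norm l2) B)"
proof -
  define z where "z t = z0 + ((h1 t - h1 0) *\<^sub>R l1 + (h2 t - h2 0) *\<^sub>R l2) + integral {0..t} f" for t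
  have lift: "norm (p *\<^sub>R l1 + q *\<^sub>R l2) \<le> m * (norm l1 + norm l2)" if "\<bar>p\<bar> \<le> m" "\<bar>q\<bar> \<le> m" for p q m
    using that by (intro order_trans[OF norm_triangle_ineq]) (simp add: distrib_left add_mono mult_right_mono)
  have ct: "continuous_on {0..t} f" if "t \<in> {0..S}" for t
    using c continuous_on_subset[of "{0..S}" f "{0..t}"] that by auto
  have zV: "z t \<in> V" if t: "t \<in> {0..S}" for t
    unfolding z_def using t by (intro V_add V_scale z0 l V_integral ct[OF t] fV) auto
  have uz: "u t = ev (z t)" if "t \<in> {0..S}" for t using u[OF that] by (simp add: z_def)
  have cz: "continuous_on {0..S} z"
    unfolding z_def by (intro continuous_intros h indefinite_integral_continuous_1 integrable_continuous_real c)
  have "norm (z t) \<le> N + M * (norm l1 + norm l2) + S * B" if t: "t \<in> {0..S}" for t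
  proof -
    have "norm (integral {0..t} f) \<le> S * B"
      by (rule norm_integral_le[OF ct[OF t] n _ _ B]) (use t in auto)
    then show ?thesis
      unfolding z_def by (rule order_trans[OF norm_triangle_ineq add_mono[OF
        order_trans[OF norm_triangle_ineq add_mono[OF z0(2) lift[OF h(3)[OF t] h(4)[OF t]]]]]])
  qed
  then have "CHw_norm mu k S u \<le> evolution_bound G N (norm l1 + norm l2) S M B"
    unfolding evolution_bound_def by (intro CHw_norm_le[OF S, where z=z]) (use zV uz in auto)
  moreover have "\<exists>ut\<in>CHw mu k S. has_time_deriv mu k S u ut \<and> CHw_norm mu k S ut \<le> evolution_rate G (norm l1 + norm l2) B M'"
    if "C1_bounded S h1 h2 M'" for M'
  proof -
    obtain h1' h2' where h': "\<And>t. t \<in> {0..S} \<Longrightarrow> (h1 has_real_derivative h1' t) (at t within {0..S})"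
      "\<And>t. t \<in> {0..S} \<Longrightarrow> (h2 has_real_derivative h2' t) (at t within {0..S})" "continuous_on {0..S} h1'" "continuous_on {0..S} h2'"
      "\<And>t. t \<in> {0..S} \<Longrightarrow> \<bar>h1' t\<bar> \<le> M'" "\<And>t. t \<in> {0..S} \<Longrightarrow> \<bar>h2' t\<bar> \<le> M'"
      using \<open>C1_bounded S h1 h2 M'\<close> unfolding C1_bounded_def by blast
    define z' where "z' t = (h1' t *\<^sub>R l1 + h2' t *\<^sub>R l2) + f t" for t
    have z'V: "z' t \<in> V" if "t \<in> {0..S}" for t unfolding z'_def using that by (intro V_add V_scale l fV)
    have D: "(z has_vector_derivative z' t) (at t within {0..S})" if t: "t \<in> {0..S}" for t
    proof -
      have "((\<lambda>t. (h t - h 0) *\<^sub>R v) has_vector_derivative d *\<^sub>R v) (at t within {0..S})"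
        if "(h has_real_derivative d) (at t within {0..S})" for h d and v :: 'x
        using has_vector_derivative_scaleR[OF DERIV_diff[OF that DERIV_const[of "h 0"]] has_vector_derivative_const[of v]] by simp
      note d = this[OF h'(1)[OF t]] this[OF h'(2)[OF t]]
      show ?thesis
        using has_vector_derivative_add[OF has_vector_derivative_add[OF has_vector_derivative_const[of z0]
          has_vector_derivative_add[OF d]] integral_has_vector_derivative[OF c t]]
        by (simp add: z_def[abs_def] z'_def)
    qed
    have "norm (z' t) \<le> M' * (norm l1 + norm l2) + B" if t: "t \<in> {0..S}" for t
      unfolding z'_def by (rule order_trans[OF norm_triangle_ineq add_mono[OF lift[OF h'(5)[OF t] h'(6)[OF t]] n[OF t]]])
    then have "CHw_norm mu k S (\<lambda>t. ev (z' t)) \<le> evolution_rate G (norm l1 + norm l2) B M'"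
      unfolding evolution_rate_def by (intro CHw_norm_le[OF S, where z=z']) (use z'V in auto)
    moreover have "(\<lambda>t. ev (z' t)) \<in> CHw mu k S"
      by (rule CHw_intro[of S z']) (use z'V in \<open>auto simp: z'_def intro!: continuous_intros h' c\<close>)
    ultimately show ?thesis
      using time_deriv_intro[OF D zV z'V uz] by blast
  qed
  ultimately show ?thesis
    unfolding regular_solution_def using CHw_intro[OF cz zV uz] by blast
qed

end

section \<open>Charts for the first and second order Sobolev spaces\<close>

text \<open>The boundary lift together with its derivative, as a point of the chart space;
  \<open>lift2\<close> adds the second derivative, which is the lift divided by
  \<open>b\<close>.\<close>

definition lift1 :: "real \<Rightarrow> real \<Rightarrow> real \<Rightarrow> (real \<Rightarrow>\<^sub>C real) \<times> (real \<Rightarrow>\<^sub>C triple)" where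
  "lift1 b p q = (boundary_lift b (w2 b) (w1 b) p q, third (boundary_lift b (dw2 b) (dw1 b) p q))"

definition lift2 :: "real \<Rightarrow> real \<Rightarrow> real \<Rightarrow> (real \<Rightarrow>\<^sub>C real) \<times> (real \<Rightarrow>\<^sub>C real) \<times> (real \<Rightarrow>\<^sub>C triple)" where
  "lift2 b p q = (boundary_lift b (w2 b) (w1 b) p q, boundary_lift b (dw2 b) (dw1 b) p q, third ((1/b) *\<^sub>R boundary_lift b (w2 b) (w1 b) p q))"

definition lift1_mass :: "real \<Rightarrow> real" where "lift1_mass b = norm (lift1 b 1 0) + norm (lift1 b 0 1)"
definition lift2_mass :: "real \<Rightarrow> real" where "lift2_mass b = norm (lift2 b 1 0) + norm (lift2 b 0 1)"

lemma boundary_lift_decomp: "boundary_lift b a2 a1 p q = p *\<^sub>R boundary_lift b a2 a1 1 0 + q *\<^sub>R boundary_lift b a2 a1 0 1"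
  by (simp add: boundary_lift_def)

context sobolev_pairing begin

definition V1 :: "((real \<Rightarrow>\<^sub>C real) \<times> (real \<Rightarrow>\<^sub>C triple)) set" where
  "V1 = {(e, P). acC e P}"

definition V2 :: "((real \<Rightarrow>\<^sub>C real) \<times> (real \<Rightarrow>\<^sub>C real) \<times> (real \<Rightarrow>\<^sub>C triple)) set" where
  "V2 = {(e, r, Q). acC e (third r) \<and> acC r Q}"

lemma chart1:
  assumes "gK \<le> K"
  shows "Hw_chart mu V1 (\<lambda>z. apply_bcontfun (fst z)) 1 (2 * K)"
proof unfold_locales
  fix z w :: "(real \<Rightarrow>\<^sub>C real) \<times> (real \<Rightarrow>\<^sub>C triple)" and a t :: real
    and f :: "real \<Rightarrow> (real \<Rightarrow>\<^sub>C real) \<times> (real \<Rightarrow>\<^sub>C triple)"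
  show "z \<in> V1 \<Longrightarrow> w \<in> V1 \<Longrightarrow> z + w \<in> V1" "z \<in> V1 \<Longrightarrow> a *\<^sub>R z \<in> V1"
    by (auto simp: V1_def intro: acC_add acC_scale)
  assume c: "continuous_on {0..t} f" and V: "\<And>s. s \<in> {0..t} \<Longrightarrow> f s \<in> V1"
  note i = integrable_continuous_real[OF c]
  have "acC (integral {0..t} (\<lambda>s. fst (f s))) (integral {0..t} (\<lambda>s. snd (f s)))"
    by (intro acC_integral continuous_intros c) (use V in \<open>force simp: V1_def\<close>)
  then show "integral {0..t} f \<in> V1"
    using integral_linear[OF i bounded_linear_fst] integral_linear[OF i bounded_linear_snd]
    by (simp add: V1_def o_def split_beta)
next
  fix z :: "(real \<Rightarrow>\<^sub>C real) \<times> (real \<Rightarrow>\<^sub>C triple)" assume z: "z \<in> V1"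
  obtain e P where [simp]: "z = (e, P)" by (cases z)
  have a: "acC e P" using z by (simp add: V1_def)
  show "apply_bcontfun (fst z) \<in> Hw mu 1" using acC_Hw1(1)[OF a] by simp
  have "norm e + norm P \<le> 2 * norm z"
    using norm_fst_le[of e P] norm_snd_le[of P e] by simp
  then have "gK * (norm e + norm P) \<le> K * (2 * norm z)"
    using gK_nonneg assms by (intro mult_mono) auto
  then show "Hw_norm mu 1 (apply_bcontfun (fst z)) \<le> 2 * K * norm z"
    using acC_Hw1(2)[OF a] by simp
next
  show "0 \<le> 2 * K" using gK_nonneg assms by simp
qed auto

lemma chart2:
  assumes "gK \<le> K"
  shows "Hw_chart mu V2 (\<lambda>z. apply_bcontfun (fst z)) 2 (3 * K)"
proof unfold_locales
  fix z w :: "(real \<Rightarrow>\<^sub>C real) \<times> (real \<Rightarrow>\<^sub>C real) \<times> (real \<Rightarrow>\<^sub>C triple)" and a t :: real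
    and f :: "real \<Rightarrow> (real \<Rightarrow>\<^sub>C real) \<times> (real \<Rightarrow>\<^sub>C real) \<times> (real \<Rightarrow>\<^sub>C triple)"
  show "z \<in> V2 \<Longrightarrow> w \<in> V2 \<Longrightarrow> z + w \<in> V2" "z \<in> V2 \<Longrightarrow> a *\<^sub>R z \<in> V2"
    by (auto simp: V2_def third_simps intro: acC_add acC_scale)
  assume c: "continuous_on {0..t} f" and V: "\<And>s. s \<in> {0..t} \<Longrightarrow> f s \<in> V2"
  note i = integrable_continuous_real[OF c]
  have r: "continuous_on {0..t} (\<lambda>s. fst (snd (f s)))" by (intro continuous_intros c)
  have "acC (integral {0..t} (\<lambda>s. fst (f s))) (third (integral {0..t} (\<lambda>s. fst (snd (f s)))))"
    unfolding integral_third[OF r, symmetric]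
    by (intro acC_integral continuous_intros c) (use V in \<open>force simp: V2_def\<close>)
  moreover have "acC (integral {0..t} (\<lambda>s. fst (snd (f s)))) (integral {0..t} (\<lambda>s. snd (snd (f s))))"
    by (intro acC_integral continuous_intros c) (use V in \<open>force simp: V2_def\<close>)
  ultimately show "integral {0..t} f \<in> V2"
    using integral_linear[OF i bounded_linear_fst] integral_linear[OF i bounded_linear_fst_comp[OF bounded_linear_snd]]
      integral_linear[OF i bounded_linear_snd_comp[OF bounded_linear_snd]]
    by (simp add: V2_def o_def split_beta)
next
  fix z :: "(real \<Rightarrow>\<^sub>C real) \<times> (real \<Rightarrow>\<^sub>C real) \<times> (real \<Rightarrow>\<^sub>C triple)" assume z: "z \<in> V2"
  obtain e r Q where [simp]: "z = (e, r, Q)" by (cases z)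
  have a: "acC e (third r)" "acC r Q" using z by (simp_all add: V2_def)
  show "apply_bcontfun (fst z) \<in> Hw mu 2" using acC_Hw2(1)[OF a] by simp
  have "norm e + norm r + norm Q \<le> 3 * norm z"
    using norm_fst_le[of e "(r, Q)"] norm_snd_le[of "(r, Q)" e] norm_fst_le[of r Q] norm_snd_le[of Q r] by simp
  then have "gK * (norm e + norm r + norm Q) \<le> K * (3 * norm z)"
    using gK_nonneg assms by (intro mult_mono) auto
  then show "Hw_norm mu 2 (apply_bcontfun (fst z)) \<le> 3 * K * norm z"
    using acC_Hw2(2)[OF a] by simp
next
  show "0 \<le> 3 * K" using gK_nonneg assms by simp
qed auto

lemma evolution_Hw1:
  assumes "gK \<le> K" and b: "b > 0" and S: "0 \<le> S" and B: "0 \<le> B"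
    and c: "continuous_on {0..S} fe" "continuous_on {0..S} fP"
    and n: "\<And>s. s \<in> {0..S} \<Longrightarrow> norm (fe s) \<le> B" "\<And>s. s \<in> {0..S} \<Longrightarrow> norm (fP s) \<le> B"
    and a: "\<And>s. s \<in> {0..S} \<Longrightarrow> acC (fe s) (fP s)"
    and z0: "acC e0 P0" "norm e0 + norm P0 \<le> N"
    and h: "continuous_on {0..S} h1" "continuous_on {0..S} h2" "\<And>t. t \<in> {0..S} \<Longrightarrow> \<bar>h1 t - h1 0\<bar> \<le> M" "\<And>t. t \<in> {0..S} \<Longrightarrow> \<bar>h2 t - h2 0\<bar> \<le> M"
    and e: "\<And>t. t \<in> {0..S} \<Longrightarrow> e t = e0 + boundary_lift b (w2 b) (w1 b) (h1 t - h1 0) (h2 t - h2 0) + integral {0..t} fe"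
  shows "regular_solution mu 1 S h1 h2 (\<lambda>t. apply_bcontfun (e t))
    (evolution_bound (2 * K) N (lift1_mass b) S M (2 * B)) (evolution_rate (2 * K) (lift1_mass b) (2 * B))"
  unfolding lift1_mass_def
proof (rule Hw_chart.evolution_regular[OF chart1[OF assms(1)] S, where f="\<lambda>s. (fe s, fP s)" and ?z0.0="(e0, P0)"])
  show "lift1 b 1 0 \<in> V1" "lift1 b 0 1 \<in> V1"
    by (simp_all add: V1_def lift1_def boundary_lift_acC b)
  show "norm (e0, P0) \<le> N" by (rule order_trans[OF norm_Pair_le z0(2)])
  show "norm (fe s, fP s) \<le> 2 * B" if "s \<in> {0..S}" for s
    using norm_Pair_le[of "fe s" "fP s"] n[OF that] by simp
  fix t assume t: "t \<in> {0..S}"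
  have "continuous_on {0..t} (\<lambda>s. (fe s, fP s))"
    using t continuous_on_subset[of "{0..S}" _ "{0..t}"] by (intro continuous_intros) (auto intro: continuous_on_subset[OF c(1)] continuous_on_subset[OF c(2)])
  from integral_linear[OF integrable_continuous_real[OF this] bounded_linear_fst]
  show "apply_bcontfun (e t) = apply_bcontfun (fst ((e0, P0) + ((h1 t - h1 0) *\<^sub>R lift1 b 1 0 + (h2 t - h2 0) *\<^sub>R lift1 b 0 1) + integral {0..t} (\<lambda>s. (fe s, fP s))))"
    using e[OF t] boundary_lift_decomp[of b "w2 b" "w1 b" "h1 t - h1 0" "h2 t - h2 0"] by (simp add: lift1_def o_def)
qed (use B a z0 h c in \<open>auto simp: V1_def intro!: continuous_intros\<close>)

lemma evolution_Hw2:
  assumes "gK \<le> K" and b: "b > 0" and S: "0 \<le> S" and B: "0 \<le> B"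
    and c: "continuous_on {0..S} fe" "continuous_on {0..S} fr" "continuous_on {0..S} fQ"
    and n: "\<And>s. s \<in> {0..S} \<Longrightarrow> norm (fe s) \<le> B" "\<And>s. s \<in> {0..S} \<Longrightarrow> norm (fr s) \<le> B" "\<And>s. s \<in> {0..S} \<Longrightarrow> norm (fQ s) \<le> B"
    and a: "\<And>s. s \<in> {0..S} \<Longrightarrow> acC (fe s) (third (fr s))" "\<And>s. s \<in> {0..S} \<Longrightarrow> acC (fr s) (fQ s)"
    and z0: "acC e0 (third r0)" "acC r0 Q0" "norm e0 + norm r0 + norm Q0 \<le> N"
    and h: "continuous_on {0..S} h1" "continuous_on {0..S} h2" "\<And>t. t \<in> {0..S} \<Longrightarrow> \<bar>h1 t - h1 0\<bar> \<le> M" "\<And>t. t \<in> {0..S} \<Longrightarrow> \<bar>h2 t - h2 0\<bar> \<le> M"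
    and e: "\<And>t. t \<in> {0..S} \<Longrightarrow> e t = e0 + boundary_lift b (w2 b) (w1 b) (h1 t - h1 0) (h2 t - h2 0) + integral {0..t} fe"
  shows "regular_solution mu 2 S h1 h2 (\<lambda>t. apply_bcontfun (e t))
    (evolution_bound (3 * K) N (lift2_mass b) S M (3 * B)) (evolution_rate (3 * K) (lift2_mass b) (3 * B))"
  unfolding lift2_mass_def
proof (rule Hw_chart.evolution_regular[OF chart2[OF assms(1)] S, where f="\<lambda>s. (fe s, fr s, fQ s)" and ?z0.0="(e0, r0, Q0)"])
  have three: "norm (p, q, s) \<le> norm p + norm q + norm s" for p q :: "real \<Rightarrow>\<^sub>C real" and s :: "real \<Rightarrow>\<^sub>C triple"
    using norm_Pair_le[of p "(q, s)"] norm_Pair_le[of q s] by linarith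
  show "lift2 b 1 0 \<in> V2" "lift2 b 0 1 \<in> V2"
    by (simp_all add: V2_def lift2_def boundary_lift_acC b)
  show "norm (e0, r0, Q0) \<le> N" by (rule order_trans[OF three z0(3)])
  show "norm (fe s, fr s, fQ s) \<le> 3 * B" if "s \<in> {0..S}" for s
    using three[of "fe s" "fr s" "fQ s"] n[OF that] by simp
  fix t assume t: "t \<in> {0..S}"
  have "continuous_on {0..t} (\<lambda>s. (fe s, fr s, fQ s))"
    using t by (intro continuous_intros) (auto intro: continuous_on_subset[OF c(1)] continuous_on_subset[OF c(2)] continuous_on_subset[OF c(3)])
  from integral_linear[OF integrable_continuous_real[OF this] bounded_linear_fst]
  show "apply_bcontfun (e t) = apply_bcontfun (fst ((e0, r0, Q0) + ((h1 t - h1 0) *\<^sub>R lift2 b 1 0 + (h2 t - h2 0) *\<^sub>R lift2 b 0 1) + integral {0..t} (\<lambda>s. (fe s, fr s, fQ s))))"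
    using e[OF t] boundary_lift_decomp[of b "w2 b" "w1 b" "h1 t - h1 0" "h2 t - h2 0"] by (simp add: lift2_def o_def)
qed (use B a z0 h c in \<open>auto simp: V2_def intro!: continuous_intros\<close>)

end

section \<open>Constants uniform over data of bounded norm, and existence\<close>

definition profile_bound :: "real \<Rightarrow> real \<Rightarrow> real" where
  "profile_bound mu n = 2 * embed_const mu * n"

text \<open>Bound for the sum of the five free terms: three sup norms of \<eta>, its derivative and
  \<open>u\<close> at time 0, two constant triples of norm at most 1, and five boundary lifts, one
  of which carries the factor \<open>1 / b\<close>. Picard iteration runs in the ball of twice this
  radius.\<close>

definition initial_bound :: "real \<Rightarrow> real \<Rightarrow> real \<Rightarrow> real \<Rightarrow> real" where
  "initial_bound b mu M n = 3 * profile_bound mu n + 2 + (4 + 1 / b) * (w_mass b * M)"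

text \<open>\<open>profile_bound mu n + 2\<close> here plays the role of a bound for
  \<open>mass\<close>: two L1 norms of at most \<open>embed_const mu * n\<close> each, plus the
  length of the interval.\<close>

definition lip_bound :: "real \<Rightarrow> real \<Rightarrow> real \<Rightarrow> real \<Rightarrow> real \<Rightarrow> real" where
  "lip_bound b c mu M n = lipc b c (op_const b * (profile_bound mu n + 2)) (2 * initial_bound b mu M n)"

definition gK_bound :: "real \<Rightarrow> real \<Rightarrow> real" where
  "gK_bound mu n = sqrt (3 * (n\<^sup>2 + n\<^sup>2 + weight_mass mu))"

text \<open>The vector field vanishes at zero, so on the ball of radius
  \<open>2 * initial_bound b mu M n\<close> it is at most the Lipschitz constant times the
  radius.\<close>

definition rate_bound :: "real \<Rightarrow> real \<Rightarrow> real \<Rightarrow> real \<Rightarrow> real \<Rightarrow> real" where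
  "rate_bound b c mu M n = lip_bound b c mu M n * (2 * initial_bound b mu M n)"

locale boundary_data =
  fixes S M :: real and h1 h2 v1 v2 :: "real \<Rightarrow> real"
  assumes S: "0 \<le> S"
    and h: "continuous_on {0..S} h1" "continuous_on {0..S} h2" and v: "continuous_on {0..S} v1" "continuous_on {0..S} v2"
    and hM: "\<And>t. t \<in> {0..S} \<Longrightarrow> \<bar>h1 t - h1 0\<bar> \<le> M" "\<And>t. t \<in> {0..S} \<Longrightarrow> \<bar>h2 t - h2 0\<bar> \<le> M"
    and vM: "\<And>t. t \<in> {0..S} \<Longrightarrow> \<bar>v1 t - v1 0\<bar> \<le> M" "\<And>t. t \<in> {0..S} \<Longrightarrow> \<bar>v2 t - v2 0\<bar> \<le> M"
begin

lemma M_nonneg: "0 \<le> M"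
  using hM(1)[of 0] S by auto

end

text \<open>Here the pairing becomes concrete: \<open>eta0\<close> and \<open>u0\<close> make
  \<open>g1\<close> the second derivative of the initial \<eta> and \<open>g2\<close> the first
  derivative of the initial \<open>u\<close>.\<close>

locale bs_data = bs_system + boundary_data +
  fixes n :: real and eta0 rb u0 :: "real \<Rightarrow> real"
  assumes eta0: "ac eta0 rb" "ac rb g1" and u0: "ac u0 g2"
    and n: "Hw_norm mu 2 eta0 \<le> n" "Hw_norm mu 1 u0 \<le> n"
    and small: "S * lip_bound b c mu M n \<le> 1 / 2"
begin

lemma n_nonneg: "0 \<le> n"
  using Hw_norm_nonneg n(1) order_trans by blast

lemma profile_le:
  "x \<in> {-1..1} \<Longrightarrow> \<bar>eta0 x\<bar> \<le> profile_bound mu n" "x \<in> {-1..1} \<Longrightarrow> \<bar>rb x\<bar> \<le> profile_bound mu n"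
  "x \<in> {-1..1} \<Longrightarrow> \<bar>u0 x\<bar> \<le> profile_bound mu n"
proof -
  have K: "0 \<le> 2 * embed_const mu" using embed_const_pos[of mu] by simp
  note m = mult_left_mono[OF n(1) K] mult_left_mono[OF n(2) K]
  show "x \<in> {-1..1} \<Longrightarrow> \<bar>eta0 x\<bar> \<le> profile_bound mu n" "x \<in> {-1..1} \<Longrightarrow> \<bar>rb x\<bar> \<le> profile_bound mu n"
  "x \<in> {-1..1} \<Longrightarrow> \<bar>u0 x\<bar> \<le> profile_bound mu n"
    unfolding profile_bound_def
    by (rule order_trans[OF sobolev_bound2(1)[OF eta0 g1_L2w] m(1)] order_trans[OF sobolev_bound2(2)[OF eta0 g1_L2w] m(1)]
      order_trans[OF sobolev_bound[OF u0 g2_L2w] m(2)]; assumption)+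
qed

lemma L2w_norm_le: "L2w_norm mu g1 \<le> n" "L2w_norm mu g2 \<le> n"
proof -
  have "L2w_norm mu g1 \<le> Hw_norm mu 2 eta0"
    unfolding Hw2_intro(2)[OF eta0 g1_L2w] by (rule real_le_rsqrt) simp
  then show "L2w_norm mu g1 \<le> n" using n(1) by simp
  have "L2w_norm mu g2 \<le> Hw_norm mu 1 u0"
    unfolding Hw1_intro(2)[OF u0 g2_L2w] by (rule real_le_rsqrt) simp
  then show "L2w_norm mu g2 \<le> n" using n(2) by simp
qed

lemma gK_le: "gK \<le> gK_bound mu n"
  unfolding gK_def gK_bound_def
  by (intro real_sqrt_le_mono mult_left_mono add_mono power_mono L2w_norm_le L2w_norm_nonneg) auto

lemma op_bound_le: "op_bound \<le> op_const b * (profile_bound mu n + 2)"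
proof -
  have K: "0 \<le> embed_const mu" using embed_const_pos[of mu] by simp
  have "mass g1 g2 \<le> embed_const mu * n + embed_const mu * n + 2"
    unfolding mass_def
    by (intro add_mono order_trans[OF L2w_L1_bound[OF mu(2) g1_L2w] mult_left_mono[OF L2w_norm_le(1) K]]
      order_trans[OF L2w_L1_bound[OF mu(2) g2_L2w] mult_left_mono[OF L2w_norm_le(2) K]]) auto
  then show ?thesis
    unfolding op_bound_def profile_bound_def by (intro mult_left_mono op_const_nonneg) (simp add: mult.commute mult.left_commute)
qed

lemma constants_nonneg:
  "0 \<le> profile_bound mu n" "0 \<le> w_mass b * M" "0 \<le> initial_bound b mu M n" "0 \<le> lip_bound b c mu M n" "0 \<le> rate_bound b c mu M n"
proof -
  show 1: "0 \<le> profile_bound mu n" unfolding profile_bound_def using embed_const_pos[of mu] n_nonneg by simp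
  show 2: "0 \<le> w_mass b * M" using w_mass_nonneg[OF b] M_nonneg by simp
  show 3: "0 \<le> initial_bound b mu M n"
    unfolding initial_bound_def using 1 b by (intro add_nonneg_nonneg mult_nonneg_nonneg[OF _ 2]) auto
  show 4: "0 \<le> lip_bound b c mu M n"
    unfolding lip_bound_def
    by (rule lipc_mono(2)[OF b _ order_refl]) (use 1 3 op_const_nonneg in auto)
  show "0 \<le> rate_bound b c mu M n" unfolding rate_bound_def using 3 4 by simp
qed

lemma lipc_le: "lipc b c op_bound (2 * initial_bound b mu M n) \<le> lip_bound b c mu M n"
  unfolding lip_bound_def by (rule lipc_mono(1)[OF b op_bound_nonneg op_bound_le]) (use constants_nonneg in auto)

text \<open>With this pairing the unit triples \<open>(1, 0, 0)\<close> and \<open>(0, 1, 0)\<close>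
  encode the merely square integrable derivatives of the data, so rough data have constant
  coefficients at time 0.\<close>

lemma data_acC:
  "acC (bc eta0) (third (bc rb))" "acC (bc rb) (const_bcontfun (1, 0, 0))" "acC (bc u0) (const_bcontfun (0, 1, 0))"
  "norm (bc eta0) \<le> profile_bound mu n" "norm (bc rb) \<le> profile_bound mu n" "norm (bc u0) \<le> profile_bound mu n"
proof -
  note c = ac_continuous[OF eta0(1)] ac_continuous[OF eta0(2)] ac_continuous[OF u0]
  note in1 = bcext_apply_in[OF c(1)] bcext_apply_in[OF c(2)] bcext_apply_in[OF c(3)]
  show "acC (bc eta0) (third (bc rb))"
    unfolding acC_third by (rule ac_cong[OF eta0(1)]) (simp_all add: in1)
  show "acC (bc rb) (const_bcontfun (1, 0, 0))"
    unfolding acC_def by (rule ac_cong[OF eta0(2)]) (simp_all add: in1 pr_def)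
  show "acC (bc u0) (const_bcontfun (0, 1, 0))"
    unfolding acC_def by (rule ac_cong[OF u0]) (simp_all add: in1 pr_def)
  show "norm (bc eta0) \<le> profile_bound mu n" "norm (bc rb) \<le> profile_bound mu n" "norm (bc u0) \<le> profile_bound mu n"
    by (rule norm_bcext_le[OF c(1)] norm_bcext_le[OF c(2)] norm_bcext_le[OF c(3)]; simp add: profile_le)+
qed

lemma local_solution:
  obtains e r u Q P where "continuous_on {0..S} e" "continuous_on {0..S} r" "continuous_on {0..S} u" "continuous_on {0..S} Q" "continuous_on {0..S} P"
    "\<And>t. t \<in> {0..S} \<Longrightarrow> norm (e t) \<le> 2 * initial_bound b mu M n \<and> norm (r t) \<le> 2 * initial_bound b mu M n
      \<and> norm (u t) \<le> 2 * initial_bound b mu M n \<and> norm (Q t) \<le> 2 * initial_bound b mu M n \<and> norm (P t) \<le> 2 * initial_bound b mu M n"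
    "\<And>t. t \<in> {0..S} \<Longrightarrow> acC (e t) (third (r t))" "\<And>t. t \<in> {0..S} \<Longrightarrow> acC (r t) (Q t)" "\<And>t. t \<in> {0..S} \<Longrightarrow> acC (u t) (P t)"
    "\<And>t. t \<in> {0..S} \<Longrightarrow> e t = bc eta0 + boundary_lift b (w2 b) (w1 b) (h1 t - h1 0) (h2 t - h2 0) + integral {0..t} (\<lambda>s. Fe (e s) (u s))"
    "\<And>t. t \<in> {0..S} \<Longrightarrow> u t = bc u0 + boundary_lift b (w2 b) (w1 b) (v1 t - v1 0) (v2 t - v2 0) + integral {0..t} (\<lambda>s. Fu (e s) (u s) (Q s))"
    "solves_system b c S h1 h2 v1 v2 eta0 u0 (\<lambda>t. apply_bcontfun (e t)) (\<lambda>t. apply_bcontfun (u t))"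
    "\<And>t. t \<in> {0..S} \<Longrightarrow> norm (Fe (e t) (u t)) \<le> rate_bound b c mu M n \<and> norm (Fr (e t) (u t)) \<le> rate_bound b c mu M n
      \<and> norm (Fu (e t) (u t) (Q t)) \<le> rate_bound b c mu M n \<and> norm (FQ (e t) (r t) (u t) (P t)) \<le> rate_bound b c mu M n
      \<and> norm (FP (e t) (u t) (Q t)) \<le> rate_bound b c mu M n"
proof -
  let ?\<rho> = "initial_bound b mu M n"
  define e0 where "e0 t = bc eta0 + boundary_lift b (w2 b) (w1 b) (h1 t - h1 0) (h2 t - h2 0)" for t
  define r0 where "r0 t = bc rb + boundary_lift b (dw2 b) (dw1 b) (h1 t - h1 0) (h2 t - h2 0)" for t
  define q0 where "q0 t = const_bcontfun (1, 0, 0) + third ((1/b) *\<^sub>R boundary_lift b (w2 b) (w1 b) (h1 t - h1 0) (h2 t - h2 0))" for t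
  define f0 where "f0 t = bc u0 + boundary_lift b (w2 b) (w1 b) (v1 t - v1 0) (v2 t - v2 0)" for t
  define p0 where "p0 t = const_bcontfun (0, 1, 0) + third (boundary_lift b (dw2 b) (dw1 b) (v1 t - v1 0) (v2 t - v2 0))" for t
  have c0: "continuous_on {0..S} e0" "continuous_on {0..S} r0" "continuous_on {0..S} f0" "continuous_on {0..S} q0" "continuous_on {0..S} p0"
    unfolding e0_def r0_def q0_def f0_def p0_def by (intro continuous_intros h v)+
  have a0: "acC (e0 t) (third (r0 t))" "acC (r0 t) (q0 t)" "acC (f0 t) (p0 t)" for t
  proof -
    show "acC (e0 t) (third (r0 t))"
      unfolding e0_def r0_def third_simps by (intro acC_add data_acC boundary_lift_acC b)
    show "acC (r0 t) (q0 t)" "acC (f0 t) (p0 t)"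
      unfolding r0_def q0_def f0_def p0_def by (intro acC_add data_acC boundary_lift_acC b)+
  qed
  have n0: "norm (e0 t) + norm (r0 t) + norm (f0 t) + norm (q0 t) + norm (p0 t) \<le> ?\<rho>" if t: "t \<in> {0..S}" for t
  proof -
    have 1: "norm (e0 t) \<le> profile_bound mu n + w_mass b * M" "norm (r0 t) \<le> profile_bound mu n + w_mass b * M"
      "norm (f0 t) \<le> profile_bound mu n + w_mass b * M"
      unfolding e0_def r0_def f0_def
      by (intro order_trans[OF norm_triangle_ineq] add_mono data_acC boundary_lift_norm b hM vM t)+
    have 2: "norm (q0 t) \<le> 1 + 1 / b * (w_mass b * M)"
      unfolding q0_def
    proof (intro order_trans[OF norm_triangle_ineq] add_mono order_trans[OF norm_third])
      show "norm (const_bcontfun (1, 0, 0) :: real \<Rightarrow>\<^sub>C triple) \<le> 1"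
        using norm_const_bcontfun_le[of "(1, 0, 0) :: triple"] by (simp add: norm_Pair)
      show "norm ((1 / b) *\<^sub>R boundary_lift b (w2 b) (w1 b) (h1 t - h1 0) (h2 t - h2 0)) \<le> 1 / b * (w_mass b * M)"
        using b by (simp add: divide_right_mono boundary_lift_norm[OF b hM(1)[OF t] hM(2)[OF t]])
    qed
    have 3: "norm (p0 t) \<le> 1 + w_mass b * M"
      unfolding p0_def
    proof (intro order_trans[OF norm_triangle_ineq] add_mono order_trans[OF norm_third])
      show "norm (const_bcontfun (0, 1, 0) :: real \<Rightarrow>\<^sub>C triple) \<le> 1"
        using norm_const_bcontfun_le[of "(0, 1, 0) :: triple"] by (simp add: norm_Pair)
    qed (intro boundary_lift_norm b vM t)
    show ?thesis using 1 2 3 unfolding initial_bound_def by (simp add: algebra_simps)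
  qed
  have SL: "S * lipc b c op_bound (2 * ?\<rho>) \<le> 1 / 2"
    using mult_left_mono[OF lipc_le S] small by linarith
  obtain e r u Q P where sol: "continuous_on {0..S} e" "continuous_on {0..S} r" "continuous_on {0..S} u" "continuous_on {0..S} Q" "continuous_on {0..S} P"
    "\<And>t. t \<in> {0..S} \<Longrightarrow> norm (e t) \<le> 2 * ?\<rho> \<and> norm (r t) \<le> 2 * ?\<rho> \<and> norm (u t) \<le> 2 * ?\<rho> \<and> norm (Q t) \<le> 2 * ?\<rho> \<and> norm (P t) \<le> 2 * ?\<rho>"
    "\<And>t. t \<in> {0..S} \<Longrightarrow> e t = e0 t + integral {0..t} (\<lambda>s. Fe (e s) (u s))"
    "\<And>t. t \<in> {0..S} \<Longrightarrow> r t = r0 t + integral {0..t} (\<lambda>s. Fr (e s) (u s))"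
    "\<And>t. t \<in> {0..S} \<Longrightarrow> u t = f0 t + integral {0..t} (\<lambda>s. Fu (e s) (u s) (Q s))"
    "\<And>t. t \<in> {0..S} \<Longrightarrow> Q t = q0 t + integral {0..t} (\<lambda>s. FQ (e s) (r s) (u s) (P s))"
    "\<And>t. t \<in> {0..S} \<Longrightarrow> P t = p0 t + integral {0..t} (\<lambda>s. FP (e s) (u s) (Q s))"
  proof (rule bounded_system_solution[OF S c0 n0 SL], goal_cases)
    case (2 e r u Q P)
    show ?case by (rule that[of e r u Q P, OF 2(2-)])
  qed
  note acs = solution_acC[OF sol(1-5,7-11) a0]
  have e: "e t = bc eta0 + boundary_lift b (w2 b) (w1 b) (h1 t - h1 0) (h2 t - h2 0) + integral {0..t} (\<lambda>s. Fe (e s) (u s))"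
    and u: "u t = bc u0 + boundary_lift b (w2 b) (w1 b) (v1 t - v1 0) (v2 t - v2 0) + integral {0..t} (\<lambda>s. Fu (e s) (u s) (Q s))"
    if "t \<in> {0..S}" for t
    using sol(7)[OF that] sol(9)[OF that] unfolding e0_def f0_def by simp_all
  have F: "norm (Fe (e t) (u t)) \<le> rate_bound b c mu M n \<and> norm (Fr (e t) (u t)) \<le> rate_bound b c mu M n
      \<and> norm (Fu (e t) (u t) (Q t)) \<le> rate_bound b c mu M n \<and> norm (FQ (e t) (r t) (u t) (P t)) \<le> rate_bound b c mu M n
      \<and> norm (FP (e t) (u t) (Q t)) \<le> rate_bound b c mu M n" if t: "t \<in> {0..S}" for t
  proof -
    have "norm (Fe (e t) (u t)) + norm (Fr (e t) (u t)) + norm (Fu (e t) (u t) (Q t)) + norm (FQ (e t) (r t) (u t) (P t)) + norm (FP (e t) (u t) (Q t))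
      \<le> lipc b c op_bound (2 * ?\<rho>) * (2 * ?\<rho>)"
      by (rule F_sum_bound) (use sol(6)[OF t] in auto)
    also have "\<dots> \<le> rate_bound b c mu M n"
      unfolding rate_bound_def using constants_nonneg by (intro mult_right_mono lipc_le) auto
    finally show ?thesis
      using norm_ge_zero[of "Fe (e t) (u t)"] norm_ge_zero[of "Fr (e t) (u t)"] norm_ge_zero[of "Fu (e t) (u t) (Q t)"]
        norm_ge_zero[of "FQ (e t) (r t) (u t) (P t)"] norm_ge_zero[of "FP (e t) (u t) (Q t)"] by linarith
  qed
  show thesis
    by (rule that[of e r u Q P, OF sol(1-6) acs e u solution_solves_system[OF sol(1,3,4) acs(1,2) ac_continuous[OF eta0(1)] ac_continuous[OF u0] e u] F])
qed

end

lemma norm_unit_triples: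
  "norm (const_bcontfun (1, 0, 0) :: real \<Rightarrow>\<^sub>C triple) \<le> 1" "norm (const_bcontfun (0, 1, 0) :: real \<Rightarrow>\<^sub>C triple) \<le> 1"
  using norm_const_bcontfun_le[of "(1, 0, 0) :: triple"] norm_const_bcontfun_le[of "(0, 1, 0) :: triple"]
  by (auto simp: norm_Pair)

context weight_exponent begin

definition eta_bound :: "real \<Rightarrow> real \<Rightarrow> real \<Rightarrow> real \<Rightarrow> real \<Rightarrow> real" where
  "eta_bound b S M n B = evolution_bound (3 * gK_bound mu n) (2 * profile_bound mu n + 1) (lift2_mass b) S M (3 * B)"

definition eta_rate_bound :: "real \<Rightarrow> real \<Rightarrow> real \<Rightarrow> real \<Rightarrow> real" where
  "eta_rate_bound b n B = evolution_rate (3 * gK_bound mu n) (lift2_mass b) (3 * B)"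

definition u_bound :: "real \<Rightarrow> real \<Rightarrow> real \<Rightarrow> real \<Rightarrow> real \<Rightarrow> real" where
  "u_bound b S M n B = evolution_bound (2 * gK_bound mu n) (profile_bound mu n + 1) (lift1_mass b) S M (2 * B)"

definition u_rate_bound :: "real \<Rightarrow> real \<Rightarrow> real \<Rightarrow> real \<Rightarrow> real" where
  "u_rate_bound b n B = evolution_rate (2 * gK_bound mu n) (lift1_mass b) (2 * B)"

text \<open>The pairing is chosen inside the proof and does not appear in the conclusion. The last
  two conclusions prepare the smoother case: for \<open>c = 0\<close> the equation for
  \<open>u\<close> holds with every pairing \<open>g\<close>, \<open>g'\<close>, so it can be read
  again with one adapted to a second derivative of \<open>u0\<close>.\<close>

lemma local_solution_Hw1:
  assumes bd: "boundary_data S M h1 h2 v1 v2" and b: "b > 0" and small: "S * lip_bound b c mu M n \<le> 1 / 2"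
    and e0: "eta0 \<in> Hw mu 2" "Hw_norm mu 2 eta0 \<le> n" and u0: "u0 \<in> Hw mu 1" "Hw_norm mu 1 u0 \<le> n"
  obtains e r u where
    "solves_system b c S h1 h2 v1 v2 eta0 u0 (\<lambda>t. apply_bcontfun (e t)) (\<lambda>t. apply_bcontfun (u t))"
    "regular_solution mu 2 S h1 h2 (\<lambda>t. apply_bcontfun (e t)) (eta_bound b S M n (rate_bound b c mu M n)) (eta_rate_bound b n (rate_bound b c mu M n))"
    "regular_solution mu 1 S v1 v2 (\<lambda>t. apply_bcontfun (u t)) (u_bound b S M n (rate_bound b c mu M n)) (u_rate_bound b n (rate_bound b c mu M n))"
    "continuous_on {0..S} e" "continuous_on {0..S} r" "continuous_on {0..S} u"
    "\<And>t. t \<in> {0..S} \<Longrightarrow> norm (e t) \<le> 2 * initial_bound b mu M n \<and> norm (r t) \<le> 2 * initial_bound b mu M n \<and> norm (u t) \<le> 2 * initial_bound b mu M n"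
    "\<And>t. t \<in> {0..S} \<Longrightarrow> ac (apply_bcontfun (e t)) (apply_bcontfun (r t))"
    "\<And>t g g'. c = 0 \<Longrightarrow> t \<in> {0..S} \<Longrightarrow> u t = bc u0 + boundary_lift b (w2 b) (w1 b) (v1 t - v1 0) (v2 t - v2 0)
        + integral {0..t} (\<lambda>s. opA b g g' (third (e s + (1/2) *\<^sub>R mulC (u s) (u s))))"
    "\<And>t g g'. c = 0 \<Longrightarrow> t \<in> {0..S} \<Longrightarrow> norm (opA b g g' (third (e t + (1/2) *\<^sub>R mulC (u t) (u t)))) \<le> rate_bound b c mu M n
        \<and> norm (opB b g g' (third (e t + (1/2) *\<^sub>R mulC (u t) (u t))) + (1/b) *\<^sub>R (e t + (1/2) *\<^sub>R mulC (u t) (u t))) \<le> rate_bound b c mu M n"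
proof -
  obtain rb g1 where rb: "ac eta0 rb" "ac rb g1" "g1 \<in> L2w mu" using Hw2_elim[OF e0(1)] .
  obtain g2 where g2: "ac u0 g2" "g2 \<in> L2w mu" using Hw1_elim[OF u0(1)] .
  interpret boundary_data S M h1 h2 v1 v2 by (rule bd)
  interpret bs_data mu g1 g2 b c S M h1 h2 v1 v2 n eta0 rb u0
    by unfold_locales (use rb g2 b e0 u0 small in auto)
  let ?B = "rate_bound b c mu M n" and ?\<rho> = "initial_bound b mu M n"
  obtain e r u Q P where sol: "continuous_on {0..S} e" "continuous_on {0..S} r" "continuous_on {0..S} u" "continuous_on {0..S} Q" "continuous_on {0..S} P"
    and le: "\<And>t. t \<in> {0..S} \<Longrightarrow> norm (e t) \<le> 2 * ?\<rho> \<and> norm (r t) \<le> 2 * ?\<rho>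
      \<and> norm (u t) \<le> 2 * ?\<rho> \<and> norm (Q t) \<le> 2 * ?\<rho> \<and> norm (P t) \<le> 2 * ?\<rho>"
    and acs: "\<And>t. t \<in> {0..S} \<Longrightarrow> acC (e t) (third (r t))" "\<And>t. t \<in> {0..S} \<Longrightarrow> acC (r t) (Q t)" "\<And>t. t \<in> {0..S} \<Longrightarrow> acC (u t) (P t)"
    and eq: "\<And>t. t \<in> {0..S} \<Longrightarrow> e t = bc eta0 + boundary_lift b (w2 b) (w1 b) (h1 t - h1 0) (h2 t - h2 0) + integral {0..t} (\<lambda>s. Fe (e s) (u s))"
    "\<And>t. t \<in> {0..S} \<Longrightarrow> u t = bc u0 + boundary_lift b (w2 b) (w1 b) (v1 t - v1 0) (v2 t - v2 0) + integral {0..t} (\<lambda>s. Fu (e s) (u s) (Q s))"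
    and solves: "solves_system b c S h1 h2 v1 v2 eta0 u0 (\<lambda>t. apply_bcontfun (e t)) (\<lambda>t. apply_bcontfun (u t))"
    and F: "\<And>t. t \<in> {0..S} \<Longrightarrow> norm (Fe (e t) (u t)) \<le> ?B \<and> norm (Fr (e t) (u t)) \<le> ?B
      \<and> norm (Fu (e t) (u t) (Q t)) \<le> ?B \<and> norm (FQ (e t) (r t) (u t) (P t)) \<le> ?B \<and> norm (FP (e t) (u t) (Q t)) \<le> ?B"
  proof (rule local_solution, goal_cases)
    case (1 e r u Q P)
    show ?case by (rule that[of e r u Q P, OF 1(2-)])
  qed
  have B: "0 \<le> ?B" by (rule constants_nonneg)
  have cF: "continuous_on {0..S} (\<lambda>s. Fe (e s) (u s))" "continuous_on {0..S} (\<lambda>s. Fr (e s) (u s))" "continuous_on {0..S} (\<lambda>s. FQ (e s) (r s) (u s) (P s))"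
    "continuous_on {0..S} (\<lambda>s. Fu (e s) (u s) (Q s))" "continuous_on {0..S} (\<lambda>s. FP (e s) (u s) (Q s))"
    by (intro continuous_on_F sol)+
  have reg_e: "regular_solution mu 2 S h1 h2 (\<lambda>t. apply_bcontfun (e t)) (eta_bound b S M n ?B) (eta_rate_bound b n ?B)"
    unfolding eta_bound_def eta_rate_bound_def
    by (rule evolution_Hw2[OF gK_le b S B cF(1-3) _ _ _ Fe_acC Fr_acC[OF acs(1,3)] data_acC(1,2) _ h hM eq(1)])
      (use F data_acC(4,5) norm_unit_triples(1) in auto)
  have reg_u: "regular_solution mu 1 S v1 v2 (\<lambda>t. apply_bcontfun (u t)) (u_bound b S M n ?B) (u_rate_bound b n ?B)"
    unfolding u_bound_def u_rate_bound_def
    by (rule evolution_Hw1[OF gK_le b S B cF(4,5) _ _ Fu_acC data_acC(3) _ v vM eq(2)])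
      (use F data_acC(6) norm_unit_triples(2) in auto)
  have c0: "Fu (e t) (u t) (Q t) = opA b g g' (third (e t + (1/2) *\<^sub>R mulC (u t) (u t)))"
    "FP (e t) (u t) (Q t) = third (opB b g g' (third (e t + (1/2) *\<^sub>R mulC (u t) (u t))) + (1/b) *\<^sub>R (e t + (1/2) *\<^sub>R mulC (u t) (u t)))"
    if "c = 0" for t g g'
    unfolding Fu_def FP_def force_def pot_def
    using that opA_third[of b g1 g2 _ g g'] opB_third[of b g1 g2 _ g g'] by simp_all
  show thesis
  proof (rule that[of e u r])
    show "u t = bc u0 + boundary_lift b (w2 b) (w1 b) (v1 t - v1 0) (v2 t - v2 0)
        + integral {0..t} (\<lambda>s. opA b g g' (third (e s + (1/2) *\<^sub>R mulC (u s) (u s))))" if "c = 0" "t \<in> {0..S}" for t g g'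
      using eq(2)[OF that(2)] unfolding c0(1)[OF that(1), of _ g g'] .
    show "norm (opA b g g' (third (e t + (1/2) *\<^sub>R mulC (u t) (u t)))) \<le> ?B
        \<and> norm (opB b g g' (third (e t + (1/2) *\<^sub>R mulC (u t) (u t))) + (1/b) *\<^sub>R (e t + (1/2) *\<^sub>R mulC (u t) (u t))) \<le> ?B"
      if "c = 0" "t \<in> {0..S}" for t g g'
      using F[OF that(2)] norm_third_ge[of "opB b g g' (third (e t + (1/2) *\<^sub>R mulC (u t) (u t))) + (1/b) *\<^sub>R (e t + (1/2) *\<^sub>R mulC (u t) (u t))"]
      unfolding c0[OF that(1), of _ g g'] by linarith
    show "ac (apply_bcontfun (e t)) (apply_bcontfun (r t))" if "t \<in> {0..S}" for t
      using acs(1)[OF that] by (simp add: acC_third)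
  qed (use solves reg_e reg_u sol le in auto)
qed

lemma Hw2_imp_Hw1:
  assumes "f \<in> Hw mu 2"
  shows "f \<in> Hw mu 1" "Hw_norm mu 1 f \<le> Hw_norm mu 2 f"
proof -
  obtain r q where rq: "ac f r" "ac r q" "q \<in> L2w mu" using Hw2_elim[OF assms] .
  have r: "r \<in> L2w mu" using L2w_continuous[OF mu(1) ac_continuous[OF rq(2)]] .
  show "f \<in> Hw mu 1" by (rule Hw1_intro(1)[OF rq(1) r])
  show "Hw_norm mu 1 f \<le> Hw_norm mu 2 f"
    unfolding Hw1_intro(2)[OF rq(1) r] Hw2_intro(2)[OF rq] by simp
qed

lemma Hw_norm_1_le_2: "Hw_norm mu 1 f \<le> Hw_norm mu 2 f"
  unfolding Hw_norm_def by (intro real_sqrt_le_mono sum_mono2) auto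

lemma CHw2_imp_CHw1:
  assumes "f \<in> CHw mu 2 S"
  shows "f \<in> CHw mu 1 S"
  unfolding CHw_def
proof (intro CollectI ballI conjI)
  fix t assume t: "t \<in> {0..S}"
  show "f t \<in> Hw mu 1" using assms t Hw2_imp_Hw1(1) by (auto simp: CHw_def)
  have "((\<lambda>s. Hw_norm mu 2 (\<lambda>x. f s x - f t x)) \<longlongrightarrow> 0) (at t within {0..S})"
    using assms t by (auto simp: CHw_def)
  then show "((\<lambda>s. Hw_norm mu 1 (\<lambda>x. f s x - f t x)) \<longlongrightarrow> 0) (at t within {0..S})"
  proof (rule tendsto_0_le[where K=1])
    have "0 \<le> Hw_norm mu k f" for k f by (simp add: Hw_norm_def sum_nonneg)
    with Hw_norm_1_le_2 show "\<forall>\<^sub>F s in at t within {0..S}. norm (Hw_norm mu 1 (\<lambda>x. f s x - f t x)) \<le> norm (Hw_norm mu 2 (\<lambda>x. f s x - f t x)) * 1"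
      by (intro always_eventually allI) (simp del: One_nat_def)
  qed
qed

text \<open>One number bounding \<open>fu\<close>, \<open>fp\<close> and \<open>fq\<close> in the
  proof below. The last factor bounds the spatial derivative \<open>p\<close> of \<open>u\<close> by
  initial profile, boundary lift and time integral; it enters through the derivative of
  \<open>u\<^sup>2 / 2\<close>.\<close>

definition u_rate2 :: "real \<Rightarrow> real \<Rightarrow> real \<Rightarrow> real \<Rightarrow> real \<Rightarrow> real" where
  "u_rate2 b S M n B = B + 1 / b * (B + (2 * initial_bound b mu M n
      + 2 * initial_bound b mu M n * (profile_bound mu n + w_mass b * M + S * B)))"

text \<open>For \<open>c = 0\<close> the second equation gains a derivative, because \<open>\<eta> + u\<^sup>2/2\<close> is already in \<open>H\<^sup>1\<^sub>w\<close>;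
  the same \<open>(\<eta>, u)\<close> as before is therefore more regular when \<open>u\<^sub>0\<close> is.\<close>

lemma local_solution_Hw2:
  assumes bd: "boundary_data S M h1 h2 v1 v2" and b: "b > 0" and small: "S * lip_bound b 0 mu M n \<le> 1 / 2"
    and e0: "eta0 \<in> Hw mu 2" "Hw_norm mu 2 eta0 \<le> n" and u0: "u0 \<in> Hw mu 2" "Hw_norm mu 2 u0 \<le> n"
  obtains eta u where
    "solves_system b 0 S h1 h2 v1 v2 eta0 u0 eta u"
    "regular_solution mu 2 S h1 h2 eta (eta_bound b S M n (rate_bound b 0 mu M n)) (eta_rate_bound b n (rate_bound b 0 mu M n))"
    "regular_solution mu 2 S v1 v2 u (eta_bound b S M n (u_rate2 b S M n (rate_bound b 0 mu M n))) (eta_rate_bound b n (u_rate2 b S M n (rate_bound b 0 mu M n)))"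
proof -
  let ?B = "rate_bound b 0 mu M n" and ?R = "2 * initial_bound b mu M n"
  have u01: "u0 \<in> Hw mu 1" "Hw_norm mu 1 u0 \<le> n" using Hw2_imp_Hw1[OF u0(1)] u0(2) by auto
  obtain e r u where
    solves: "solves_system b 0 S h1 h2 v1 v2 eta0 u0 (\<lambda>t. apply_bcontfun (e t)) (\<lambda>t. apply_bcontfun (u t))"
    and reg: "regular_solution mu 2 S h1 h2 (\<lambda>t. apply_bcontfun (e t)) (eta_bound b S M n ?B) (eta_rate_bound b n ?B)"
    and c: "continuous_on {0..S} e" "continuous_on {0..S} r" "continuous_on {0..S} u"
    and le: "\<And>t. t \<in> {0..S} \<Longrightarrow> norm (e t) \<le> ?R \<and> norm (r t) \<le> ?R \<and> norm (u t) \<le> ?R"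
    and er: "\<And>t. t \<in> {0..S} \<Longrightarrow> ac (apply_bcontfun (e t)) (apply_bcontfun (r t))"
    and ueq: "\<And>t g g'. t \<in> {0..S} \<Longrightarrow> u t = bc u0 + boundary_lift b (w2 b) (w1 b) (v1 t - v1 0) (v2 t - v2 0)
        + integral {0..t} (\<lambda>s. opA b g g' (third (e s + (1/2) *\<^sub>R mulC (u s) (u s))))"
    and Fb: "\<And>t g g'. t \<in> {0..S} \<Longrightarrow> norm (opA b g g' (third (e t + (1/2) *\<^sub>R mulC (u t) (u t)))) \<le> ?B
        \<and> norm (opB b g g' (third (e t + (1/2) *\<^sub>R mulC (u t) (u t))) + (1/b) *\<^sub>R (e t + (1/2) *\<^sub>R mulC (u t) (u t))) \<le> ?B"
  proof (rule local_solution_Hw1[OF bd b small e0 u01], goal_cases)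
    case (1 e r u)
    show ?case by (rule that[of e u r, OF 1(2,3,5-9)]) (use 1(10,11) in simp_all)
  qed
  obtain pb g3 where pb: "ac u0 pb" "ac pb g3" "g3 \<in> L2w mu" using Hw2_elim[OF u0(1)] .
  interpret boundary_data S M h1 h2 v1 v2 by (rule bd)
  \<comment> \<open>A new pairing: the singular function is now the second derivative
    \<open>g3\<close> of \<open>u0\<close>, and the second slot is zero. Only operators on
    continuous functions occur, so the old solution satisfies the equation in the new
    pairing.\<close>
  interpret G: sobolev_pairing mu g3 "\<lambda>_. 0" by unfold_locales (use pb zero_L2w in auto)
  define pot where "pot s = e s + (1/2) *\<^sub>R mulC (u s) (u s)" for s
  define fu where "fu s = opA b g3 (\<lambda>_. 0) (third (pot s))" for s
  define fp where "fp s = opB b g3 (\<lambda>_. 0) (third (pot s)) + (1/b) *\<^sub>R pot s" for s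
  \<comment> \<open>Candidate for the spatial derivative of \<open>u\<close>, obtained by
    differentiating its integral equation; \<open>fp\<close> is the derivative of
    \<open>fu\<close>.\<close>
  define p where "p t = bc pb + boundary_lift b (dw2 b) (dw1 b) (v1 t - v1 0) (v2 t - v2 0) + integral {0..t} fp" for t
  \<comment> \<open>The derivative of \<open>fp\<close>: the \<open>opB\<close> part gives
    \<open>fu / b\<close>, and \<eta> plus half the square of \<open>u\<close> has the continuous
    derivative \<open>r + u p\<close>.\<close>
  define fq where "fq s = third ((1/b) *\<^sub>R fu s) + (1/b) *\<^sub>R third (r s + mulC (u s) (p s))" for s
  have S0: "0 \<le> S" by (rule S)
  have cpot: "continuous_on {0..S} pot" unfolding pot_def by (intro continuous_intros c)
  have cfu: "continuous_on {0..S} fu" unfolding fu_def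
    by (intro bounded_linear.continuous_on[OF G.op_bounded_linear(1)] continuous_intros cpot)
  have cfp: "continuous_on {0..S} fp" unfolding fp_def
    by (intro continuous_intros bounded_linear.continuous_on[OF G.op_bounded_linear(2)] cpot)
  have cp: "continuous_on {0..S} p"
    unfolding p_def by (intro continuous_intros v indefinite_integral_continuous_1 integrable_continuous_real cfp)
  have cfq: "continuous_on {0..S} fq" unfolding fq_def by (intro continuous_intros cfu c cp)
  have u_eq: "u t = bc u0 + boundary_lift b (w2 b) (w1 b) (v1 t - v1 0) (v2 t - v2 0) + integral {0..t} fu" if "t \<in> {0..S}" for t
    using ueq[OF that, of g3 "\<lambda>_. 0"] by (simp add: fu_def[abs_def] pot_def)
  have nb: "norm (fu t) \<le> ?B" "norm (fp t) \<le> ?B" if "t \<in> {0..S}" for t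
    using Fb[OF that, of g3 "\<lambda>_. 0"] by (auto simp: fu_def fp_def pot_def)
  have B: "0 \<le> ?B" using nb(1)[of 0] S order_trans[OF norm_ge_zero] by auto
  have R: "0 \<le> ?R" using le[of 0] S order_trans[OF norm_ge_zero] by (meson atLeastAtMost_iff order_refl)
  have fu_ac: "G.acC (fu s) (third (fp s))" for s
    using G.acC_opA[OF b, of "third (pot s)"] by (simp add: fu_def fp_def third_simps)
  note cb = ac_continuous[OF pb(1)] ac_continuous[OF pb(2)]
  note in1 = bcext_apply_in[OF cb(1)] bcext_apply_in[OF cb(2)]
  have a0: "G.acC (bc u0) (third (bc pb))" "G.acC (bc pb) (const_bcontfun (1, 0, 0))"
  proof -
    show "G.acC (bc u0) (third (bc pb))"
      unfolding G.acC_third by (rule ac_cong[OF pb(1)]) (simp_all add: in1)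
    show "G.acC (bc pb) (const_bcontfun (1, 0, 0))"
      unfolding G.acC_def by (rule ac_cong[OF pb(2)]) (simp_all add: in1 pr_def)
  qed
  have sub: "{0..t} \<subseteq> {0..S}" if "t \<in> {0..S}" for t using that by auto
  have u_ac: "G.acC (u t) (third (p t))" if t: "t \<in> {0..S}" for t
  proof -
    have cs: "continuous_on {0..t} fu" "continuous_on {0..t} fp"
      using continuous_on_subset[OF cfu sub[OF t]] continuous_on_subset[OF cfp sub[OF t]] .
    have "G.acC (integral {0..t} fu) (integral {0..t} (\<lambda>s. third (fp s)))"
      by (intro G.acC_integral cs continuous_intros fu_ac)
    then show ?thesis
      unfolding u_eq[OF t] p_def third_simps integral_third[OF cs(2)] by (intro G.acC_add a0 G.boundary_lift_acC b)
  qed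
  have fp_ac: "G.acC (fp t) (fq t)" if t: "t \<in> {0..S}" for t
  proof -
    have "G.acC (e t) (third (r t))" using er[OF t] by (simp add: G.acC_third)
    moreover have "G.acC (mulC (u t) (u t)) (mulC (u t) (third (p t)) + third (mulC (p t) (u t)))"
      by (rule G.acC_mulC[OF u_ac[OF t] u_ac[OF t]])
    ultimately have "G.acC (pot t) (third (r t) + (1/2) *\<^sub>R (mulC (u t) (third (p t)) + third (mulC (p t) (u t))))"
      unfolding pot_def by (intro G.acC_add G.acC_scale)
    also have "third (r t) + (1/2) *\<^sub>R (mulC (u t) (third (p t)) + third (mulC (p t) (u t))) = third (r t + mulC (u t) (p t))"
      by (rule bcontfun_eqI) simp
    finally have "G.acC (pot t) (third (r t + mulC (u t) (p t)))" .
    then show ?thesis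
      unfolding fp_def fq_def fu_def by (intro G.acC_add G.acC_opB b G.acC_scale)
  qed
  have pn: "norm (p t) \<le> profile_bound mu n + w_mass b * M + S * ?B" if t: "t \<in> {0..S}" for t
    unfolding p_def
  proof (intro order_trans[OF norm_triangle_ineq] add_mono)
    have "2 * embed_const mu * Hw_norm mu 2 u0 \<le> profile_bound mu n"
      unfolding profile_bound_def using u0(2) embed_const_pos[of mu] by (intro mult_left_mono) auto
    then show "norm (bc pb) \<le> profile_bound mu n"
      by (intro norm_bcext_le[OF cb(2)]) (use sobolev_bound2(2)[OF pb] in force)+
    show "norm (boundary_lift b (dw2 b) (dw1 b) (v1 t - v1 0) (v2 t - v2 0)) \<le> w_mass b * M"
      by (intro boundary_lift_norm b vM t)
    show "norm (integral {0..t} fp) \<le> S * ?B"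
      using t by (intro norm_integral_le continuous_on_subset[OF cfp sub[OF t]] B) (auto intro!: nb)
  qed
  have qn: "norm (fq t) \<le> 1 / b * ?B + 1 / b * (?R + ?R * (profile_bound mu n + w_mass b * M + S * ?B))" if t: "t \<in> {0..S}" for t
    unfolding fq_def
  proof (intro order_trans[OF norm_triangle_ineq] add_mono)
    show "norm (third ((1 / b) *\<^sub>R fu t)) \<le> 1 / b * ?B"
      by (rule order_trans[OF norm_third]) (use b nb(1)[OF t] in \<open>simp add: divide_right_mono\<close>)
    have "norm (r t + mulC (u t) (p t)) \<le> ?R + ?R * (profile_bound mu n + w_mass b * M + S * ?B)"
      using le[OF t] R by (intro order_trans[OF norm_triangle_ineq] add_mono order_trans[OF norm_mulC] mult_mono pn t) auto
    then have "norm (third (r t + mulC (u t) (p t))) \<le> ?R + ?R * (profile_bound mu n + w_mass b * M + S * ?B)"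
      using norm_third order_trans by blast
    then show "norm ((1 / b) *\<^sub>R third (r t + mulC (u t) (p t))) \<le> 1 / b * (?R + ?R * (profile_bound mu n + w_mass b * M + S * ?B))"
      using b by (simp add: divide_right_mono)
  qed
  let ?B2 = "u_rate2 b S M n ?B"
  have P0: "0 \<le> profile_bound mu n + w_mass b * M + S * ?B"
    using pn[of 0] S order_trans[OF norm_ge_zero] by (meson atLeastAtMost_iff order_refl)
  have BB: "?B \<le> ?B2" "0 \<le> ?B2"
  proof -
    have "0 \<le> 1 / b * (?B + (?R + ?R * (profile_bound mu n + w_mass b * M + S * ?B)))"
      using b by (intro mult_nonneg_nonneg[of "1 / b"] add_nonneg_nonneg B R mult_nonneg_nonneg[OF R P0]) auto
    then show "?B \<le> ?B2" unfolding u_rate2_def by simp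
    with B show "0 \<le> ?B2" by linarith
  qed
  have qB: "norm (fq t) \<le> ?B2" if "t \<in> {0..S}" for t
    using qn[OF that] B unfolding u_rate2_def distrib_left by linarith
  have gK: "G.gK \<le> gK_bound mu n"
  proof -
    have "L2w_norm mu g3 \<le> Hw_norm mu 2 u0"
      unfolding Hw2_intro(2)[OF pb] by (rule real_le_rsqrt) simp
    then have "(L2w_norm mu g3)\<^sup>2 \<le> n\<^sup>2"
      using u0(2) by (intro power_mono L2w_norm_nonneg) simp
    then show ?thesis
      unfolding G.gK_def gK_bound_def zero_L2w(2) by (intro real_sqrt_le_mono mult_left_mono add_mono) auto
  qed
  have N0: "norm (bc u0) + norm (bc pb) + norm (const_bcontfun (1, 0, 0) :: real \<Rightarrow>\<^sub>C triple) \<le> 2 * profile_bound mu n + 1"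
  proof -
    have pb_le: "2 * embed_const mu * Hw_norm mu 2 u0 \<le> profile_bound mu n"
      unfolding profile_bound_def using u0(2) embed_const_pos[of mu] by (intro mult_left_mono) auto
    have "norm (bc u0) \<le> profile_bound mu n"
      by (intro norm_bcext_le[OF cb(1)]) (use sobolev_bound2(1)[OF pb] pb_le in force)+
    moreover have "norm (bc pb) \<le> profile_bound mu n"
      by (intro norm_bcext_le[OF cb(2)]) (use sobolev_bound2(2)[OF pb] pb_le in force)+
    ultimately show ?thesis using norm_unit_triples(1) by linarith
  qed
  have "regular_solution mu 2 S v1 v2 (\<lambda>t. apply_bcontfun (u t)) (eta_bound b S M n ?B2) (eta_rate_bound b n ?B2)"
    unfolding eta_bound_def eta_rate_bound_def
    by (rule G.evolution_Hw2[OF gK b S0 BB(2) cfu cfp cfq _ _ _ fu_ac fp_ac a0 N0 v vM u_eq])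
      (use nb BB(1) qB order_trans in blast)+
  with solves reg that show thesis by blast
qed

end

text \<open>The bound may depend on the existence time only. The existence time is therefore taken from a strictly
  decreasing sequence, so that it determines an upper bound for the norms of the data.\<close>

lemma uniform_time_constant:
  fixes N1 :: "'a \<Rightarrow> real" and N2 :: "'b \<Rightarrow> real" and P :: "real \<Rightarrow> real \<Rightarrow> 'a \<Rightarrow> 'b \<Rightarrow> bool"
  assumes T: "T > 0"
    and ex: "\<And>n::nat. \<exists>\<tau>>0. \<forall>S. 0 < S \<and> S \<le> \<tau> \<and> S \<le> T \<longrightarrow>
      (\<exists>K. \<forall>x\<in>A. \<forall>y\<in>B. N1 x \<le> real n \<and> N2 y \<le> real n \<longrightarrow> P S K x y)"
  shows "\<exists>(T0 :: real \<Rightarrow> real \<Rightarrow> real) (C :: real \<Rightarrow> real). \<forall>x\<in>A. \<forall>y\<in>B. Q x y \<longrightarrow>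
    (let S = T0 (N1 x) (N2 y) in 0 < S \<and> S \<le> T \<and> P S (C S) x y)"
proof -
  obtain \<tau> where \<tau>: "\<And>n. \<tau> n > 0" "\<And>n S. 0 < S \<Longrightarrow> S \<le> \<tau> n \<Longrightarrow> S \<le> T \<Longrightarrow>
      \<exists>K. \<forall>x\<in>A. \<forall>y\<in>B. N1 x \<le> real n \<and> N2 y \<le> real n \<longrightarrow> P S K x y"
    using ex by metis
  \<comment> \<open>The minimum over all indices up to \<open>n\<close> makes the times monotone;
    dividing by \<open>n + 1\<close> makes them strictly decreasing, hence injective.\<close>
  define m where "m n = Min (insert T (\<tau> ` {..n}))" for n
  define s where "s n = m n / real (Suc n)" for n
  have m_pos: "m n > 0" for n using T \<tau>(1) by (auto simp: m_def)
  have m_le: "m n \<le> T" "m n \<le> \<tau> n" for n unfolding m_def by (rule Min_le; auto)+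
  have s_pos: "s n > 0" for n using m_pos by (simp add: s_def)
  have s_le_m: "s n \<le> m n" for n using m_pos[of n] by (simp add: s_def divide_le_eq mult_le_cancel_left1)
  have dec: "s (Suc n) < s n" for n
  proof -
    have "m (Suc n) \<le> m n" unfolding m_def by (rule Min_antimono) auto
    then have "s (Suc n) \<le> m n / real (Suc (Suc n))" unfolding s_def by (intro divide_right_mono) auto
    also have "\<dots> < s n" unfolding s_def using m_pos[of n] by (intro divide_strict_left_mono) auto
    finally show ?thesis .
  qed
  have inj: "inj s"
  proof (rule injI)
    fix i j assume ij: "s i = s j"
    have "s k < s l" if "l < k" for k l using that dec by (rule lift_Suc_mono_less[where f="\<lambda>n. - s n", simplified, rotated])
    with ij show "i = j" by (metis less_irrefl linorder_neqE_nat)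
  qed
  have "\<exists>K. \<forall>x\<in>A. \<forall>y\<in>B. N1 x \<le> real n \<and> N2 y \<le> real n \<longrightarrow> P (s n) K x y" for n
    by (rule \<tau>(2)[OF s_pos order_trans[OF s_le_m m_le(2)] order_trans[OF s_le_m m_le(1)]])
  then obtain K where K: "\<And>n. \<forall>x\<in>A. \<forall>y\<in>B. N1 x \<le> real n \<and> N2 y \<le> real n \<longrightarrow> P (s n) (K n) x y"
    by metis
  define i where "i a b = nat \<lceil>max a b\<rceil>" for a b :: real
  have i: "a \<le> real (i a b)" "b \<le> real (i a b)" for a b
    unfolding i_def using real_nat_ceiling_ge[of "max a b"] by auto
  show ?thesis
  \<comment> \<open>Injectivity of \<open>s\<close> lets the constant be recovered from the
    existence time alone, as \<open>K (inv s S)\<close>.\<close>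
  proof (intro exI[of _ "\<lambda>a b. s (i a b)"] exI[of _ "\<lambda>S. K (inv s S)"] ballI impI)
    fix x y assume "x \<in> A" "y \<in> B"
    then have "P (s (i (N1 x) (N2 y))) (K (i (N1 x) (N2 y))) x y" using K i by blast
    then show "let S = s (i (N1 x) (N2 y)) in 0 < S \<and> S \<le> T \<and> P S (K (inv s S)) x y"
      using s_pos order_trans[OF s_le_m m_le(1)] by (simp add: inv_f_f[OF inj])
  qed
qed

lemma boundary_data_exists:
  assumes "continuous_on {0..T} h1" "continuous_on {0..T} h2" "continuous_on {0..T} v1" "continuous_on {0..T} v2"
  obtains M where "\<And>S. 0 \<le> S \<Longrightarrow> S \<le> T \<Longrightarrow> boundary_data S M h1 h2 v1 v2"
proof -
  have c: "continuous_on {0..T} (\<lambda>t. f t - f 0)" if "continuous_on {0..T} f" for f :: "real \<Rightarrow> real"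
    by (intro continuous_intros that)
  obtain M1 where M1: "\<And>t. t \<in> {0..T} \<Longrightarrow> \<bar>h1 t - h1 0\<bar> \<le> M1" using continuous_on_Icc_bounded[OF c[OF assms(1)]] by blast
  obtain M2 where M2: "\<And>t. t \<in> {0..T} \<Longrightarrow> \<bar>h2 t - h2 0\<bar> \<le> M2" using continuous_on_Icc_bounded[OF c[OF assms(2)]] by blast
  obtain M3 where M3: "\<And>t. t \<in> {0..T} \<Longrightarrow> \<bar>v1 t - v1 0\<bar> \<le> M3" using continuous_on_Icc_bounded[OF c[OF assms(3)]] by blast
  obtain M4 where M4: "\<And>t. t \<in> {0..T} \<Longrightarrow> \<bar>v2 t - v2 0\<bar> \<le> M4" using continuous_on_Icc_bounded[OF c[OF assms(4)]] by blast
  show thesis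
  proof (rule that[of "max (max M1 M2) (max M3 M4)"])
    fix S assume S: "0 \<le> S" "S \<le> T"
    then have sub: "{0..S} \<subseteq> {0..T}" by auto
    show "boundary_data S (max (max M1 M2) (max M3 M4)) h1 h2 v1 v2"
      by unfold_locales (use S M1 M2 M3 M4 assms sub in \<open>auto intro: continuous_on_subset simp: le_max_iff_disj\<close>)
  qed
qed

lemma small_time:
  assumes "0 < S" "S \<le> 1 / (2 * max L 0 + 1)"
  shows "S * L \<le> 1 / (2::real)"
proof -
  have "S * L \<le> S * max L 0" using assms by (intro mult_left_mono) auto
  also have "\<dots> \<le> 1 / (2 * max L 0 + 1) * max L 0" using assms by (intro mult_right_mono) auto
  also have "\<dots> \<le> 1 / 2" by (simp add: field_simps max_def)
  finally show ?thesis .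
qed

lemma regular_solution_bounds:
  assumes "regular_solution mu k S h1 h2 f X Y" "C1_interval S h1 \<and> C1_interval S h2 \<longrightarrow> C1_bounded S h1 h2 M" "X + \<bar>Y M\<bar> \<le> K"
  shows "f \<in> CHw mu k S" "CHw_norm mu k S f \<le> K"
    "C1_interval S h1 \<and> C1_interval S h2 \<longrightarrow>
      (\<exists>ft\<in>CHw mu k S. has_time_deriv mu k S f ft \<and> CHw_norm mu k S f + CHw_norm mu k S ft \<le> K)"
proof -
  show "f \<in> CHw mu k S" using assms(1) by (simp add: regular_solution_def)
  have X: "CHw_norm mu k S f \<le> X" using assms(1) by (simp add: regular_solution_def)
  with assms(3) show "CHw_norm mu k S f \<le> K" by linarith
  show "C1_interval S h1 \<and> C1_interval S h2 \<longrightarrow>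
      (\<exists>ft\<in>CHw mu k S. has_time_deriv mu k S f ft \<and> CHw_norm mu k S f + CHw_norm mu k S ft \<le> K)"
  proof
    assume "C1_interval S h1 \<and> C1_interval S h2"
    then obtain ft where "ft \<in> CHw mu k S" "has_time_deriv mu k S f ft" "CHw_norm mu k S ft \<le> Y M"
      using assms(1,2) unfolding regular_solution_def by blast
    moreover have "Y M \<le> \<bar>Y M\<bar>" by simp
    ultimately show "\<exists>ft\<in>CHw mu k S. has_time_deriv mu k S f ft \<and> CHw_norm mu k S f + CHw_norm mu k S ft \<le> K"
      using X assms(3) by (intro bexI[of _ ft]) auto
  qed
qed

definition well_posed ::
  "real \<Rightarrow> real \<Rightarrow> real \<Rightarrow> nat \<Rightarrow> (real \<Rightarrow> real) \<Rightarrow> (real \<Rightarrow> real) \<Rightarrow> (real \<Rightarrow> real) \<Rightarrow> (real \<Rightarrow> real) \<Rightarrow>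
    real \<Rightarrow> real \<Rightarrow> (real \<Rightarrow> real) \<Rightarrow> (real \<Rightarrow> real) \<Rightarrow> bool" where
  "well_posed mu b c k h1 h2 v1 v2 S K eta0 u0 \<longleftrightarrow> (\<exists>eta u.
            eta \<in> CHw mu 2 S \<and> u \<in> CHw mu k S \<and>
            solves_system b c S h1 h2 v1 v2 eta0 u0 eta u \<and>
            (\<forall>eta' u'. eta' \<in> CHw mu 2 S \<and> u' \<in> CHw mu k S \<and>
               solves_system b c S h1 h2 v1 v2 eta0 u0 eta' u' \<longrightarrow>
               (\<forall>t\<in>{0..S}. \<forall>x\<in>{-1..1}. eta' t x = eta t x \<and> u' t x = u t x)) \<and>
            CHw_norm mu 2 S eta \<le> K \<and> CHw_norm mu k S u \<le> K \<and>
            (C1_interval S h1 \<and> C1_interval S h2 \<longrightarrow>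
               (\<exists>eta_t\<in>CHw mu 2 S. has_time_deriv mu 2 S eta eta_t \<and>
                  CHw_norm mu 2 S eta + CHw_norm mu 2 S eta_t \<le> K)) \<and>
            (C1_interval S v1 \<and> C1_interval S v2 \<longrightarrow>
               (\<exists>u_t\<in>CHw mu k S. has_time_deriv mu k S u u_t \<and>
                  CHw_norm mu k S u + CHw_norm mu k S u_t \<le> K)))"

lemma (in weight_exponent) well_posedI:
  assumes b: "b > 0" and k: "k = 1 \<or> k = 2"
    and sol: "solves_system b c S h1 h2 v1 v2 eta0 u0 eta u"
    and reg: "regular_solution mu 2 S h1 h2 eta X1 Y1" "regular_solution mu k S v1 v2 u X2 Y2"
    and C: "C1_interval S h1 \<and> C1_interval S h2 \<longrightarrow> C1_bounded S h1 h2 M1"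
      "C1_interval S v1 \<and> C1_interval S v2 \<longrightarrow> C1_bounded S v1 v2 M2"
  shows "well_posed mu b c k h1 h2 v1 v2 S (max (X1 + \<bar>Y1 M1\<bar>) (X2 + \<bar>Y2 M2\<bar>)) eta0 u0"
proof -
  note r1 = regular_solution_bounds[OF reg(1) C(1) max.cobounded1[of "X1 + \<bar>Y1 M1\<bar>" "X2 + \<bar>Y2 M2\<bar>"]]
  note r2 = regular_solution_bounds[OF reg(2) C(2) max.cobounded2[of "X2 + \<bar>Y2 M2\<bar>" "X1 + \<bar>Y1 M1\<bar>"]]
  \<comment> \<open>Competitors in the smoother class also belong to \<open>CHw mu 1 S\<close>, so
    one uniqueness lemma covers both values of \<open>k\<close>.\<close>
  have k1: "f \<in> CHw mu 1 S" if "f \<in> CHw mu k S" for f using k that CHw2_imp_CHw1 by auto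
  have "eta' t x = eta t x \<and> u' t x = u t x"
    if "eta' \<in> CHw mu 2 S \<and> u' \<in> CHw mu k S \<and> solves_system b c S h1 h2 v1 v2 eta0 u0 eta' u'" "t \<in> {0..S}" "x \<in> {-1..1}"
    for eta' u' t x
    by (rule system_unique[OF b _ k1 r1(1) k1[OF r2(1)] _ sol that(2,3)]) (use that(1) in auto)
  then show ?thesis
    unfolding well_posed_def using sol r1 r2 by (intro exI[of _ eta] exI[of _ u] conjI) blast+
qed

theorem theorem2p2:
  fixes theta b c mu T :: real and h1 h2 v1 v2 :: "real \<Rightarrow> real"
  assumes "2 / 3 \<le> theta\<^sup>2" and "theta\<^sup>2 \<le> 1"
    and "b = (3 * theta\<^sup>2 - 1) / 6" and "c = (2 - 3 * theta\<^sup>2) / 3"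
    and "T > 0" and "-1 < mu" and "mu < 1"
    and "continuous_on {0..T} h1" and "continuous_on {0..T} h2"
    and "continuous_on {0..T} v1" and "continuous_on {0..T} v2"
  shows "(c < 0 \<longrightarrow> (\<exists>(T0 :: real \<Rightarrow> real \<Rightarrow> real) (C :: real \<Rightarrow> real).
      \<forall>eta0\<in>Hw mu 2. \<forall>u0\<in>Hw mu 1. compatible h1 h2 v1 v2 eta0 u0 \<longrightarrow>
        (let S = T0 (Hw_norm mu 2 eta0) (Hw_norm mu 1 u0) in
          0 < S \<and> S \<le> T \<and>
          (\<exists>eta u.
            eta \<in> CHw mu 2 S \<and> u \<in> CHw mu 1 S \<and>
            solves_system b c S h1 h2 v1 v2 eta0 u0 eta u \<and>
            (\<forall>eta' u'. eta' \<in> CHw mu 2 S \<and> u' \<in> CHw mu 1 S \<and>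
               solves_system b c S h1 h2 v1 v2 eta0 u0 eta' u' \<longrightarrow>
               (\<forall>t\<in>{0..S}. \<forall>x\<in>{-1..1}. eta' t x = eta t x \<and> u' t x = u t x)) \<and>
            CHw_norm mu 2 S eta \<le> C S \<and> CHw_norm mu 1 S u \<le> C S \<and>
            (C1_interval S h1 \<and> C1_interval S h2 \<longrightarrow>
               (\<exists>eta_t\<in>CHw mu 2 S. has_time_deriv mu 2 S eta eta_t \<and>
                  CHw_norm mu 2 S eta + CHw_norm mu 2 S eta_t \<le> C S)) \<and>
            (C1_interval S v1 \<and> C1_interval S v2 \<longrightarrow>
               (\<exists>u_t\<in>CHw mu 1 S. has_time_deriv mu 1 S u u_t \<and>
                  CHw_norm mu 1 S u + CHw_norm mu 1 S u_t \<le> C S)))))) \<and>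
   (c = 0 \<longrightarrow> (\<exists>(T0 :: real \<Rightarrow> real \<Rightarrow> real) (C :: real \<Rightarrow> real).
      \<forall>eta0\<in>Hw mu 2. \<forall>u0\<in>Hw mu 2. compatible h1 h2 v1 v2 eta0 u0 \<longrightarrow>
        (let S = T0 (Hw_norm mu 2 eta0) (Hw_norm mu 2 u0) in
          0 < S \<and> S \<le> T \<and>
          (\<exists>eta u.
            eta \<in> CHw mu 2 S \<and> u \<in> CHw mu 2 S \<and>
            solves_system b c S h1 h2 v1 v2 eta0 u0 eta u \<and>
            (\<forall>eta' u'. eta' \<in> CHw mu 2 S \<and> u' \<in> CHw mu 2 S \<and>
               solves_system b c S h1 h2 v1 v2 eta0 u0 eta' u' \<longrightarrow>
               (\<forall>t\<in>{0..S}. \<forall>x\<in>{-1..1}. eta' t x = eta t x \<and> u' t x = u t x)) \<and>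
            CHw_norm mu 2 S eta \<le> C S \<and> CHw_norm mu 2 S u \<le> C S \<and>
            (C1_interval S h1 \<and> C1_interval S h2 \<longrightarrow>
               (\<exists>eta_t\<in>CHw mu 2 S. has_time_deriv mu 2 S eta eta_t \<and>
                  CHw_norm mu 2 S eta + CHw_norm mu 2 S eta_t \<le> C S)) \<and>
            (C1_interval S v1 \<and> C1_interval S v2 \<longrightarrow>
               (\<exists>u_t\<in>CHw mu 2 S. has_time_deriv mu 2 S u u_t \<and>
                  CHw_norm mu 2 S u + CHw_norm mu 2 S u_t \<le> C S))))))"
proof -
  have b: "b > 0" using assms(1,3) by simp
  interpret weight_exponent mu by unfold_locales (use assms in auto)
  obtain M where bd: "\<And>S. 0 \<le> S \<Longrightarrow> S \<le> T \<Longrightarrow> boundary_data S M h1 h2 v1 v2"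
    using boundary_data_exists[OF assms(8-11)] by blast
  have "\<exists>(T0 :: real \<Rightarrow> real \<Rightarrow> real) (C :: real \<Rightarrow> real). \<forall>eta0\<in>Hw mu 2. \<forall>u0\<in>Hw mu 1. compatible h1 h2 v1 v2 eta0 u0 \<longrightarrow>
    (let S = T0 (Hw_norm mu 2 eta0) (Hw_norm mu 1 u0) in 0 < S \<and> S \<le> T \<and> well_posed mu b c 1 h1 h2 v1 v2 S (C S) eta0 u0)"
  proof (rule uniform_time_constant[OF assms(5), where P="well_posed mu b c 1 h1 h2 v1 v2"])
    fix n :: nat
    let ?L = "lip_bound b c mu M n"
    show "\<exists>\<tau>>0. \<forall>S. 0 < S \<and> S \<le> \<tau> \<and> S \<le> T \<longrightarrow> (\<exists>K. \<forall>x\<in>Hw mu 2. \<forall>y\<in>Hw mu 1.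
      Hw_norm mu 2 x \<le> real n \<and> Hw_norm mu 1 y \<le> real n \<longrightarrow> well_posed mu b c 1 h1 h2 v1 v2 S K x y)"
    \<comment> \<open>The maximum with 0 and the added 1 keep the denominator positive before the
      sign of the Lipschitz constant is known; up to this time \<open>S * ?L \<le> 1 / 2\<close>
      holds.\<close>
    proof (rule exI[of _ "1 / (2 * max ?L 0 + 1)"], intro conjI allI impI)
      fix S assume S: "0 < S \<and> S \<le> 1 / (2 * max ?L 0 + 1) \<and> S \<le> T"
      \<comment> \<open>Fixed before the initial data, so that the resulting constant depends on
        \<open>S\<close>, \<open>n\<close> and the boundary data only.\<close>
      obtain M1 where M1: "C1_interval S h1 \<and> C1_interval S h2 \<longrightarrow> C1_bounded S h1 h2 M1" using C1_interval_pair_bounded by blast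
      obtain M2 where M2: "C1_interval S v1 \<and> C1_interval S v2 \<longrightarrow> C1_bounded S v1 v2 M2" using C1_interval_pair_bounded by blast
      show "\<exists>K. \<forall>x\<in>Hw mu 2. \<forall>y\<in>Hw mu 1.
        Hw_norm mu 2 x \<le> real n \<and> Hw_norm mu 1 y \<le> real n \<longrightarrow> well_posed mu b c 1 h1 h2 v1 v2 S K x y"
      proof (intro exI ballI impI)
        fix eta0 u0 assume d: "eta0 \<in> Hw mu 2" "u0 \<in> Hw mu 1" "Hw_norm mu 2 eta0 \<le> real n \<and> Hw_norm mu 1 u0 \<le> real n"
        have bdS: "boundary_data S M h1 h2 v1 v2" and sm: "S * ?L \<le> 1 / 2"
          using S bd small_time[of S ?L] by auto
        show "well_posed mu b c 1 h1 h2 v1 v2 S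
          (max (eta_bound b S M n (rate_bound b c mu M n) + \<bar>eta_rate_bound b n (rate_bound b c mu M n) M1\<bar>)
            (u_bound b S M n (rate_bound b c mu M n) + \<bar>u_rate_bound b n (rate_bound b c mu M n) M2\<bar>)) eta0 u0"
        proof (rule local_solution_Hw1[OF bdS b sm d(1) _ d(2)], goal_cases)
          case (3 e r u)
          show ?case by (rule well_posedI[OF b _ 3(1-3) M1 M2]) simp
        qed (use d(3) in auto)
      qed
    qed (simp add: add_nonneg_pos)
  qed
  moreover have "\<exists>(T0 :: real \<Rightarrow> real \<Rightarrow> real) (C :: real \<Rightarrow> real). \<forall>eta0\<in>Hw mu 2. \<forall>u0\<in>Hw mu 2. compatible h1 h2 v1 v2 eta0 u0 \<longrightarrow>
    (let S = T0 (Hw_norm mu 2 eta0) (Hw_norm mu 2 u0) in 0 < S \<and> S \<le> T \<and> well_posed mu b c 2 h1 h2 v1 v2 S (C S) eta0 u0)"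
    if c: "c = 0"
  proof (rule uniform_time_constant[OF assms(5), where P="well_posed mu b c 2 h1 h2 v1 v2"])
    fix n :: nat
    let ?L = "lip_bound b 0 mu M n" and ?B = "rate_bound b 0 mu M n"
    show "\<exists>\<tau>>0. \<forall>S. 0 < S \<and> S \<le> \<tau> \<and> S \<le> T \<longrightarrow> (\<exists>K. \<forall>x\<in>Hw mu 2. \<forall>y\<in>Hw mu 2.
      Hw_norm mu 2 x \<le> real n \<and> Hw_norm mu 2 y \<le> real n \<longrightarrow> well_posed mu b c 2 h1 h2 v1 v2 S K x y)"
    proof (rule exI[of _ "1 / (2 * max ?L 0 + 1)"], intro conjI allI impI)
      fix S assume S: "0 < S \<and> S \<le> 1 / (2 * max ?L 0 + 1) \<and> S \<le> T"
      obtain M1 where M1: "C1_interval S h1 \<and> C1_interval S h2 \<longrightarrow> C1_bounded S h1 h2 M1" using C1_interval_pair_bounded by blast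
      obtain M2 where M2: "C1_interval S v1 \<and> C1_interval S v2 \<longrightarrow> C1_bounded S v1 v2 M2" using C1_interval_pair_bounded by blast
      show "\<exists>K. \<forall>x\<in>Hw mu 2. \<forall>y\<in>Hw mu 2.
        Hw_norm mu 2 x \<le> real n \<and> Hw_norm mu 2 y \<le> real n \<longrightarrow> well_posed mu b c 2 h1 h2 v1 v2 S K x y"
      proof (intro exI ballI impI)
        fix eta0 u0 assume d: "eta0 \<in> Hw mu 2" "u0 \<in> Hw mu 2" "Hw_norm mu 2 eta0 \<le> real n \<and> Hw_norm mu 2 u0 \<le> real n"
        have bdS: "boundary_data S M h1 h2 v1 v2" and sm: "S * ?L \<le> 1 / 2"
          using S bd small_time[of S ?L] by auto
        show "well_posed mu b c 2 h1 h2 v1 v2 S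
          (max (eta_bound b S M n ?B + \<bar>eta_rate_bound b n ?B M1\<bar>)
            (eta_bound b S M n (u_rate2 b S M n ?B) + \<bar>eta_rate_bound b n (u_rate2 b S M n ?B) M2\<bar>)) eta0 u0"
          unfolding c
        proof (rule local_solution_Hw2[OF bdS b sm d(1) _ d(2)], goal_cases)
          case (3 eta u)
          show ?case by (rule well_posedI[OF b _ 3 M1 M2]) simp
        qed (use d(3) in auto)
      qed
    qed (simp add: add_nonneg_pos)
  qed
  ultimately show ?thesis
    unfolding well_posed_def by blast
qed

end
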